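(* Let $C$ be a generic curve on a surface $S$ realizing the homology class dual to the first Stiefel--Whitney class $w_1(S)\in H^1(S;\mathbb Z/2\mathbb Z)$. Then the chord diagram of $C$ is orientable.
   Context: A generic curve on a surface $S$ (orientable or not) is the image of a generic immersion of a closed 1-manifold to $S$, i.e. an immersion whose multiple points are transversal double points only. Its chord diagram consists of the source 1-manifold (the base) and, for each double point, a chord connecting the two points of the base mapped to it. The curve is considered as a 1-cycle with coefficients in $\mathbb Z/2\mathbb Z$; it realizes the class (Poincaré) dual to $w_1(S)$ if for each loop on $S$ in general position to the curve, the value of $w_1(S)$ on the loop equals the number of intersection points of the loop and the curve modulo 2. Orientation of a chord diagram: the end points of chords divide the base into arcs. An orientation of the chord diagram is a choice of orientations of all these arcs such that (1) at each end point of a chord the orientations of the two adjacent arcs do not extend over the point: either both arcs are directed towards the point (the point is attractive) or both are directed away from it (the point is repulsive); (2) for each chord, one of its end points is attractive and the other one is repulsive. A chord diagram is orientable if it admits an orientation. *)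

theory Defs
  imports "HOL-Analysis.Analysis" "HOL-Library.Z2"
begin

subsection \<open>Smooth manifolds\<close>

text \<open>
  \<open>C_diff_on k U f\<close>: \<open>f\<close> is of class \<open>C\<^sup>k\<close> on \<open>U\<close>. It is used for open \<open>U\<close> in a
  Euclidean space only, where being \<open>C\<^sup>k\<^sup>+\<^sup>1\<close> amounts to being differentiable with all
  directional derivatives of class \<open>C\<^sup>k\<close>.
\<close>

primrec C_diff_on ::
  "nat \<Rightarrow> 'b::real_normed_vector set \<Rightarrow> ('b \<Rightarrow> 'c::real_normed_vector) \<Rightarrow> bool" where
  "C_diff_on 0 U f \<longleftrightarrow> continuous_on U f"
| "C_diff_on (Suc k) U f \<longleftrightarrow>
     (\<forall>x\<in>U. f differentiable at x) \<and>
     (\<forall>v. C_diff_on k U (\<lambda>x. frechet_derivative f (at x) v))"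

definition smooth_on ::
  "'b::real_normed_vector set \<Rightarrow> ('b \<Rightarrow> 'c::real_normed_vector) \<Rightarrow> bool" where
  "smooth_on U f \<longleftrightarrow> (\<forall>k. C_diff_on k U f)"

type_synonym ('m, 'b) chart = "'m set \<times> ('m \<Rightarrow> 'b)"

abbreviation cdom :: "('m, 'b) chart \<Rightarrow> 'm set" where
  "cdom c \<equiv> fst c"

abbreviation cmap :: "('m, 'b) chart \<Rightarrow> 'm \<Rightarrow> 'b" where
  "cmap c \<equiv> snd c"

definition cinv :: "('m, 'b) chart \<Rightarrow> 'b \<Rightarrow> 'm" where
  "cinv c = inv_into (cdom c) (cmap c)"

text \<open>
  A manifold is a subset \<open>M\<close> of a second countable Hausdorff space, with the subspace topology,
  together with an atlas (not assumed to be maximal). There is no boundary, since charts have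
  open images in the model space. The model space is \<^typ>\<open>real^2\<close> for surfaces and
  \<^typ>\<open>real\<close> for 1-manifolds.
\<close>

definition smooth_manifold ::
  "'m::{t2_space, second_countable_topology} set \<Rightarrow> ('m, 'b::euclidean_space) chart set \<Rightarrow> bool"
where
  "smooth_manifold M A \<longleftrightarrow>
     (\<Union>c\<in>A. cdom c) = M \<and>
     (\<forall>c\<in>A. openin (top_of_set M) (cdom c) \<and> open (cmap c ` cdom c) \<and>
        homeomorphism (cdom c) (cmap c ` cdom c) (cmap c) (cinv c)) \<and>
     (\<forall>c\<in>A. \<forall>d\<in>A. smooth_on (cmap c ` (cdom c \<inter> cdom d)) (cmap d \<circ> cinv c))"

definition smooth_map ::
  "'m::topological_space set \<Rightarrow> ('m, 'b::euclidean_space) chart set \<Rightarrow>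
   'n::topological_space set \<Rightarrow> ('n, 'c::euclidean_space) chart set \<Rightarrow> ('m \<Rightarrow> 'n) \<Rightarrow> bool"
where
  "smooth_map M A N A' f \<longleftrightarrow>
     continuous_on M f \<and> f ` M \<subseteq> N \<and>
     (\<forall>c\<in>A. \<forall>d\<in>A'. smooth_on (cmap c ` (cdom c \<inter> f -` cdom d)) (cmap d \<circ> f \<circ> cinv c))"

text \<open>
  For a map \<open>f\<close> from a 1-manifold, the image under \<open>df\<close> of the unit tangent vector of the
  chart \<open>c\<close> at \<open>x\<close>, written in the chart \<open>d\<close>.
\<close>

definition velocity ::
  "('m, real) chart \<Rightarrow> ('m \<Rightarrow> 'n) \<Rightarrow> ('n, 'b::real_normed_vector) chart \<Rightarrow> 'm \<Rightarrow> 'b" where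
  "velocity c f d x = vector_derivative (cmap d \<circ> f \<circ> cinv c) (at (cmap c x))"


subsection \<open>Generic curves\<close>

definition immersion_1 ::
  "'m::topological_space set \<Rightarrow> ('m, real) chart set \<Rightarrow>
   's::topological_space set \<Rightarrow> ('s, 'b::euclidean_space) chart set \<Rightarrow> ('m \<Rightarrow> 's) \<Rightarrow> bool"
where
  "immersion_1 B AB S AS f \<longleftrightarrow>
     smooth_map B AB S AS f \<and>
     (\<forall>c\<in>AB. \<forall>d\<in>AS. \<forall>x \<in> cdom c. f x \<in> cdom d \<longrightarrow> velocity c f d x \<noteq> 0)"

text \<open>
  Two maps from 1-manifolds passing through the same point of a surface at \<open>x\<close> and \<open>y\<close> are
  transversal there if the images of the two tangent lines span the tangent plane.
\<close>

definition transversal_at ::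
  "('s, real^2) chart set \<Rightarrow> ('m, real) chart set \<Rightarrow> ('m \<Rightarrow> 's) \<Rightarrow> 'm \<Rightarrow>
   ('n, real) chart set \<Rightarrow> ('n \<Rightarrow> 's) \<Rightarrow> 'n \<Rightarrow> bool"
where
  "transversal_at AS A f x A' g y \<longleftrightarrow>
     (\<forall>d\<in>AS. \<forall>c\<in>A. \<forall>c'\<in>A'. f x \<in> cdom d \<longrightarrow> x \<in> cdom c \<longrightarrow> y \<in> cdom c' \<longrightarrow>
        span {velocity c f d x, velocity c' g d y} = UNIV)"

definition generic_immersion ::
  "'m::{t2_space, second_countable_topology} set \<Rightarrow> ('m, real) chart set \<Rightarrow>
   's::{t2_space, second_countable_topology} set \<Rightarrow> ('s, real^2) chart set \<Rightarrow> ('m \<Rightarrow> 's) \<Rightarrow> bool"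
where
  "generic_immersion B AB S AS f \<longleftrightarrow>
     immersion_1 B AB S AS f \<and>
     (\<forall>x\<in>B. \<forall>y\<in>B. \<forall>z\<in>B. f x = f y \<longrightarrow> f y = f z \<longrightarrow> x = y \<or> y = z \<or> x = z) \<and>
     (\<forall>x\<in>B. \<forall>y\<in>B. x \<noteq> y \<longrightarrow> f x = f y \<longrightarrow> transversal_at AS AB f x AB f y)"


subsection \<open>Loops and the first Stiefel--Whitney class\<close>

definition line_atlas :: "(real, real) chart set" where
  "line_atlas = {(UNIV, id)}"

text \<open>Loops are smooth maps from the circle \<open>\<real> / \<int>\<close>, given as 1-periodic maps on \<open>\<real>\<close>.\<close>

definition smooth_loop ::
  "'s::topological_space set \<Rightarrow> ('s, real^2) chart set \<Rightarrow> (real \<Rightarrow> 's) \<Rightarrow> bool" where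
  "smooth_loop S AS \<gamma> \<longleftrightarrow> smooth_map UNIV line_atlas S AS \<gamma> \<and> (\<forall>t. \<gamma> (t + 1) = \<gamma> t)"

definition general_position ::
  "'m set \<Rightarrow> ('m, real) chart set \<Rightarrow> ('s, real^2) chart set \<Rightarrow> ('m \<Rightarrow> 's) \<Rightarrow> (real \<Rightarrow> 's) \<Rightarrow> bool"
where
  "general_position B AB AS f \<gamma> \<longleftrightarrow>
     (\<forall>t. \<forall>x\<in>B. \<gamma> t = f x \<longrightarrow>
        transversal_at AS line_atlas \<gamma> t AB f x \<and> (\<forall>y\<in>B. f y = f x \<longrightarrow> y = x))"

text \<open>
  \<open>w\<^sub>1\<close> of the tangent bundle is represented by the Cech cocycle with coefficients in
  \<open>\<int>/2\<int>\<close> which assigns to two overlapping charts the sign of the determinant of the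
  transition function of the tangent bundle. It is evaluated on a loop by subdividing the loop
  into segments, each contained in the domain of one chart, and summing the cocycle over the
  (cyclically ordered) consecutive pairs of charts. The sum does not depend on the choices.
\<close>

definition w1_cocycle :: "('s, real^2) chart \<Rightarrow> ('s, real^2) chart \<Rightarrow> 's \<Rightarrow> bit" where
  "w1_cocycle c d p =
     (if det (jacobian (cmap d \<circ> cinv c) (at (cmap c p))) < 0 then 1 else 0)"

definition chart_subdivision ::
  "('s, real^2) chart set \<Rightarrow> (real \<Rightarrow> 's) \<Rightarrow> nat \<Rightarrow> (nat \<Rightarrow> real) \<Rightarrow> (nat \<Rightarrow> ('s, real^2) chart) \<Rightarrow> bool"
where
  "chart_subdivision AS \<gamma> n t c \<longleftrightarrow>
     n > 0 \<and> t 0 = 0 \<and> t n = 1 \<and>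
     (\<forall>i<n. t i < t (Suc i) \<and> c i \<in> AS \<and> \<gamma> ` {t i..t (Suc i)} \<subseteq> cdom (c i))"

definition w1_on_loop :: "('s, real^2) chart set \<Rightarrow> (real \<Rightarrow> 's) \<Rightarrow> bit" where
  "w1_on_loop AS \<gamma> =
     (THE v. \<exists>n t c. chart_subdivision AS \<gamma> n t c \<and>
        v = (\<Sum>i<n. w1_cocycle (c i) (c (Suc i mod n)) (\<gamma> (t (Suc i)))))"

text \<open>
  Intersection points are counted by their parameters in the fundamental domain \<open>[0, 1)\<close> of the
  circle, i.e. with multiplicity if the loop passes several times through a point of the curve.
\<close>

definition dual_to_w1 ::
  "'m set \<Rightarrow> ('m, real) chart set \<Rightarrow>
   's::topological_space set \<Rightarrow> ('s, real^2) chart set \<Rightarrow> ('m \<Rightarrow> 's) \<Rightarrow> bool"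
where
  "dual_to_w1 B AB S AS f \<longleftrightarrow>
     (\<forall>\<gamma>. smooth_loop S AS \<gamma> \<longrightarrow> general_position B AB AS f \<gamma> \<longrightarrow>
        w1_on_loop AS \<gamma> = of_nat (card {t \<in> {0..<1}. \<gamma> t \<in> f ` B}))"


subsection \<open>Chord diagrams\<close>

text \<open>
  A chord diagram is given by its base and the set of its chords, a chord being identified with
  the set of its two end points.
\<close>

definition chords :: "'m set \<Rightarrow> ('m \<Rightarrow> 's) \<Rightarrow> 'm set set" where
  "chords B f = {{x, y} | x y. x \<in> B \<and> y \<in> B \<and> x \<noteq> y \<and> f x = f y}"

text \<open>
  An orientation of a 1-manifold is encoded by a locally constant sign for each chart:
  \<open>\<omega> c x = 1\<close> if near \<open>x\<close> the coordinate \<open>cmap c\<close> increases in the direction of the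
  orientation, and \<open>\<omega> c x = -1\<close> if it decreases.
\<close>

definition orients ::
  "('m::topological_space, real) chart set \<Rightarrow> 'm set \<Rightarrow> (('m, real) chart \<Rightarrow> 'm \<Rightarrow> real) \<Rightarrow> bool"
where
  "orients AB a \<omega> \<longleftrightarrow>
     (\<forall>c\<in>AB. continuous_on (a \<inter> cdom c) (\<omega> c) \<and> \<omega> c ` (a \<inter> cdom c) \<subseteq> {1, -1}) \<and>
     (\<forall>c\<in>AB. \<forall>d\<in>AB. \<forall>x \<in> a \<inter> cdom c \<inter> cdom d.
        \<omega> d x = sgn (deriv (cmap d \<circ> cinv c) (cmap c x)) * \<omega> c x)"

definition attractive ::
  "'m::topological_space set \<Rightarrow> ('m, real) chart set \<Rightarrow> (('m, real) chart \<Rightarrow> 'm \<Rightarrow> real) \<Rightarrow> 'm \<Rightarrow> bool"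
where
  "attractive B AB \<omega> p \<longleftrightarrow>
     (\<forall>c\<in>AB. p \<in> cdom c \<longrightarrow>
        (\<forall>\<^sub>F x in at p within B. \<omega> c x = (if cmap c x < cmap c p then 1 else -1)))"

definition repulsive ::
  "'m::topological_space set \<Rightarrow> ('m, real) chart set \<Rightarrow> (('m, real) chart \<Rightarrow> 'm \<Rightarrow> real) \<Rightarrow> 'm \<Rightarrow> bool"
where
  "repulsive B AB \<omega> p \<longleftrightarrow>
     (\<forall>c\<in>AB. p \<in> cdom c \<longrightarrow>
        (\<forall>\<^sub>F x in at p within B. \<omega> c x = (if cmap c x < cmap c p then -1 else 1)))"

text \<open>
  The arcs are the components of the complement of the set \<open>\<Union>K\<close> of end points of chords. They
  are disjoint, so one sign function \<open>\<omega>\<close> holds the independently chosen orientations of all arcs.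
\<close>

definition chord_diagram_orientation ::
  "'m::topological_space set \<Rightarrow> ('m, real) chart set \<Rightarrow> 'm set set \<Rightarrow>
   (('m, real) chart \<Rightarrow> 'm \<Rightarrow> real) \<Rightarrow> bool"
where
  "chord_diagram_orientation B AB K \<omega> \<longleftrightarrow>
     (\<forall>a \<in> components (B - \<Union>K). orients AB a \<omega>) \<and>
     (\<forall>p \<in> \<Union>K. attractive B AB \<omega> p \<or> repulsive B AB \<omega> p) \<and>
     (\<forall>k\<in>K. \<exists>p q. k = {p, q} \<and> attractive B AB \<omega> p \<and> repulsive B AB \<omega> q)"

definition orientable_chord_diagram ::
  "'m::topological_space set \<Rightarrow> ('m, real) chart set \<Rightarrow> 'm set set \<Rightarrow> bool" where
  "orientable_chord_diagram B AB K \<longleftrightarrow> (\<exists>\<omega>. chord_diagram_orientation B AB K \<omega>)"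

end

theory Submission
  imports Defs
begin

text \<open>
  Transport an orientation of the surface along paths in general position to the curve and reverse
  it at each crossing. Around a loop the orientation is reversed \<open>w\<^sub>1\<close> times by the surface and once
  at each crossing, and by duality the total is even (\<open>joins_loop\<close>). Hence the complement of the
  curve carries an orientation that is reversed on crossing the curve (\<open>flip_orientation\<close>). The
  regions on the two sides of an arc of the curve then induce the same boundary orientation on the
  arc, and this is how the arcs of the chord diagram are oriented (\<open>arc_sign\<close>).

  At a double point the two branches cut a neighbourhood into four sectors, and relative to a local
  orientation the flip orientation alternates between them. Follow one branch: the sectors on its
  left before and after the double point have opposite values, so the boundary orientation changes
  and does not extend over the point. In coordinates with the branches as axes, the first quadrant
  being positive, the halves of the horizontal axis are directed away from the origin and those of
  the vertical axis towards it: one end of the chord is repulsive, the other one attractive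
  (\<open>left_value_at_double_point\<close>, \<open>chord_ends\<close>).

  Three choices keep the analysis elementary. First, \<open>w\<^sub>1\<close> of a loop is computed from a lift of the
  loop to the orientation covering (\<open>w1_on_loop_eq_lift\<close>); lifts can be glued and reversed
  with ease, and they make the independence of the subdivision evident. Second, paths rest at
  their ends, so that their concatenations are smooth, and apart from constant paths only segments
  in charts are needed (\<open>flip_in_chart_segment\<close>, \<open>flip_in_chart_cross\<close>). Third, near a point the curve is not
  straightened: it lies in thin cones around the tangents of its branches, and the sectors
  between the cones are convex, so that segments suffice there (\<open>sector_value_exists\<close>). Only for the
  passage from a point to its neighbours along a branch is a finer estimate needed
  (\<open>branch_clearance\<close>).
\<close>

section \<open>Calculus of \<open>C\<^sup>k\<close> maps\<close>

lemma C_diff_on_cong: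
  assumes "open U" "\<And>x. x \<in> U \<Longrightarrow> f x = g x"
  shows "C_diff_on k U f \<longleftrightarrow> C_diff_on k U g"
  using assms(2)
proof (induction k arbitrary: f g)
  case 0
  then show ?case by (auto cong: continuous_on_cong)
next
  case (Suc k)
  have d: "f differentiable at x \<longleftrightarrow> g differentiable at x" if "x \<in> U" for x
    using Suc.prems that assms(1)
    by (metis differentiable_def has_derivative_transform_within_open)
  have fr: "frechet_derivative f (at x) = frechet_derivative g (at x)" if "x \<in> U" for x
  proof -
    have "(f has_derivative D) (at x) \<longleftrightarrow> (g has_derivative D) (at x)" for D
      using Suc.prems that assms(1) by (metis has_derivative_transform_within_open)
    then show ?thesis by (simp add: frechet_derivative_def)
  qed
  have "C_diff_on k U (\<lambda>x. frechet_derivative f (at x) v) \<longleftrightarrow>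
        C_diff_on k U (\<lambda>x. frechet_derivative g (at x) v)" for v
    by (rule Suc.IH) (simp add: fr)
  with d show ?case by auto
qed

lemma C_diff_on_subset: "C_diff_on k U f \<Longrightarrow> V \<subseteq> U \<Longrightarrow> C_diff_on k V f"
proof (induction k arbitrary: f)
  case 0
  then show ?case using continuous_on_subset by auto
next
  case (Suc k)
  then show ?case by (metis C_diff_on.simps(2) subsetD)
qed

lemma C_diff_on_local:
  assumes "\<And>x. x \<in> U \<Longrightarrow> \<exists>V. open V \<and> x \<in> V \<and> C_diff_on k V f"
  shows "C_diff_on k U f"
  using assms
proof (induction k arbitrary: f)
  case 0
  then have "isCont f x" if "x \<in> U" for x
    using that by (metis C_diff_on.simps(1) continuous_on_eq_continuous_at)
  then show ?case by (simp add: continuous_at_imp_continuous_on)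
next
  case (Suc k)
  then have "C_diff_on k U (\<lambda>x. frechet_derivative f (at x) v)" for v
    by (intro Suc.IH) (metis C_diff_on.simps(2))
  with Suc.prems show ?case by (metis C_diff_on.simps(2))
qed

lemma C_diff_on_Suc_imp: "C_diff_on (Suc k) U f \<Longrightarrow> C_diff_on k U f"
proof (induction k arbitrary: f)
  case 0
  then show ?case
    by (auto intro!: continuous_at_imp_continuous_on differentiable_imp_continuous_within)
next
  case (Suc k)
  then show ?case by (metis C_diff_on.simps(2))
qed

lemma C_diff_on_SucI:
  assumes "open U" "\<And>x. x \<in> U \<Longrightarrow> (f has_derivative D x) (at x)"
    and "\<And>v. C_diff_on k U (\<lambda>x. D x v)"
  shows "C_diff_on (Suc k) U f"
proof -
  have fr: "frechet_derivative f (at x) = D x" if "x \<in> U" for x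
    using frechet_derivative_at[OF assms(2)[OF that]] by simp
  have "C_diff_on k U (\<lambda>x. frechet_derivative f (at x) v)" for v
    using C_diff_on_cong[OF assms(1), of "\<lambda>x. frechet_derivative f (at x) v" "\<lambda>x. D x v"]
      assms(3)[of v] by (simp add: fr)
  then show ?thesis using assms(2) by (auto simp: differentiable_def)
qed

lemma C_diff_on_SucD:
  assumes "C_diff_on (Suc k) U f"
  shows "\<And>x. x \<in> U \<Longrightarrow> (f has_derivative frechet_derivative f (at x)) (at x)"
    and "\<And>v. C_diff_on k U (\<lambda>x. frechet_derivative f (at x) v)"
  using assms by (auto simp: frechet_derivative_works)

lemma C_diff_on_const: "C_diff_on k U (\<lambda>x. a)"
proof (induction k arbitrary: a)
  case (Suc k)
  have "frechet_derivative (\<lambda>x::'a. a) (at x) = (\<lambda>v. 0)" for x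
    by (simp add: frechet_derivative_const)
  then show ?case using Suc[of 0] by simp
qed simp

lemma C_diff_on_add:
  assumes "open U" "C_diff_on k U f" "C_diff_on k U g"
  shows "C_diff_on k U (\<lambda>x. f x + g x)"
  using assms(2,3)
proof (induction k arbitrary: f g)
  case (Suc k)
  note f = C_diff_on_SucD[OF Suc.prems(1)] and g = C_diff_on_SucD[OF Suc.prems(2)]
  show ?case
    by (rule C_diff_on_SucI[OF assms(1) has_derivative_add[OF f(1) g(1)]])
      (auto intro: Suc.IH f g)
qed (simp add: continuous_on_add)

lemma C_diff_on_scaleR:
  assumes "open U" "C_diff_on k U a" "C_diff_on k U f"
  shows "C_diff_on k U (\<lambda>x. a x *\<^sub>R f x)"
  using assms(2,3)
proof (induction k arbitrary: a f)
  case (Suc k)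
  note a = C_diff_on_SucD[OF Suc.prems(1)] and f = C_diff_on_SucD[OF Suc.prems(2)]
  show ?case
  proof (rule C_diff_on_SucI[OF assms(1) has_derivative_scaleR[OF a(1) f(1)]])
    fix v
    show "C_diff_on k U (\<lambda>x. a x *\<^sub>R frechet_derivative f (at x) v
                              + frechet_derivative a (at x) v *\<^sub>R f x)"
      using Suc.prems[THEN C_diff_on_Suc_imp] by (intro C_diff_on_add assms(1) Suc.IH a f)
  qed
qed (simp add: continuous_on_scaleR)

lemma open_line_preimage:
  fixes y u :: "'b::real_normed_vector" and \<phi> :: "real \<Rightarrow> real"
  assumes "C_diff_on k UNIV \<phi>" "open U"
  shows "open {t. y + \<phi> t *\<^sub>R u \<in> U}"
proof -
  have "C_diff_on 0 UNIV \<phi>"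
    using assms(1) by (induction k) (use C_diff_on_Suc_imp in blast)+
  then have "continuous_on UNIV (\<lambda>t. y + \<phi> t *\<^sub>R u)"
    by (auto intro!: continuous_intros)
  from open_vimage[OF assms(2) this] show ?thesis by (simp add: vimage_def)
qed

text \<open>
  Compositions \<open>g \<circ> h\<close> are only taken with curves \<open>h\<close> that run along a straight line: their
  velocity \<open>\<phi>' t *\<^sub>R u\<close> has a constant direction, so that the chain rule produces a single
  directional derivative of \<open>g\<close> and the induction closes. Affine changes of the parameter are the
  case of a one-dimensional domain.
\<close>

lemma C_diff_on_compose_line:
  fixes g :: "'b::real_normed_vector \<Rightarrow> 'c::real_normed_vector" and \<phi> :: "real \<Rightarrow> real"
  assumes "open U" "C_diff_on k U g" "smooth_on UNIV \<phi>"
  shows "C_diff_on k {t. y + \<phi> t *\<^sub>R u \<in> U} (\<lambda>t. g (y + \<phi> t *\<^sub>R u))"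
  using assms(2)
proof (induction k arbitrary: g)
  case 0
  have "continuous_on UNIV \<phi>" using assms(3) by (metis C_diff_on.simps(1) smooth_on_def)
  then have "continuous_on {t. y + \<phi> t *\<^sub>R u \<in> U} (\<lambda>t. y + \<phi> t *\<^sub>R u)"
    using continuous_on_subset[of UNIV \<phi>] by (intro continuous_intros) auto
  from continuous_on_compose2[OF _ this, of U g] 0 show ?case by auto
next
  case (Suc k)
  let ?V = "{t. y + \<phi> t *\<^sub>R u \<in> U}"
  note g = C_diff_on_SucD[OF Suc.prems]
  have \<phi>: "C_diff_on (Suc k) UNIV \<phi>" using assms(3) by (auto simp: smooth_on_def)
  note p = C_diff_on_SucD[OF \<phi>]
  have op: "open ?V" by (rule open_line_preimage[OF \<phi> assms(1)])
  have pd: "frechet_derivative \<phi> (at t) v = v * frechet_derivative \<phi> (at t) 1" for t v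
    using linear_scale[OF has_derivative_linear[OF p(1)], of t v 1] by simp
  show ?case
  proof (rule C_diff_on_SucI[OF op])
    fix t assume t: "t \<in> ?V"
    have "((\<lambda>t. y + \<phi> t *\<^sub>R u) has_derivative (\<lambda>v. frechet_derivative \<phi> (at t) v *\<^sub>R u)) (at t)"
      by (auto intro!: derivative_eq_intros p(1))
    from has_derivative_compose[OF this g(1)] t
    have *: "((\<lambda>t. g (y + \<phi> t *\<^sub>R u)) has_derivative (\<lambda>v.
        frechet_derivative g (at (y + \<phi> t *\<^sub>R u)) (frechet_derivative \<phi> (at t) v *\<^sub>R u))) (at t)"
      by simp
    have "frechet_derivative g (at (y + \<phi> t *\<^sub>R u)) (frechet_derivative \<phi> (at t) v *\<^sub>R u) =
        frechet_derivative \<phi> (at t) v *\<^sub>R frechet_derivative g (at (y + \<phi> t *\<^sub>R u)) u" for v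
      by (rule linear_scale[OF has_derivative_linear[OF g(1)]]) (use t in simp)
    with * show "((\<lambda>t. g (y + \<phi> t *\<^sub>R u)) has_derivative (\<lambda>v.
        frechet_derivative \<phi> (at t) v *\<^sub>R frechet_derivative g (at (y + \<phi> t *\<^sub>R u)) u)) (at t)"
      by simp
  next
    fix v
    show "C_diff_on k ?V (\<lambda>t. frechet_derivative \<phi> (at t) v *\<^sub>R
        frechet_derivative g (at (y + \<phi> t *\<^sub>R u)) u)"
      by (intro C_diff_on_scaleR op Suc.IH g C_diff_on_subset[OF p(2)]) auto
  qed
qed

lemma smooth_on_compose_line:
  fixes g :: "'b::real_normed_vector \<Rightarrow> 'c::real_normed_vector" and \<phi> :: "real \<Rightarrow> real"
  assumes "open U" "smooth_on U g" "smooth_on UNIV \<phi>"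
  shows "smooth_on {t. y + \<phi> t *\<^sub>R u \<in> U} (\<lambda>t. g (y + \<phi> t *\<^sub>R u))"
  unfolding smooth_on_def
  using C_diff_on_compose_line[OF assms(1) _ assms(3)] assms(2) by (metis smooth_on_def)

lemma smooth_on_cong:
  assumes "open U" "\<And>x. x \<in> U \<Longrightarrow> f x = g x"
  shows "smooth_on U f \<longleftrightarrow> smooth_on U g"
  unfolding smooth_on_def using C_diff_on_cong[of U f g] assms by blast

lemma smooth_on_subset: "smooth_on U f \<Longrightarrow> V \<subseteq> U \<Longrightarrow> smooth_on V f"
  unfolding smooth_on_def using C_diff_on_subset by blast

lemma smooth_on_local:
  assumes "\<And>x. x \<in> U \<Longrightarrow> \<exists>V. open V \<and> x \<in> V \<and> smooth_on V f"
  shows "smooth_on U f"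
  unfolding smooth_on_def
proof
  fix k show "C_diff_on k U f"
    by (rule C_diff_on_local) (use assms smooth_on_def in blast)
qed

lemma smooth_on_const: "smooth_on U (\<lambda>x. a)"
  by (simp add: smooth_on_def C_diff_on_const)

lemma smooth_on_id_real: "smooth_on (UNIV :: real set) (\<lambda>x. x)"
  unfolding smooth_on_def
proof
  fix k show "C_diff_on k (UNIV :: real set) (\<lambda>x. x)"
  proof (cases k)
    case (Suc j)
    show ?thesis unfolding Suc
      by (rule C_diff_on_SucI[OF open_UNIV has_derivative_ident]) (rule C_diff_on_const)
  qed simp
qed

lemma smooth_on_compose_affine:
  fixes g :: "real \<Rightarrow> 'c::real_normed_vector"
  assumes "open U" "smooth_on U g"
  shows "smooth_on {t. m * t + b \<in> U} (\<lambda>t. g (m * t + b))"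
  using smooth_on_compose_line[OF assms smooth_on_id_real, of b m]
  by (simp add: algebra_simps)

section \<open>A smooth step function\<close>

text \<open>
  The functions \<open>flat n x = exp (- 1 / x) / x ^ n\<close> (for \<open>x > 0\<close>) span a space that contains
  \<open>exp (- 1 / x)\<close> and is closed under differentiation, which is what makes them smooth at \<open>0\<close>.
\<close>

definition flat :: "nat \<Rightarrow> real \<Rightarrow> real" where
  "flat n x = (if x > 0 then exp (- inverse x) * inverse x ^ n else 0)"

text \<open>
  With \<open>u = 1 / x\<close> this is the decay of \<open>u ^ n / exp u\<close> at infinity.
\<close>

lemma flat_lim_0: "((\<lambda>x. exp (- inverse x) * inverse x ^ n) \<longlongrightarrow> 0) (at_right (0::real))"
proof -
  have "((\<lambda>u::real. u ^ n / exp u) \<longlongrightarrow> 0) at_top"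
    by (rule tendsto_power_div_exp_0)
  from filterlim_compose[OF this filterlim_inverse_at_top_right]
  show ?thesis by (simp add: exp_minus field_simps)
qed

lemma flat_has_derivative:
  "(flat n has_real_derivative (flat (n + 2) x - n * flat (n + 1) x)) (at x)"
proof -
  consider "x > 0" | "x < 0" | "x = 0" by linarith
  then show ?thesis
  proof cases
    case 1
    have e: "exp (- inverse x) * inverse x ^ n * (inverse x) ^ 2 - n * (exp (- inverse x) * inverse x ^ n * inverse x)
      = flat (n + 2) x - n * flat (n + 1) x"
      using 1 by (simp add: flat_def power_add power2_eq_square)
    have n: "real n * inverse x ^ (n - 1) * (inverse x ^ 2) = n * (inverse x ^ n * inverse x)"
      by (cases n) (auto simp: power2_eq_square)
    have "((\<lambda>x. exp (- inverse x) * inverse x ^ n) has_real_derivative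
        exp (- inverse x) * inverse x ^ n * (inverse x) ^ 2 - exp (- inverse x) * (real n * inverse x ^ (n - 1) * (inverse x ^ 2))) (at x)"
      using 1 by (auto intro!: derivative_eq_intros simp: power2_eq_square algebra_simps)
    then have "((\<lambda>x. exp (- inverse x) * inverse x ^ n) has_real_derivative
         flat (n + 2) x - n * flat (n + 1) x) (at x)"
      unfolding n e[symmetric] by (simp add: algebra_simps)
    then show ?thesis
      by (rule has_field_derivative_transform_within_open[of _ _ _ "{0<..}"]) (use 1 in \<open>auto simp: flat_def\<close>)
  next
    case 2
    have "((\<lambda>x. 0) has_real_derivative 0) (at x)" by simp
    then have "(flat n has_real_derivative 0) (at x)"
      by (rule has_field_derivative_transform_within_open[of _ _ _ "{..<0}"]) (use 2 in \<open>auto simp: flat_def\<close>)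
    then show ?thesis using 2 by (simp add: flat_def)
  next
    case 3
    have "((\<lambda>h. (flat n h - flat n 0) / (h - 0)) \<longlongrightarrow> 0) (at_right 0)"
      by (rule Lim_transform_eventually[OF flat_lim_0[of "Suc n"]])
        (auto simp: eventually_at_filter flat_def field_simps)
    moreover have "((\<lambda>h. (flat n h - flat n 0) / (h - 0)) \<longlongrightarrow> 0) (at_left 0)"
      by (rule Lim_transform_eventually[OF tendsto_const])
        (auto simp: eventually_at_filter flat_def)
    ultimately have "(flat n has_real_derivative 0) (at 0)"
      by (simp add: has_field_derivative_iff filterlim_split_at)
    then show ?thesis using 3 by (simp add: flat_def)
  qed
qed

lemma C_diff_on_SucI_real:
  fixes f f' :: "real \<Rightarrow> real"
  assumes "\<And>x. (f has_real_derivative f' x) (at x)" "C_diff_on k UNIV f'"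
  shows "C_diff_on (Suc k) UNIV f"
proof (rule C_diff_on_SucI[OF open_UNIV])
  show "(f has_derivative (\<lambda>v. v *\<^sub>R f' x)) (at x)" for x
    using assms(1)[of x] by (simp add: has_field_derivative_def mult_commute_abs)
  show "C_diff_on k UNIV (\<lambda>x. v *\<^sub>R f' x)" for v
    by (rule C_diff_on_scaleR[OF open_UNIV C_diff_on_const assms(2)])
qed

lemma C_diff_on_flat: "C_diff_on k UNIV (flat n)"
proof (induction k arbitrary: n)
  case 0
  show ?case using DERIV_isCont[OF flat_has_derivative]
    by (auto intro!: continuous_at_imp_continuous_on)
next
  case (Suc k)
  have "C_diff_on k UNIV (\<lambda>x. flat (n + 2) x + (- real n) *\<^sub>R flat (n + 1) x)"
    by (intro C_diff_on_add C_diff_on_scaleR C_diff_on_const Suc.IH open_UNIV)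
  then show ?case
    by (intro C_diff_on_SucI_real[OF flat_has_derivative]) simp
qed

text \<open>
  The normalised integral of a bump function that is positive exactly on \<open>(0, 1)\<close>. A segment run
  through with such a step rests near both ends, which allows smooth gluing, and moves with
  non-zero velocity in between, so that it is transversal to the curve whenever its direction is.
\<close>

lemma smooth_step_exists:
  obtains \<phi> :: "real \<Rightarrow> real" where "smooth_on UNIV \<phi>"
    "\<And>t. t \<le> 0 \<Longrightarrow> \<phi> t = 0" "\<And>t. t \<ge> 1 \<Longrightarrow> \<phi> t = 1"
    "\<And>t. 0 < t \<Longrightarrow> t < 1 \<Longrightarrow> 0 < \<phi> t \<and> \<phi> t < 1"
    "\<And>t. 0 < t \<Longrightarrow> t < 1 \<Longrightarrow> \<exists>D>0. (\<phi> has_real_derivative D) (at t)"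
    "inj_on \<phi> {0..1}"
proof -
  define b where "b t = flat 0 t * flat 0 (1 - t)" for t
  have bk: "C_diff_on k UNIV b" for k
  proof -
    have "C_diff_on k UNIV (\<lambda>t. flat 0 (1 + t *\<^sub>R (-1)))"
      using C_diff_on_compose_line[OF open_UNIV C_diff_on_flat smooth_on_id_real, of k 1 "-1" 0] by simp
    from C_diff_on_scaleR[OF open_UNIV C_diff_on_flat this, of 0]
    show ?thesis by (simp add: b_def[abs_def])
  qed
  have bpos: "b t > 0" if "0 < t" "t < 1" for t using that by (auto simp: b_def flat_def)
  have b0: "b t = 0" if "t \<le> 0 \<or> t \<ge> 1" for t using that by (auto simp: b_def flat_def)
  have bc: "continuous_on UNIV b" using bk[of 0] by simp
  obtain I where I: "\<And>t. (I has_real_derivative b t) (at t)"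
  proof -
    have "\<exists>g. \<forall>x::real. (g has_vector_derivative b x) (at x)"
      using einterval_antiderivative[of "-\<infinity>" \<infinity> b] bc
      by (auto simp: continuous_on_eq_continuous_at)
    then show ?thesis using that by (auto simp: has_real_derivative_iff_has_vector_derivative)
  qed
  have mono: "I s < I t" if "0 \<le> s" "s < t" "t \<le> 1" for s t
    using I bpos that by (intro DERIV_pos_imp_increasing_open[OF that(2)])
      (auto intro!: continuous_at_imp_continuous_on DERIV_isCont[OF I] exI[of _ "b _"])
  have const: "I s = I t" if "s < t" "\<And>u. s \<le> u \<Longrightarrow> u \<le> t \<Longrightarrow> b u = 0" for s t
  proof (rule DERIV_isconst_end[OF \<open>s < t\<close>, symmetric])
    show "continuous_on {s..t} I"
      by (auto intro!: continuous_at_imp_continuous_on DERIV_isCont[OF I])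
    show "DERIV I u :> 0" if "s < u" "u < t" for u using I[of u] \<open>\<And>u. s \<le> u \<Longrightarrow> u \<le> t \<Longrightarrow> b u = 0\<close>[of u] that by simp
  qed
  define \<phi> where "\<phi> t = (I t - I 0) / (I 1 - I 0)" for t
  have i: "I 1 - I 0 > 0" using mono[of 0 1] by simp
  have D: "(\<phi> has_real_derivative b t / (I 1 - I 0)) (at t)" for t
    unfolding \<phi>_def[abs_def] using i by (auto intro!: derivative_eq_intros I)
  show ?thesis
  proof (rule that[of \<phi>])
    show "smooth_on UNIV \<phi>"
      unfolding smooth_on_def
    proof
      fix k
      have "C_diff_on k UNIV (\<lambda>t. inverse (I 1 - I 0) *\<^sub>R b t)"
        by (intro C_diff_on_scaleR C_diff_on_const bk open_UNIV)
      then have "C_diff_on (Suc k) UNIV \<phi>"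
        by (intro C_diff_on_SucI_real[OF D]) (simp add: field_simps)
      then show "C_diff_on k UNIV \<phi>" by (rule C_diff_on_Suc_imp)
    qed
    show "\<phi> t = 0" if "t \<le> 0" for t
      using const[of t 0] b0 that by (cases "t = 0") (auto simp: \<phi>_def)
    show "\<phi> t = 1" if "t \<ge> 1" for t
      using const[of 1 t] b0 that i by (cases "t = 1") (auto simp: \<phi>_def)
    show "0 < \<phi> t \<and> \<phi> t < 1" if "0 < t" "t < 1" for t
      using mono[of 0 t] mono[of t 1] that i by (auto simp: \<phi>_def)
    show "\<exists>D>0. (\<phi> has_real_derivative D) (at t)" if "0 < t" "t < 1" for t
      using D[of t] bpos[OF that] i by (intro exI[of _ "b t / (I 1 - I 0)"]) auto
    show "inj_on \<phi> {0..1}"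
    proof (rule linorder_inj_onI')
      fix s t :: real assume "s \<in> {0..1}" "t \<in> {0..1}" "s < t"
      then show "\<phi> s \<noteq> \<phi> t" using mono[of s t] i by (auto simp: \<phi>_def)
    qed
  qed
qed

section \<open>The oriented plane\<close>

definition det2 :: "real^2 \<Rightarrow> real^2 \<Rightarrow> real" where
  "det2 u v = u$1 * v$2 - u$2 * v$1"

text \<open>
  The quarter turn to the left: \<open>det2 u v > 0\<close> means that \<open>v\<close> points to the left of \<open>u\<close>, and the
  perpendicular \<open>rot u\<close> is the standard such \<open>v\<close>.
\<close>

definition rot :: "real^2 \<Rightarrow> real^2" where
  "rot u = vector [- u$2, u$1]"

lemma det2_simps:
  "det2 (u + v) w = det2 u w + det2 v w" "det2 w (u + v) = det2 w u + det2 w v"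
  "det2 (u - v) w = det2 u w - det2 v w" "det2 w (u - v) = det2 w u - det2 w v"
  "det2 (a *\<^sub>R u) w = a * det2 u w" "det2 w (a *\<^sub>R u) = a * det2 w u"
  "det2 (- u) w = - det2 u w" "det2 w (- u) = - det2 w u"
  "det2 0 w = 0" "det2 w 0 = 0" "det2 u u = 0"
  by (auto simp: det2_def algebra_simps)

lemma det2_swap: "det2 v u = - det2 u v"
  by (simp add: det2_def)

lemma det2_eq_inner: "det2 u v = rot u \<bullet> v"
  by (simp add: det2_def rot_def inner_vec_def sum_2)

lemma norm_rot [simp]: "norm (rot u) = norm u"
  by (simp add: norm_vec_def L2_set_def sum_2 rot_def add.commute)

lemma det2_rot: "det2 u (rot u) = (norm u)\<^sup>2"
  by (simp add: det2_eq_inner power2_norm_eq_inner[symmetric])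

lemma inner_rot: "u \<bullet> rot u = 0"
  by (simp add: rot_def inner_vec_def sum_2)

lemma abs_det2_le: "\<bar>det2 u v\<bar> \<le> norm u * norm v"
  using Cauchy_Schwarz_ineq2[of "rot u" v] by (simp add: det2_eq_inner)

lemma tendsto_det2 [tendsto_intros]:
  assumes "(f \<longlongrightarrow> a) F" "(g \<longlongrightarrow> b) F"
  shows "((\<lambda>x. det2 (f x) (g x)) \<longlongrightarrow> det2 a b) F"
  unfolding det2_def by (intro tendsto_intros assms)

text \<open>
  If the determinant vanishes, some non-zero linear form \<open>det2 z\<close> kills both vectors and thus
  their span, but it does not kill \<open>rot z\<close>.
\<close>

lemma span_pair_eq_UNIV_iff: "span {u, v} = UNIV \<longleftrightarrow> det2 u v \<noteq> 0"
proof
  assume D: "det2 u v \<noteq> 0"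
  have "w \<in> span {u, v}" for w
  proof -
    have "det2 u v *\<^sub>R w = det2 w v *\<^sub>R u + det2 u w *\<^sub>R v"
      by (simp add: vec_eq_iff forall_2 det2_def algebra_simps)
    then have "inverse (det2 u v) *\<^sub>R (det2 u v *\<^sub>R w) =
        inverse (det2 u v) *\<^sub>R (det2 w v *\<^sub>R u + det2 u w *\<^sub>R v)" by simp
    then have "w = inverse (det2 u v) *\<^sub>R (det2 w v *\<^sub>R u + det2 u w *\<^sub>R v)"
      using D by simp
    also have "\<dots> \<in> span {u, v}"
      by (intro span_add span_scale) (auto intro: span_base)
    finally show ?thesis .
  qed
  then show "span {u, v} = UNIV" by auto
next
  assume s: "span {u, v} = UNIV"
  show "det2 u v \<noteq> 0"
  proof
    assume D: "det2 u v = 0"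
    obtain z where z: "z \<noteq> 0" "det2 z u = 0" "det2 z v = 0"
    proof (cases "u = 0 \<and> v = 0")
      case True
      then show ?thesis using that[of "axis 1 1"] by (simp add: det2_simps axis_eq_0_iff)
    next
      case False
      then show ?thesis using that[of u] that[of v] D by (auto simp: det2_simps det2_swap[of v u])
    qed
    have "rot z \<in> span {u, v}" using s by simp
    then have "det2 z (rot z) = 0"
      by (induction rule: span_induct_alt) (use z in \<open>auto simp: det2_simps\<close>)
    then show False using z(1) by (simp add: det2_rot)
  qed
qed

lemma det2_matrix: "det2 (A *v u) (A *v v) = det A * det2 u v" for A :: "real^2^2"
  by (simp add: det2_def det_2 matrix_vector_mult_def sum_2 algebra_simps)

section \<open>Charts and the orientation cocycle\<close>

definition transition_jacobian ::
  "('s, real^2) chart \<Rightarrow> ('s, real^2) chart \<Rightarrow> 's \<Rightarrow> real^2^2" where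
  "transition_jacobian d e p = jacobian (cmap e \<circ> cinv d) (at (cmap d p))"

lemma w1_cocycle_alt: "w1_cocycle d e p = (if det (transition_jacobian d e p) < 0 then 1 else 0)"
  by (simp add: w1_cocycle_def transition_jacobian_def)

locale manifold =
  fixes M :: "'m::{t2_space, second_countable_topology} set"
    and A :: "('m, 'b::euclidean_space) chart set"
  assumes smooth_manifold: "smooth_manifold M A"
begin

lemma chart_homeo:
  "c \<in> A \<Longrightarrow> homeomorphism (cdom c) (cmap c ` cdom c) (cmap c) (cinv c)"
  and openin_cdom: "c \<in> A \<Longrightarrow> openin (top_of_set M) (cdom c)"
  and open_chart_image: "c \<in> A \<Longrightarrow> open (cmap c ` cdom c)"
  and smooth_transition: "c \<in> A \<Longrightarrow> d \<in> A \<Longrightarrow>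
    smooth_on (cmap c ` (cdom c \<inter> cdom d)) (cmap d \<circ> cinv c)"
  and Union_cdom: "(\<Union>c\<in>A. cdom c) = M"
  using smooth_manifold by (auto simp: smooth_manifold_def)

lemma chart_at: assumes "p \<in> M" obtains c where "c \<in> A" "p \<in> cdom c"
  using assms Union_cdom by auto

lemma cdom_subset: "c \<in> A \<Longrightarrow> cdom c \<subseteq> M"
  using Union_cdom by auto

lemma cinv_cmap [simp]: "c \<in> A \<Longrightarrow> p \<in> cdom c \<Longrightarrow> cinv c (cmap c p) = p"
  using homeomorphism_apply1[OF chart_homeo] .

lemma cmap_cinv [simp]: "c \<in> A \<Longrightarrow> y \<in> cmap c ` cdom c \<Longrightarrow> cmap c (cinv c y) = y"
  using homeomorphism_apply2[OF chart_homeo] .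

lemma cinv_in: "c \<in> A \<Longrightarrow> y \<in> cmap c ` cdom c \<Longrightarrow> cinv c y \<in> cdom c"
  by (metis cinv_cmap imageE)

lemma cmap_inj: "c \<in> A \<Longrightarrow> p \<in> cdom c \<Longrightarrow> q \<in> cdom c \<Longrightarrow> cmap c p = cmap c q \<Longrightarrow> p = q"
  using cinv_cmap by metis

lemma continuous_on_cmap: "c \<in> A \<Longrightarrow> continuous_on (cdom c) (cmap c)"
  using homeomorphism_cont1[OF chart_homeo] .

lemma continuous_on_cinv: "c \<in> A \<Longrightarrow> continuous_on (cmap c ` cdom c) (cinv c)"
  using homeomorphism_cont2[OF chart_homeo] .

lemma open_image_openin:
  assumes c: "c \<in> A" and N: "openin (top_of_set M) N"
  shows "open (cmap c ` (cdom c \<inter> N))"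
proof -
  have "openin (top_of_set (cdom c)) (cdom c \<inter> N)"
    using N cdom_subset[OF c] by (metis inf.absorb_iff2 inf_commute openin_subtopology_Int2 subtopology_subtopology)
  from homeomorphism_imp_open_map[OF chart_homeo[OF c] this] show ?thesis
    using open_chart_image[OF c] openin_open_eq by blast
qed

lemma open_overlap: "c \<in> A \<Longrightarrow> d \<in> A \<Longrightarrow> open (cmap c ` (cdom c \<inter> cdom d))"
  using open_image_openin openin_cdom by blast

lemma openin_chart_preimage:
  assumes c: "c \<in> A" and W: "open W"
  shows "openin (top_of_set M) (cdom c \<inter> cmap c -` W)"
  using continuous_openin_preimage_gen[OF continuous_on_cmap[OF c] W] openin_cdom[OF c]
    openin_trans by blast

lemma eventually_in_openin:
  assumes "openin (top_of_set M) N" "p \<in> N"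
  shows "eventually (\<lambda>q. q \<in> N) (at p within M)"
proof -
  obtain T where T: "open T" "N = M \<inter> T" using assms(1) by (auto simp: openin_open)
  have "eventually (\<lambda>q. q \<in> T) (at p within M)"
    using T assms(2) by (intro topological_tendstoD[OF tendsto_ident_at]) auto
  moreover have "eventually (\<lambda>q. q \<in> M) (at p within M)"
    by (auto simp: eventually_at_filter)
  ultimately show ?thesis by (rule eventually_elim2) (use T in auto)
qed

lemma has_derivative_transition:
  assumes "c \<in> A" "d \<in> A" "p \<in> cdom c" "p \<in> cdom d"
  shows "(cmap d \<circ> cinv c has_derivative frechet_derivative (cmap d \<circ> cinv c) (at (cmap c p))) (at (cmap c p))"
proof -
  have "C_diff_on (Suc 0) (cmap c ` (cdom c \<inter> cdom d)) (cmap d \<circ> cinv c)"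
    using smooth_transition[OF assms(1,2)] by (simp add: smooth_on_def del: C_diff_on.simps)
  from C_diff_on_SucD(1)[OF this] show ?thesis using assms by auto
qed

end

locale surface = manifold S AS
  for S :: "'s::{t2_space, second_countable_topology} set" and AS :: "('s, real^2) chart set"
begin

abbreviation "J \<equiv> transition_jacobian"

lemma has_derivative_J:
  assumes "d \<in> AS" "e \<in> AS" "p \<in> cdom d" "p \<in> cdom e"
  shows "(cmap e \<circ> cinv d has_derivative (\<lambda>v. J d e p *v v)) (at (cmap d p))"
  using has_derivative_transition[OF assms] unfolding transition_jacobian_def
  by (metis differentiable_def jacobian_works)

lemma J_unique:
  assumes "d \<in> AS" "e \<in> AS" "p \<in> cdom d" "p \<in> cdom e"
    and "(cmap e \<circ> cinv d has_derivative (\<lambda>v. K *v v)) (at (cmap d p))"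
  shows "J d e p = K"
  using has_derivative_unique[OF has_derivative_J[OF assms(1-4)] assms(5)]
  by (metis matrix_eq)

lemma J_self:
  assumes "d \<in> AS" "p \<in> cdom d"
  shows "J d d p = mat 1"
proof (rule J_unique[OF assms(1,1,2,2)])
  have "((\<lambda>y. y) has_derivative (\<lambda>v. v)) (at (cmap d p))" by simp
  then have "(cmap d \<circ> cinv d has_derivative (\<lambda>v. v)) (at (cmap d p))"
    by (rule has_derivative_transform_within_open[OF _ open_chart_image[OF assms(1)]])
      (auto simp: assms)
  then show "(cmap d \<circ> cinv d has_derivative (\<lambda>v. mat 1 *v v)) (at (cmap d p))" by simp
qed

lemma J_compose:
  assumes "d \<in> AS" "e \<in> AS" "g \<in> AS" "p \<in> cdom d" "p \<in> cdom e" "p \<in> cdom g"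
  shows "J d g p = J e g p ** J d e p"
proof (rule J_unique[OF assms(1,3,4,6)])
  have ep: "(cmap e \<circ> cinv d) (cmap d p) = cmap e p" by (simp add: assms)
  have "((cmap g \<circ> cinv e) \<circ> (cmap e \<circ> cinv d) has_derivative (\<lambda>v. J e g p *v v) \<circ> (\<lambda>v. J d e p *v v)) (at (cmap d p))"
    by (rule diff_chain_at[OF has_derivative_J])
      (use has_derivative_J[of e g p] ep assms in auto)
  then have "((cmap g \<circ> cinv e) \<circ> (cmap e \<circ> cinv d) has_derivative (\<lambda>v. (J e g p ** J d e p) *v v)) (at (cmap d p))"
    by (simp add: o_def matrix_vector_mul_assoc)
  then show "(cmap g \<circ> cinv d has_derivative (\<lambda>v. (J e g p ** J d e p) *v v)) (at (cmap d p))"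
  proof (rule has_derivative_transform_within_open[OF _ open_overlap[OF assms(1,2)]])
    show "cmap d p \<in> cmap d ` (cdom d \<inter> cdom e)" using assms by auto
    show "\<And>y. y \<in> cmap d ` (cdom d \<inter> cdom e) \<Longrightarrow>
      (cmap g \<circ> cinv e \<circ> (cmap e \<circ> cinv d)) y = (cmap g \<circ> cinv d) y"
      by (auto simp: assms)
  qed
qed

lemma det_J_compose:
  assumes "d \<in> AS" "e \<in> AS" "g \<in> AS" "p \<in> cdom d" "p \<in> cdom e" "p \<in> cdom g"
  shows "det (J d g p) = det (J e g p) * det (J d e p)"
  using J_compose[OF assms] by (simp add: det_mul)

lemma det_J_nonzero:
  assumes "d \<in> AS" "e \<in> AS" "p \<in> cdom d" "p \<in> cdom e"
  shows "det (J d e p) \<noteq> 0"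
  using det_J_compose[of d e d p] J_self[of d p] assms by auto

lemma w1_cocycle_self: "d \<in> AS \<Longrightarrow> p \<in> cdom d \<Longrightarrow> w1_cocycle d d p = 0"
  by (simp add: w1_cocycle_alt J_self)

text \<open>
  The cocycle condition is the chain rule followed by multiplicativity of the determinant.
\<close>

lemma w1_cocycle_compose:
  assumes "d \<in> AS" "e \<in> AS" "g \<in> AS" "p \<in> cdom d" "p \<in> cdom e" "p \<in> cdom g"
  shows "w1_cocycle d g p = w1_cocycle d e p + w1_cocycle e g p"
  using det_J_compose[OF assms] det_J_nonzero[of d e p] det_J_nonzero[of e g p] assms
  by (auto simp: w1_cocycle_alt mult_less_0_iff)

lemma continuous_on_det_J:
  assumes "d \<in> AS" "e \<in> AS"
  shows "continuous_on (cdom d \<inter> cdom e) (\<lambda>p. det (J d e p))"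
proof -
  let ?T = "cmap e \<circ> cinv d"
  have "C_diff_on (Suc 0) (cmap d ` (cdom d \<inter> cdom e)) ?T"
    using smooth_transition[OF assms] by (simp add: smooth_on_def del: C_diff_on.simps)
  from C_diff_on_SucD(2)[OF this]
  have "continuous_on (cmap d ` (cdom d \<inter> cdom e)) (\<lambda>y. frechet_derivative ?T (at y) v)" for v
    by simp
  then have c: "continuous_on (cdom d \<inter> cdom e) (\<lambda>p. frechet_derivative ?T (at (cmap d p)) v)" for v
    by (rule continuous_on_compose2) (use continuous_on_subset[OF continuous_on_cmap[OF assms(1)]] in auto)
  have "det (J d e p) = frechet_derivative ?T (at (cmap d p)) (axis 1 1) $ 1 * frechet_derivative ?T (at (cmap d p)) (axis 2 1) $ 2
     - frechet_derivative ?T (at (cmap d p)) (axis 2 1) $ 1 * frechet_derivative ?T (at (cmap d p)) (axis 1 1) $ 2" for p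
    by (simp add: det_2 transition_jacobian_def jacobian_def matrix_def)
  then show ?thesis by (simp only:) (intro continuous_intros c)
qed

text \<open>
  The Jacobian determinant is continuous and has no zeros, so its sign cannot jump.
\<close>

lemma w1_cocycle_locally_constant:
  assumes "d \<in> AS" "e \<in> AS" "p \<in> cdom d" "p \<in> cdom e"
  shows "\<forall>\<^sub>F q in at p within S. q \<in> cdom d \<and> q \<in> cdom e \<and> w1_cocycle d e q = w1_cocycle d e p"
proof -
  let ?D = "\<lambda>q. det (J d e q)"
  have N: "openin (top_of_set S) (cdom d \<inter> cdom e)" using openin_cdom assms by blast
  have "openin (top_of_set (cdom d \<inter> cdom e)) ((cdom d \<inter> cdom e) \<inter> ?D -` {x. x * ?D p > 0})"
    by (intro continuous_openin_preimage_gen continuous_on_det_J assms open_Collect_less continuous_intros)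
  then have "openin (top_of_set S) ((cdom d \<inter> cdom e) \<inter> ?D -` {x. x * ?D p > 0})"
    using N openin_trans by blast
  from eventually_in_openin[OF this, of p] assms det_J_nonzero[OF assms]
  have "\<forall>\<^sub>F q in at p within S. q \<in> (cdom d \<inter> cdom e) \<inter> ?D -` {x. x * ?D p > 0}"
    by (auto simp: zero_less_mult_iff linorder_neq_iff)
  then show ?thesis
    by eventually_elim (auto simp: w1_cocycle_alt zero_less_mult_iff)
qed

text \<open>
  Velocities of paths on the surface and of branches of the immersed curve change with the chart
  by the same Jacobian matrix, which is why transversality and the sides of the curve can be
  studied in a single chart.
\<close>

lemma has_vector_derivative_change_chart:
  assumes de: "d \<in> AS" "e \<in> AS" "g t \<in> cdom d" "g t \<in> cdom e"
    and ev: "\<forall>\<^sub>F s in at t within X. g s \<in> cdom d" and t: "t \<in> X"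
    and v: "(cmap d \<circ> g has_vector_derivative v) (at t within X)"
  shows "(cmap e \<circ> g has_vector_derivative J d e (g t) *v v) (at t within X)"
proof -
  have "(cmap e \<circ> cinv d has_derivative (\<lambda>v. J d e (g t) *v v)) (at ((cmap d \<circ> g) t) within (cmap d \<circ> g) ` X)"
    using has_derivative_at_withinI[OF has_derivative_J[OF de]] by (simp add: o_def)
  from diff_chain_within[OF v[unfolded has_vector_derivative_def] this]
  have "((cmap e \<circ> cinv d) \<circ> (cmap d \<circ> g) has_derivative (\<lambda>x. x *\<^sub>R (J d e (g t) *v v))) (at t within X)"
    by (simp add: o_def matrix_vector_mult_scaleR)
  then have "(cmap e \<circ> g has_derivative (\<lambda>x. x *\<^sub>R (J d e (g t) *v v))) (at t within X)"
  proof (rule has_derivative_transform_eventually)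
    show "\<forall>\<^sub>F x' in at t within X. (cmap e \<circ> cinv d \<circ> (cmap d \<circ> g)) x' = (cmap e \<circ> g) x'"
      using ev by eventually_elim (auto simp: de)
  qed (auto simp: de t)
  then show ?thesis by (simp add: has_vector_derivative_def)
qed

end

section \<open>Paths and lifts to the orientation covering\<close>

lemma cinv_line: "cinv (UNIV, id) = id"
  by (simp add: cinv_def)

lemma velocity_line: "velocity (UNIV, id) \<gamma> d t = vector_derivative (cmap d \<circ> \<gamma>) (at t)"
  by (simp add: velocity_def cinv_line)

context surface
begin

definition smooth_path :: "(real \<Rightarrow> 's) \<Rightarrow> bool" where
  "smooth_path \<gamma> \<longleftrightarrow> continuous_on UNIV \<gamma> \<and> range \<gamma> \<subseteq> S \<and>
     (\<forall>d\<in>AS. smooth_on (\<gamma> -` cdom d) (cmap d \<circ> \<gamma>))"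

lemma smooth_path_iff: "smooth_path \<gamma> \<longleftrightarrow> smooth_map UNIV line_atlas S AS \<gamma>"
  by (simp add: smooth_path_def smooth_map_def line_atlas_def cinv_line)

lemma open_vimage_openin:
  fixes \<gamma> :: "real \<Rightarrow> 's"
  assumes "continuous_on UNIV \<gamma>" "range \<gamma> \<subseteq> S" "openin (top_of_set S) N"
  shows "open (\<gamma> -` N)"
  using continuous_openin_preimage[of UNIV \<gamma> S N] assms by (simp add: Pi_def image_subset_iff)

lemma smooth_path_open: "smooth_path \<gamma> \<Longrightarrow> d \<in> AS \<Longrightarrow> open (\<gamma> -` cdom d)"
  using open_vimage_openin openin_cdom by (auto simp: smooth_path_def)

text \<open>
  Concatenated paths and periodic extensions are smooth because near each parameter they agree
  with one smooth path.
\<close>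

lemma smooth_path_local:
  assumes "\<And>t. \<exists>V \<gamma>'. open V \<and> t \<in> V \<and> smooth_path \<gamma>' \<and> (\<forall>u\<in>V. \<gamma> u = \<gamma>' u)"
  shows "smooth_path \<gamma>"
  unfolding smooth_path_def
proof (intro conjI ballI)
  show "continuous_on UNIV \<gamma>"
  proof (intro continuous_at_imp_continuous_on ballI)
    fix t
    obtain V \<gamma>' where V: "open V" "t \<in> V" "smooth_path \<gamma>'" "\<forall>u\<in>V. \<gamma> u = \<gamma>' u"
      using assms by blast
    then have "continuous_on V \<gamma>'"
      using continuous_on_subset[of UNIV \<gamma>' V] by (simp add: smooth_path_def)
    then have "continuous_on V \<gamma>" using V(4) by (metis continuous_on_cong)
    then show "isCont \<gamma> t" using continuous_on_eq_continuous_at[OF V(1)] V(2) by blast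
  qed
  show "range \<gamma> \<subseteq> S"
  proof clarify
    fix t
    obtain V \<gamma>' where V: "open V" "t \<in> V" "smooth_path \<gamma>'" "\<forall>u\<in>V. \<gamma> u = \<gamma>' u"
      using assms by blast
    then show "\<gamma> t \<in> S" by (auto simp: smooth_path_def)
  qed
  fix d assume d: "d \<in> AS"
  show "smooth_on (\<gamma> -` cdom d) (cmap d \<circ> \<gamma>)"
  proof (rule smooth_on_local)
    fix t assume t: "t \<in> \<gamma> -` cdom d"
    obtain V \<gamma>' where V: "open V" "t \<in> V" "smooth_path \<gamma>'" "\<forall>u\<in>V. \<gamma> u = \<gamma>' u"
      using assms by blast
    have op: "open (V \<inter> \<gamma>' -` cdom d)" using V smooth_path_open d by blast
    have "smooth_on (V \<inter> \<gamma>' -` cdom d) (cmap d \<circ> \<gamma>')"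
      using V d smooth_on_subset by (metis inf_le2 smooth_path_def)
    then have "smooth_on (V \<inter> \<gamma>' -` cdom d) (cmap d \<circ> \<gamma>)"
      using smooth_on_cong[OF op, of "cmap d \<circ> \<gamma>" "cmap d \<circ> \<gamma>'"] V by auto
    then show "\<exists>V. open V \<and> t \<in> V \<and> smooth_on V (cmap d \<circ> \<gamma>)"
      using op V t by (intro exI[of _ "V \<inter> \<gamma>' -` cdom d"]) auto
  qed
qed

lemma smooth_path_affine:
  assumes "smooth_path \<gamma>"
  shows "smooth_path (\<lambda>t. \<gamma> (m * t + b))"
  unfolding smooth_path_def
proof (intro conjI ballI)
  show "continuous_on UNIV (\<lambda>t. \<gamma> (m * t + b))"
  proof (rule continuous_on_compose2[of UNIV \<gamma>])
    show "continuous_on UNIV \<gamma>" using assms by (simp add: smooth_path_def)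
  qed (auto intro!: continuous_intros)
  show "range (\<lambda>t. \<gamma> (m * t + b)) \<subseteq> S" using assms by (auto simp: smooth_path_def)
  fix d assume d: "d \<in> AS"
  then have "smooth_on (\<gamma> -` cdom d) (cmap d \<circ> \<gamma>)" using assms by (simp add: smooth_path_def)
  from smooth_on_compose_affine[OF smooth_path_open[OF assms d] this, of m b]
  show "smooth_on ((\<lambda>t. \<gamma> (m * t + b)) -` cdom d) (cmap d \<circ> (\<lambda>t. \<gamma> (m * t + b)))"
    by (simp add: o_def vimage_def)
qed

lemma smooth_path_const: "p \<in> S \<Longrightarrow> smooth_path (\<lambda>t. p)"
  by (auto simp: smooth_path_def o_def smooth_on_const)

lemma smooth_path_derivative:
  assumes "smooth_path \<gamma>" "d \<in> AS" "\<gamma> t \<in> cdom d"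
  shows "(cmap d \<circ> \<gamma> has_vector_derivative vector_derivative (cmap d \<circ> \<gamma>) (at t)) (at t)"
proof -
  have "C_diff_on (Suc 0) (\<gamma> -` cdom d) (cmap d \<circ> \<gamma>)"
    using assms by (simp add: smooth_path_def smooth_on_def del: C_diff_on.simps)
  from C_diff_on_SucD(1)[OF this, of t] assms(3) show ?thesis
    by (metis differentiableI_vector differentiable_def has_vector_derivative_def
        vector_derivative_works vimageI)
qed

text \<open>
  A lift of the path \<open>\<gamma>\<close> to the orientation double covering of the surface: \<open>\<theta> d t\<close> tells
  whether the orientation that has been transported to \<open>\<gamma> t\<close> agrees with the one of the chart \<open>d\<close>.
\<close>

definition lift :: "(real \<Rightarrow> 's) \<Rightarrow> (('s, real^2) chart \<Rightarrow> real \<Rightarrow> bit) \<Rightarrow> bool" where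
  "lift \<gamma> \<theta> \<longleftrightarrow>
     (\<forall>d\<in>AS. \<forall>t. \<gamma> t \<in> cdom d \<longrightarrow> (\<forall>\<^sub>F u in nhds t. \<theta> d u = \<theta> d t)) \<and>
     (\<forall>d\<in>AS. \<forall>e\<in>AS. \<forall>t. \<gamma> t \<in> cdom d \<longrightarrow> \<gamma> t \<in> cdom e \<longrightarrow>
        \<theta> d t + \<theta> e t = w1_cocycle d e (\<gamma> t))"

lemma liftD:
  assumes "lift \<gamma> \<theta>" "d \<in> AS" "\<gamma> t \<in> cdom d"
  shows "\<forall>\<^sub>F u in nhds t. \<theta> d u = \<theta> d t"
    and "e \<in> AS \<Longrightarrow> \<gamma> t \<in> cdom e \<Longrightarrow> \<theta> d t + \<theta> e t = w1_cocycle d e (\<gamma> t)"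
  using assms by (simp_all add: lift_def)

lemma lift_constant:
  assumes "lift \<gamma> \<theta>" "d \<in> AS" "connected I" "\<And>t. t \<in> I \<Longrightarrow> \<gamma> t \<in> cdom d" "a \<in> I" "b \<in> I"
  shows "\<theta> d a = \<theta> d b"
proof (rule connected_local_const[OF assms(3,5,6)], intro ballI)
  fix a assume "a \<in> I"
  then have "\<forall>\<^sub>F u in nhds a. \<theta> d u = \<theta> d a" using liftD assms by blast
  then show "\<forall>\<^sub>F b in at a within I. \<theta> d a = \<theta> d b"
    by (auto simp: eventually_at_filter elim: eventually_mono)
qed

lemma lift_affine:
  assumes "lift \<gamma> \<theta>"
  shows "lift (\<lambda>t. \<gamma> (m * t + b)) (\<lambda>d t. \<theta> d (m * t + b))"
  unfolding lift_def
proof (intro conjI ballI allI impI)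
  fix d t assume "d \<in> AS" "\<gamma> (m * t + b) \<in> cdom d"
  then have "\<forall>\<^sub>F u in nhds (m * t + b). \<theta> d u = \<theta> d (m * t + b)" using liftD assms by blast
  moreover have "((\<lambda>u. m * u + b) \<longlongrightarrow> m * t + b) (nhds t)"
    by (intro tendsto_intros filterlim_ident)
  ultimately show "\<forall>\<^sub>F u in nhds t. \<theta> d (m * u + b) = \<theta> d (m * t + b)"
    by (rule eventually_compose_filterlim)
qed (use assms in \<open>simp add: lift_def\<close>)

text \<open>
  Within one chart \<open>d\<close> the transported orientation can be taken to be that of \<open>d\<close> itself, and the
  cocycle compares it to the other charts.
\<close>

lemma lift_single_chart:
  assumes "continuous_on UNIV \<gamma>" "d \<in> AS" "\<And>t. \<gamma> t \<in> cdom d"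
  shows "lift \<gamma> (\<lambda>e t. w1_cocycle d e (\<gamma> t))"
  unfolding lift_def
proof (intro conjI ballI allI impI)
  fix e t assume e: "e \<in> AS" "\<gamma> t \<in> cdom e"
  have S: "\<gamma> u \<in> S" for u using assms(2,3) cdom_subset by blast
  have "\<forall>\<^sub>F q in at (\<gamma> t) within S. w1_cocycle d e q = w1_cocycle d e (\<gamma> t)"
    using w1_cocycle_locally_constant[OF assms(2) e(1) assms(3) e(2)]
    by (rule eventually_mono) simp
  then have "\<forall>\<^sub>F q in nhds (\<gamma> t). q \<in> S \<longrightarrow> w1_cocycle d e q = w1_cocycle d e (\<gamma> t)"
    unfolding eventually_at_filter by (rule eventually_mono) auto
  then obtain T where "open T" "\<gamma> t \<in> T"
    "\<forall>q\<in>T. q \<in> S \<longrightarrow> w1_cocycle d e q = w1_cocycle d e (\<gamma> t)"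
    unfolding eventually_nhds by blast
  moreover have "open (\<gamma> -` T)" using open_vimage[OF \<open>open T\<close> assms(1)] .
  ultimately have "\<forall>\<^sub>F u in nhds t. \<gamma> u \<in> S \<longrightarrow> w1_cocycle d e (\<gamma> u) = w1_cocycle d e (\<gamma> t)"
    unfolding eventually_nhds by (intro exI[of _ "\<gamma> -` T"]) simp
  then show "\<forall>\<^sub>F u in nhds t. w1_cocycle d e (\<gamma> u) = w1_cocycle d e (\<gamma> t)"
    using S by simp
next
  fix e g t assume "e \<in> AS" "g \<in> AS" "\<gamma> t \<in> cdom e" "\<gamma> t \<in> cdom g"
  then have "w1_cocycle d g (\<gamma> t) = w1_cocycle d e (\<gamma> t) + w1_cocycle e g (\<gamma> t)"
    by (intro w1_cocycle_compose assms)
  then show "w1_cocycle d e (\<gamma> t) + w1_cocycle d g (\<gamma> t) = w1_cocycle e g (\<gamma> t)"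
    by (cases "w1_cocycle d e (\<gamma> t)") auto
qed

lemma bit_telescope: "(\<Sum>i<m. a i + a (Suc i)) = a 0 + a m" for a :: "nat \<Rightarrow> bit"
proof (induction m)
  case (Suc m)
  then show ?case by (cases "a m"; cases "a 0"; cases "a (Suc m)") auto
qed (cases "a 0"; simp)

lemma subdivision_mono:
  fixes t :: "nat \<Rightarrow> real"
  assumes "\<forall>i<n. t i < t (Suc i)" "i \<le> j" "j \<le> n"
  shows "t i \<le> t j"
  using assms(2,3)
proof (induction j rule: dec_induct)
  case (step j)
  then have "t j < t (Suc j)" using assms(1) by simp
  then show ?case using step by simp
qed simp

text \<open>
  Subdivide \<open>[0, 1]\<close> into equal parts that are shorter than a Lebesgue number of the cover by the
  preimages of chart domains.
\<close>

lemma chart_subdivision_exists: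
  assumes "continuous_on UNIV \<gamma>" "range \<gamma> \<subseteq> S"
  shows "\<exists>n t c. chart_subdivision AS \<gamma> n t c"
proof -
  have "\<exists>d\<in>AS. \<gamma> x \<in> cdom d" for x
    using assms(2) chart_at[of "\<gamma> x"] by blast
  then have cov: "{0..1} \<subseteq> \<Union> ((\<lambda>d. \<gamma> -` cdom d) ` AS)" by blast
  have op: "open G" if "G \<in> (\<lambda>d. \<gamma> -` cdom d) ` AS" for G
    using that open_vimage_openin[OF assms openin_cdom] by blast
  obtain e where e: "e > 0" "\<And>x. x \<in> {0..1} \<Longrightarrow> \<exists>G\<in>(\<lambda>d. \<gamma> -` cdom d) ` AS. ball x e \<subseteq> G"
    by (rule Heine_Borel_lemma[OF compact_Icc cov]) (erule op, rule that)
  obtain n where n: "n > 0" "1 / real n < e"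
    using nat_approx_posE[OF e(1)] zero_less_Suc by blast
  define t where "t i = real i / real n" for i
  have "\<exists>d. d \<in> AS \<and> \<gamma> ` {t i..t (Suc i)} \<subseteq> cdom d" if "i < n" for i
  proof -
    have "t i \<in> {0..1}" using that by (auto simp: t_def)
    then obtain d where d: "d \<in> AS" "ball (t i) e \<subseteq> \<gamma> -` cdom d" using e(2) by blast
    have "{t i..t (Suc i)} \<subseteq> ball (t i) e"
      using n by (auto simp: t_def dist_real_def add_divide_distrib)
    then show ?thesis using d by blast
  qed
  then obtain c where "\<forall>i. i < n \<longrightarrow> c i \<in> AS \<and> \<gamma> ` {t i..t (Suc i)} \<subseteq> cdom (c i)"
    using choice[of "\<lambda>i d. i < n \<longrightarrow> d \<in> AS \<and> \<gamma> ` {t i..t (Suc i)} \<subseteq> cdom d"] by blast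
  then have "chart_subdivision AS \<gamma> n t c"
    using n by (auto simp: chart_subdivision_def t_def divide_strict_right_mono)
  then show ?thesis by blast
qed

text \<open>
  The monodromy of the orientation covering: \<open>w\<^sub>1\<close> compares the two ends of a lift. For any
  subdivision the cocycle terms telescope, which shows at once that their sum does not depend on
  the subdivision. The lift belongs to a path \<open>\<gamma>\<close> that need not be periodic; only the values of the
  loop on \<open>[0, 1]\<close> enter.
\<close>

lemma w1_on_loop_eq_lift:
  assumes \<gamma>: "continuous_on UNIV \<gamma>" "range \<gamma> \<subseteq> S" "lift \<gamma> \<theta>" "\<gamma> 0 = \<gamma> 1"
    and eq: "\<And>u. 0 \<le> u \<Longrightarrow> u \<le> 1 \<Longrightarrow> \<Lambda> u = \<gamma> u"
    and d: "d \<in> AS" "\<gamma> 0 \<in> cdom d"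
  shows "w1_on_loop AS \<Lambda> = \<theta> d 0 + \<theta> d 1"
proof -
  have sub: "chart_subdivision AS \<Lambda> n t c \<longleftrightarrow> chart_subdivision AS \<gamma> n t c" for n t c
  proof (cases "t 0 = 0 \<and> t n = 1 \<and> (\<forall>i<n. t i < t (Suc i))")
    case True
    then have mono: "\<And>i j. i \<le> j \<Longrightarrow> j \<le> n \<Longrightarrow> t i \<le> t j" using subdivision_mono by blast
    have "\<Lambda> ` {t i..t (Suc i)} = \<gamma> ` {t i..t (Suc i)}" if "i < n" for i
    proof (intro image_cong refl eq)
      fix u assume "u \<in> {t i..t (Suc i)}"
      then show "0 \<le> u" "u \<le> 1"
        using mono[of 0 i] mono[of "Suc i" n] that True by auto
    qed
    then show ?thesis by (simp add: chart_subdivision_def cong: conj_cong)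
  qed (auto simp: chart_subdivision_def)
  have val: "(\<Sum>i<n. w1_cocycle (c i) (c (Suc i mod n)) (\<Lambda> (t (Suc i)))) = \<theta> d 0 + \<theta> d 1"
    if cs: "chart_subdivision AS \<Lambda> n t c" for n t c
  proof -
    obtain m where m: "n = Suc m" using cs by (cases n) (auto simp: chart_subdivision_def)
    have cs': "\<forall>i<n. t i < t (Suc i) \<and> c i \<in> AS \<and> \<gamma> ` {t i..t (Suc i)} \<subseteq> cdom (c i)"
      using iffD1[OF sub cs] by (simp add: chart_subdivision_def)
    have c: "c i \<in> AS" "t i < t (Suc i)" if "i < n" for i using cs' that by simp_all
    have c3: "\<gamma> u \<in> cdom (c i)" if "i < n" "t i \<le> u" "u \<le> t (Suc i)" for i u
    proof -
      have "\<gamma> u \<in> \<gamma> ` {t i..t (Suc i)}" using that by simp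
      then show ?thesis using cs' that(1) by blast
    qed
    have t01: "t 0 = 0" "t n = 1" using cs by (auto simp: chart_subdivision_def)
    have "t i \<le> t j" if "i \<le> j" "j \<le> n" for i j
      using subdivision_mono[of n t] that c(2) by blast
    then have "\<Lambda> (t i) = \<gamma> (t i)" if "i \<le> n" for i
      using that t01 eq by (metis le0 order_refl)
    note \<Lambda> = this
    define a where "a i = \<theta> (c i) (t i)" for i
    have a: "\<theta> (c i) (t (Suc i)) = a i" if "i < n" for i
      unfolding a_def
      by (rule lift_constant[OF \<gamma>(3) c(1)[OF that] connected_Icc, of "t i" "t (Suc i)"])
        (use c[OF that] c3[OF that] in auto)
    have "(\<Sum>i<n. w1_cocycle (c i) (c (Suc i mod n)) (\<Lambda> (t (Suc i)))) =
        (\<Sum>i<m. w1_cocycle (c i) (c (Suc i)) (\<gamma> (t (Suc i)))) + w1_cocycle (c m) (c 0) (\<gamma> 1)"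
      using t01 \<Lambda> by (simp add: m)
    also have "(\<Sum>i<m. w1_cocycle (c i) (c (Suc i)) (\<gamma> (t (Suc i)))) = (\<Sum>i<m. a i + a (Suc i))"
    proof (intro sum.cong refl)
      fix i assume "i \<in> {..<m}"
      then have i: "i < n" "Suc i < n" using m by auto
      have "w1_cocycle (c i) (c (Suc i)) (\<gamma> (t (Suc i))) = \<theta> (c i) (t (Suc i)) + \<theta> (c (Suc i)) (t (Suc i))"
        by (rule liftD(2)[OF \<gamma>(3), symmetric])
          (use c[OF i(1)] c[OF i(2)] c3[OF i(1)] c3[OF i(2)] in auto)
      then show "w1_cocycle (c i) (c (Suc i)) (\<gamma> (t (Suc i))) = a i + a (Suc i)"
        using a[OF i(1)] by (simp add: a_def)
    qed
    also have "\<dots> = a 0 + a m" by (rule bit_telescope)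
    also have "w1_cocycle (c m) (c 0) (\<gamma> 1) = \<theta> (c m) 1 + \<theta> (c 0) 1"
      by (rule liftD(2)[OF \<gamma>(3), symmetric])
        (use c[of m] c3[of m 1] c[of 0] c3[of 0 0] m t01 \<gamma>(4) in auto)
    also have "\<theta> (c m) 1 = a m" using a[of m] m t01 by simp
    also have "a 0 = \<theta> (c 0) 0" using t01 by (simp add: a_def)
    also have "\<theta> (c 0) 0 + a m + (a m + \<theta> (c 0) 1) = \<theta> (c 0) 0 + \<theta> (c 0) 1"
      by (cases "a m") auto
    also have "\<dots> = \<theta> d 0 + \<theta> d 1"
    proof -
      have c0: "c 0 \<in> AS" "\<gamma> 0 \<in> cdom (c 0)" using c[of 0] c3[of 0 0] m t01 by auto
      have "\<theta> (c 0) 0 + \<theta> d 0 = \<theta> (c 0) 1 + \<theta> d 1"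
        using liftD(2)[OF \<gamma>(3) c0 d] liftD(2)[OF \<gamma>(3) c0(1) _ d(1), of 1] c0(2) d(2) \<gamma>(4) by simp
      then show ?thesis
        by (cases "\<theta> (c 0) 0"; cases "\<theta> (c 0) 1"; cases "\<theta> d 0"; cases "\<theta> d 1") auto
    qed
    finally show ?thesis .
  qed
  obtain n t c where "chart_subdivision AS \<gamma> n t c"
    using chart_subdivision_exists[OF \<gamma>(1,2)] by blast
  then have cs: "chart_subdivision AS \<Lambda> n t c" using sub by simp
  show ?thesis
    unfolding w1_on_loop_def
  proof (rule the_equality)
    show "\<exists>n t c. chart_subdivision AS \<Lambda> n t c \<and>
        \<theta> d 0 + \<theta> d 1 = (\<Sum>i<n. w1_cocycle (c i) (c (Suc i mod n)) (\<Lambda> (t (Suc i))))"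
      by (rule exI[of _ n], rule exI[of _ t], rule exI[of _ c]) (simp only: cs val[OF cs])
    fix v
    assume "\<exists>n t c. chart_subdivision AS \<Lambda> n t c \<and>
        v = (\<Sum>i<n. w1_cocycle (c i) (c (Suc i mod n)) (\<Lambda> (t (Suc i))))"
    then show "v = \<theta> d 0 + \<theta> d 1" using val by (elim exE conjE) simp
  qed
qed

end

section \<open>Transport of orientations with a flip at the curve\<close>

lemma vector_derivative_cong_open:
  assumes "open V" "t \<in> V" "\<And>u. u \<in> V \<Longrightarrow> g u = h u"
  shows "vector_derivative g (at t) = vector_derivative h (at t)"
proof -
  have "(g has_vector_derivative D) (at t) \<longleftrightarrow> (h has_vector_derivative D) (at t)" for D
    using has_vector_derivative_transform_within_open[OF _ assms(1,2), of g D h]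
      has_vector_derivative_transform_within_open[OF _ assms(1,2), of h D g] assms(3) by auto
  then show ?thesis by (simp add: vector_derivative_def)
qed

locale curve_on_surface = surface S AS + base: manifold B AB
  for S :: "'s::{t2_space, second_countable_topology} set" and AS :: "('s, real^2) chart set"
    and B :: "'m::{t2_space, second_countable_topology} set" and AB :: "('m, real) chart set" +
  fixes f :: "'m \<Rightarrow> 's"
  assumes compact_base: "compact B" and generic: "generic_immersion B AB S AS f"
begin

lemma continuous_on_curve: "continuous_on B f"
  and curve_in_surface: "x \<in> B \<Longrightarrow> f x \<in> S"
  and smooth_curve: "c \<in> AB \<Longrightarrow> d \<in> AS \<Longrightarrow>
    smooth_on (cmap c ` (cdom c \<inter> f -` cdom d)) (cmap d \<circ> f \<circ> cinv c)"
  and velocity_nonzero: "c \<in> AB \<Longrightarrow> d \<in> AS \<Longrightarrow> x \<in> cdom c \<Longrightarrow> f x \<in> cdom d \<Longrightarrow> velocity c f d x \<noteq> 0"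
  and no_triple_point: "x \<in> B \<Longrightarrow> y \<in> B \<Longrightarrow> z \<in> B \<Longrightarrow> f x = f y \<Longrightarrow> f y = f z \<Longrightarrow> x = y \<or> y = z \<or> x = z"
  and double_point_transversal: "x \<in> B \<Longrightarrow> y \<in> B \<Longrightarrow> x \<noteq> y \<Longrightarrow> f x = f y \<Longrightarrow> transversal_at AS AB f x AB f y"
  using generic by (auto simp: generic_immersion_def immersion_1_def smooth_map_def)

lemma open_curve_domain:
  assumes "c \<in> AB" "d \<in> AS"
  shows "open (cmap c ` (cdom c \<inter> f -` cdom d))"
proof -
  have "openin (top_of_set B) (B \<inter> f -` cdom d)"
    using continuous_openin_preimage[OF continuous_on_curve _ openin_cdom[OF assms(2)]]
      curve_in_surface by auto
  from base.open_image_openin[OF assms(1) this]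
  have "open (cmap c ` (cdom c \<inter> (B \<inter> f -` cdom d)))" .
  also have "cdom c \<inter> (B \<inter> f -` cdom d) = cdom c \<inter> f -` cdom d"
    using base.cdom_subset[OF assms(1)] by blast
  finally show ?thesis .
qed

lemma curve_C1:
  assumes "c \<in> AB" "d \<in> AS"
  shows "C_diff_on (Suc 0) (cmap c ` (cdom c \<inter> f -` cdom d)) (cmap d \<circ> f \<circ> cinv c)"
  using smooth_curve[OF assms] by (simp add: smooth_on_def del: C_diff_on.simps)

lemma curve_derivative:
  assumes "c \<in> AB" "d \<in> AS" "x \<in> cdom c" "f x \<in> cdom d"
  shows "(cmap d \<circ> f \<circ> cinv c has_vector_derivative velocity c f d x) (at (cmap c x))"
proof -
  have "cmap d \<circ> f \<circ> cinv c differentiable at (cmap c x)"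
    using C_diff_on_SucD(1)[OF curve_C1[OF assms(1,2)], of "cmap c x"] assms(3,4)
    unfolding differentiable_def by blast
  then show ?thesis unfolding velocity_def vector_derivative_works .
qed

lemma velocity_change_surface_chart:
  assumes "c \<in> AB" "d \<in> AS" "e \<in> AS" "x \<in> cdom c" "f x \<in> cdom d" "f x \<in> cdom e"
  shows "velocity c f e x = J d e (f x) *v velocity c f d x"
proof -
  have x: "(f \<circ> cinv c) (cmap c x) = f x" using assms by simp
  have "\<forall>\<^sub>F t in nhds (cmap c x). t \<in> cmap c ` (cdom c \<inter> f -` cdom d)"
    using assms by (intro eventually_nhds_in_open open_curve_domain) auto
  then have "\<forall>\<^sub>F t in at (cmap c x). (f \<circ> cinv c) t \<in> cdom d"
    unfolding eventually_at_filter by (rule eventually_mono) (use assms in auto)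
  moreover have "(cmap d \<circ> (f \<circ> cinv c) has_vector_derivative velocity c f d x) (at (cmap c x))"
    using curve_derivative[OF assms(1,2,4,5)] by (simp only: comp_assoc)
  ultimately have "(cmap e \<circ> (f \<circ> cinv c) has_vector_derivative
      J d e ((f \<circ> cinv c) (cmap c x)) *v velocity c f d x) (at (cmap c x))"
    using x assms by (intro has_vector_derivative_change_chart) simp_all
  then have "(cmap e \<circ> (f \<circ> cinv c) has_vector_derivative J d e (f x) *v velocity c f d x) (at (cmap c x))"
    by (simp only: x)
  then show ?thesis
    unfolding velocity_def comp_assoc by (rule vector_derivative_at)
qed

lemma velocity_change_base_chart:
  assumes "c \<in> AB" "c' \<in> AB" "d \<in> AS" "x \<in> cdom c" "x \<in> cdom c'" "f x \<in> cdom d"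
  shows "velocity c f d x = deriv (cmap c' \<circ> cinv c) (cmap c x) *\<^sub>R velocity c' f d x"
proof -
  let ?h = "cmap c' \<circ> cinv c" and ?F = "cmap d \<circ> f \<circ> cinv c'"
  have "?h field_differentiable (at (cmap c x))"
    using base.has_derivative_transition[OF assms(1,2,4,5)] differentiable_def
      real_differentiableE field_differentiable_def by metis
  then have h: "(?h has_vector_derivative deriv ?h (cmap c x)) (at (cmap c x))"
    using field_differentiable_derivI has_real_derivative_iff_has_vector_derivative by blast
  have hx: "?h (cmap c x) = cmap c' x" using assms by simp
  have "(?F \<circ> ?h has_vector_derivative deriv ?h (cmap c x) *\<^sub>R velocity c' f d x) (at (cmap c x))"
    using vector_diff_chain_at[OF h] curve_derivative[OF assms(2,3,5,6)] hx by simp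
  then have "(cmap d \<circ> f \<circ> cinv c has_vector_derivative deriv ?h (cmap c x) *\<^sub>R velocity c' f d x) (at (cmap c x))"
    by (rule has_vector_derivative_transform_within_open[OF _ base.open_overlap[OF assms(1,2)]])
      (use assms in auto)
  then show ?thesis unfolding velocity_def by (rule vector_derivative_at)
qed

text \<open>
  Other charts multiply the determinant by the Jacobian determinant of a transition map and by the
  derivative of a coordinate change of the base, which are both non-zero; hence one pair of charts
  decides.
\<close>

lemma transversal_at_iff:
  assumes "smooth_path \<gamma>" "\<gamma> t = f x" "d \<in> AS" "f x \<in> cdom d" "c \<in> AB" "x \<in> cdom c"
  shows "transversal_at AS line_atlas \<gamma> t AB f x \<longleftrightarrow>
    det2 (vector_derivative (cmap d \<circ> \<gamma>) (at t)) (velocity c f d x) \<noteq> 0" (is "_ \<longleftrightarrow> det2 ?v ?w \<noteq> 0")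
proof
  assume "transversal_at AS line_atlas \<gamma> t AB f x"
  then show "det2 ?v ?w \<noteq> 0"
    using assms unfolding transversal_at_def line_atlas_def
    by (simp add: span_pair_eq_UNIV_iff velocity_line)
next
  assume D: "det2 ?v ?w \<noteq> 0"
  have "det2 (vector_derivative (cmap e \<circ> \<gamma>) (at t)) (velocity c' f e x) \<noteq> 0"
    if e: "e \<in> AS" "f x \<in> cdom e" and c': "c' \<in> AB" "x \<in> cdom c'" for e c'
  proof -
    have "\<forall>\<^sub>F s in nhds t. s \<in> \<gamma> -` cdom d"
      using assms smooth_path_open by (intro eventually_nhds_in_open) auto
    then have "\<forall>\<^sub>F s in at t. \<gamma> s \<in> cdom d"
      unfolding eventually_at_filter by (rule eventually_mono) simp
    from has_vector_derivative_change_chart[OF assms(3) e(1) _ _ this]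
    have "(cmap e \<circ> \<gamma> has_vector_derivative J d e (f x) *v ?v) (at t)"
      using smooth_path_derivative[OF assms(1,3)] assms e by simp
    then have v: "vector_derivative (cmap e \<circ> \<gamma>) (at t) = J d e (f x) *v ?v"
      by (rule vector_derivative_at)
    have w: "velocity c' f e x = J d e (f x) *v velocity c' f d x"
      by (rule velocity_change_surface_chart) (use assms e c' in auto)
    have "det2 ?v (velocity c' f d x) \<noteq> 0"
      using D velocity_change_base_chart[OF assms(5) c'(1) assms(3,6) c'(2) assms(4)]
      by (auto simp: det2_simps)
    then show ?thesis
      unfolding v w det2_matrix using det_J_nonzero[OF assms(3) e(1) assms(4) e(2)] by simp
  qed
  then show "transversal_at AS line_atlas \<gamma> t AB f x"
    unfolding transversal_at_def line_atlas_def
    using assms by (simp add: span_pair_eq_UNIV_iff velocity_line)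
qed

text \<open>
  General position at one parameter value. Unlike the condition on the whole path, it only depends
  on the path near that value and thus survives gluing.
\<close>

definition crosses_well :: "(real \<Rightarrow> 's) \<Rightarrow> real \<Rightarrow> bool" where
  "crosses_well \<gamma> t \<longleftrightarrow> (\<forall>x\<in>B. \<gamma> t = f x \<longrightarrow>
     transversal_at AS line_atlas \<gamma> t AB f x \<and> (\<forall>y\<in>B. f y = f x \<longrightarrow> y = x))"

lemma general_position_iff: "general_position B AB AS f \<gamma> \<longleftrightarrow> (\<forall>t. crosses_well \<gamma> t)"
  by (simp add: general_position_def crosses_well_def)

lemma crosses_well_off: "\<gamma> t \<notin> f ` B \<Longrightarrow> crosses_well \<gamma> t"
  by (auto simp: crosses_well_def)

lemma crosses_well_cong:
  assumes "open V" "t \<in> V" "\<And>u. u \<in> V \<Longrightarrow> \<gamma> u = \<gamma>' u" "crosses_well \<gamma>' t"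
  shows "crosses_well \<gamma> t"
proof -
  have "vector_derivative (cmap d \<circ> \<gamma>) (at t) = vector_derivative (cmap d \<circ> \<gamma>') (at t)" for d :: "('s, real^2) chart"
    using assms by (intro vector_derivative_cong_open[of V]) auto
  then show ?thesis
    using assms(2-4) unfolding crosses_well_def transversal_at_def line_atlas_def
    by (simp add: velocity_line)
qed

lemma crosses_well_affine:
  assumes "smooth_path \<gamma>" "m \<noteq> 0" "crosses_well \<gamma> (m * t + b)"
  shows "crosses_well (\<lambda>t. \<gamma> (m * t + b)) t"
  unfolding crosses_well_def
proof (intro ballI impI)
  fix x assume x: "x \<in> B" "\<gamma> (m * t + b) = f x"
  obtain c where c: "c \<in> AB" "x \<in> cdom c" using base.chart_at x(1) by blast
  obtain d where d: "d \<in> AS" "f x \<in> cdom d" using chart_at curve_in_surface x(1) by blast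
  let ?v = "vector_derivative (cmap d \<circ> \<gamma>) (at (m * t + b))"
  have T: "transversal_at AS line_atlas \<gamma> (m * t + b) AB f x"
    and simple: "\<forall>y\<in>B. f y = f x \<longrightarrow> y = x"
    using assms(3) x by (simp_all add: crosses_well_def)
  have "((\<lambda>t. m * t + b) has_vector_derivative m) (at t)"
    by (auto intro!: derivative_eq_intros simp: has_real_derivative_iff_has_vector_derivative[symmetric])
  moreover have "(cmap d \<circ> \<gamma> has_vector_derivative ?v) (at (m * t + b))"
    using smooth_path_derivative[OF assms(1) d(1)] d x by simp
  ultimately have "((cmap d \<circ> \<gamma>) \<circ> (\<lambda>t. m * t + b) has_vector_derivative m *\<^sub>R ?v) (at t)"
    by (rule vector_diff_chain_at)
  then have v: "vector_derivative (cmap d \<circ> (\<lambda>t. \<gamma> (m * t + b))) (at t) = m *\<^sub>R ?v"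
    by (simp add: vector_derivative_at o_def)
  show "transversal_at AS line_atlas (\<lambda>t. \<gamma> (m * t + b)) t AB f x \<and> (\<forall>y\<in>B. f y = f x \<longrightarrow> y = x)"
    using simple T transversal_at_iff[OF assms(1) x(2) d c]
      transversal_at_iff[OF smooth_path_affine[OF assms(1)] x(2) d c] v assms(2)
    by (auto simp: det2_simps)
qed

text \<open>
  A state is a chart together with a point of its domain off the curve, and stands for the
  orientation of the chart at that point. \<open>joins u v b\<close> means that some path in general position
  carries the orientation of \<open>u\<close>, reversed at each crossing with the curve, to \<open>(-1)\<^sup>b\<close> times the
  orientation of \<open>v\<close>. Paths stand still outside \<open>[0, 1]\<close>, so that joining them keeps them smooth.
\<close>

definition state :: "('s, real^2) chart \<times> 's \<Rightarrow> bool" where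
  "state u \<longleftrightarrow> fst u \<in> AS \<and> snd u \<in> cdom (fst u) \<and> snd u \<notin> f ` B"

definition crossings :: "(real \<Rightarrow> 's) \<Rightarrow> real set" where
  "crossings \<gamma> = {t. \<gamma> t \<in> f ` B}"

definition path_between :: "(real \<Rightarrow> 's) \<Rightarrow> 's \<Rightarrow> 's \<Rightarrow> bool" where
  "path_between \<gamma> p q \<longleftrightarrow> smooth_path \<gamma> \<and> (\<forall>t. crosses_well \<gamma> t) \<and> finite (crossings \<gamma>) \<and>
     (\<forall>t\<le>0. \<gamma> t = p) \<and> (\<forall>t\<ge>1. \<gamma> t = q)"

definition joins :: "('s, real^2) chart \<times> 's \<Rightarrow> ('s, real^2) chart \<times> 's \<Rightarrow> bit \<Rightarrow> bool" where
  "joins u v b \<longleftrightarrow> state u \<and> state v \<and> (\<exists>\<gamma> \<theta>. path_between \<gamma> (snd u) (snd v) \<and> lift \<gamma> \<theta> \<and>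
     b = \<theta> (fst u) 0 + \<theta> (fst v) 1 + of_nat (card (crossings \<gamma>)))"

lemma crossings_inside:
  assumes "path_between \<gamma> p q" "p \<notin> f ` B" "q \<notin> f ` B" "t \<in> crossings \<gamma>"
  shows "0 < t \<and> t < 1"
  using assms unfolding path_between_def crossings_def
  by (metis mem_Collect_eq not_le)

lemma crossings_affine:
  assumes "m \<noteq> 0"
  shows "crossings (\<lambda>t. \<gamma> (m * t + b)) = (\<lambda>s. (s - b) / m) ` crossings \<gamma>"
    and "card (crossings (\<lambda>t. \<gamma> (m * t + b))) = card (crossings \<gamma>)"
proof -
  show *: "crossings (\<lambda>t. \<gamma> (m * t + b)) = (\<lambda>s. (s - b) / m) ` crossings \<gamma>"
  proof (intro set_eqI iffI)
    fix t assume "t \<in> crossings (\<lambda>t. \<gamma> (m * t + b))"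
    then show "t \<in> (\<lambda>s. (s - b) / m) ` crossings \<gamma>"
      using assms by (intro image_eqI[of _ _ "m * t + b"]) (auto simp: crossings_def)
  qed (use assms in \<open>auto simp: crossings_def\<close>)
  have "inj_on (\<lambda>s. (s - b) / m) (crossings \<gamma>)" using assms by (auto simp: inj_on_def)
  then show "card (crossings (\<lambda>t. \<gamma> (m * t + b))) = card (crossings \<gamma>)"
    unfolding * by (rule card_image)
qed

lemma joins_sym:
  assumes "joins u v b"
  shows "joins v u b"
proof -
  obtain \<gamma> \<theta> where g: "path_between \<gamma> (snd u) (snd v)" "lift \<gamma> \<theta>"
    and b: "b = \<theta> (fst u) 0 + \<theta> (fst v) 1 + of_nat (card (crossings \<gamma>))"
    using assms by (auto simp: joins_def)
  have sm: "smooth_path \<gamma>" using g(1) by (simp add: path_between_def)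
  let ?g = "\<lambda>t. \<gamma> ((-1) * t + 1)"
  have "path_between ?g (snd v) (snd u)"
    unfolding path_between_def
  proof (intro conjI allI)
    show "smooth_path ?g" by (rule smooth_path_affine[OF sm])
    show "crosses_well ?g t" for t
      using g(1) by (intro crosses_well_affine[OF sm]) (auto simp: path_between_def)
    show "finite (crossings ?g)"
      using g(1) crossings_affine(1)[of "-1" \<gamma> 1] by (simp add: path_between_def)
  qed (use g(1) in \<open>auto simp: path_between_def\<close>)
  moreover have "lift ?g (\<lambda>d t. \<theta> d ((-1) * t + 1))" by (rule lift_affine[OF g(2)])
  moreover have "b = \<theta> (fst v) ((-1) * 0 + 1) + \<theta> (fst u) ((-1) * 1 + 1) + of_nat (card (crossings ?g))"
    unfolding b using crossings_affine(2)[of "-1" \<gamma> 1]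
    by (cases "\<theta> (fst u) 0"; cases "\<theta> (fst v) 1") simp_all
  ultimately show ?thesis using assms unfolding joins_def by blast
qed

lemma lift_at_ends:
  assumes "path_between \<gamma> p q" "lift \<gamma> \<theta>" "d \<in> AS"
  shows "p \<in> cdom d \<Longrightarrow> t \<le> 0 \<Longrightarrow> \<theta> d t = \<theta> d 0"
    and "q \<in> cdom d \<Longrightarrow> t \<ge> 1 \<Longrightarrow> \<theta> d t = \<theta> d 1"
proof -
  show "\<theta> d t = \<theta> d 0" if "p \<in> cdom d" "t \<le> 0"
    by (rule lift_constant[OF assms(2,3), of "{..0}"]) (use assms(1) that in \<open>auto simp: path_between_def\<close>)
  show "\<theta> d t = \<theta> d 1" if "q \<in> cdom d" "t \<ge> 1"
    by (rule lift_constant[OF assms(2,3), of "{1..}"]) (use assms(1) that in \<open>auto simp: path_between_def\<close>)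
qed

text \<open>
  The first path is run through during \<open>[0, 1/3]\<close> and the second one during \<open>[2/3, 1]\<close>. In between
  the joined path rests, so that near each parameter it agrees with one of the two reparametrised
  paths, and the lift of the second path can be adjusted by a constant to continue that of the
  first.
\<close>

lemma joins_trans:
  assumes "joins u v b" "joins v w b'"
  shows "joins u w (b + b')"
proof -
  obtain \<gamma>1 \<theta>1 where g1: "path_between \<gamma>1 (snd u) (snd v)" "lift \<gamma>1 \<theta>1"
    and b1: "b = \<theta>1 (fst u) 0 + \<theta>1 (fst v) 1 + of_nat (card (crossings \<gamma>1))"
    using assms(1) by (auto simp: joins_def)
  obtain \<gamma>2 \<theta>2 where g2: "path_between \<gamma>2 (snd v) (snd w)" "lift \<gamma>2 \<theta>2"
    and b2: "b' = \<theta>2 (fst v) 0 + \<theta>2 (fst w) 1 + of_nat (card (crossings \<gamma>2))"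
    using assms(2) by (auto simp: joins_def)
  have st: "state u" "state v" "state w" using assms by (auto simp: joins_def)
  have sm: "smooth_path \<gamma>1" "smooth_path \<gamma>2" using g1(1) g2(1) by (auto simp: path_between_def)
  define \<delta>1 where "\<delta>1 = (\<lambda>t. \<gamma>1 (3 * t + 0))"
  define \<delta>2 where "\<delta>2 = (\<lambda>t. \<gamma>2 (3 * t + (-2)))"
  define \<eta>1 where "\<eta>1 = (\<lambda>d t. \<theta>1 d (3 * t + 0))"
  define \<eta>2 where "\<eta>2 = (\<lambda>d t. \<theta>2 d (3 * t + (-2)))"
  define k where "k = \<theta>1 (fst v) 1 + \<theta>2 (fst v) 0"
  define \<gamma> where "\<gamma> = (\<lambda>t. if t < 1/2 then \<delta>1 t else \<delta>2 t)"
  define \<theta> where "\<theta> = (\<lambda>d t. if t < 1/2 then \<eta>1 d t else \<eta>2 d t + k)"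
  have e1: "\<gamma> t = \<delta>1 t" if "t < 2/3" for t
    using that g1(1) g2(1) unfolding \<gamma>_def \<delta>1_def \<delta>2_def path_between_def by (cases "t < 1/2") auto
  have e2: "\<gamma> t = \<delta>2 t" if "t > 1/3" for t
    using that g1(1) g2(1) unfolding \<gamma>_def \<delta>1_def \<delta>2_def path_between_def by (cases "t < 1/2") auto
  have l: "lift \<delta>1 \<eta>1" "lift \<delta>2 \<eta>2"
    unfolding \<delta>1_def \<delta>2_def \<eta>1_def \<eta>2_def by (intro lift_affine g1 g2)+
  \<comment> \<open>The two lifts over the resting point \<open>snd v\<close> differ by \<open>k\<close>, in every chart.\<close>
  have k: "\<theta>1 d 1 = \<theta>2 d 0 + k" if "d \<in> AS" "snd v \<in> cdom d" for d
  proof -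
    have ends: "\<gamma>1 1 = snd v" "\<gamma>2 0 = snd v" using g1(1) g2(1) by (auto simp: path_between_def)
    have v: "fst v \<in> AS" "snd v \<in> cdom (fst v)" using st by (auto simp: state_def)
    have "\<theta>1 d 1 + \<theta>1 (fst v) 1 = \<theta>2 d 0 + \<theta>2 (fst v) 0"
      using liftD(2)[OF g1(2) that(1) _ v(1), of 1] liftD(2)[OF g2(2) that(1) _ v(1), of 0] ends that v by simp
    then show ?thesis unfolding k_def
      by (cases "\<theta>1 d 1"; cases "\<theta>1 (fst v) 1"; cases "\<theta>2 d 0"; cases "\<theta>2 (fst v) 0") auto
  qed
  have m: "\<eta>1 d t = \<eta>2 d t + k" if "d \<in> AS" "snd v \<in> cdom d" "1/3 < t" "t < 2/3" for d t
    unfolding \<eta>1_def \<eta>2_def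
    using k[OF that(1,2)] lift_at_ends(2)[OF g1 that(1,2), of "3 * t + 0"]
      lift_at_ends(1)[OF g2 that(1,2), of "3 * t + (-2)"] that(3,4) by simp
  have rest: "\<gamma> t = snd v" if "1/3 < t" "t < 2/3" for t
    using that g1(1) e1[of t] by (auto simp: \<delta>1_def path_between_def)
  have t1: "\<theta> d t = \<eta>1 d t" if "t < 2/3" "d \<in> AS" "\<gamma> t \<in> cdom d" for d t
    using that m[of d t] rest[of t] by (auto simp: \<theta>_def)
  have t2: "\<theta> d t = \<eta>2 d t + k" if "t > 1/3" "d \<in> AS" "\<gamma> t \<in> cdom d" for d t
    using that m[of d t] rest[of t] by (auto simp: \<theta>_def)
  have lift: "lift \<gamma> \<theta>"
    unfolding lift_def
  proof (intro conjI ballI allI impI)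
    fix d t assume d: "d \<in> AS" "\<gamma> t \<in> cdom d"
    consider "t < 1/2" | "t > 1/2" | "t = 1/2" by linarith
    then show "\<forall>\<^sub>F u in nhds t. \<theta> d u = \<theta> d t"
    proof cases
      case 1
      then have "\<forall>\<^sub>F u in nhds t. u < 1/2" by (intro eventually_nhds_in_open[of "{..<1/2}", simplified]) auto
      moreover have "\<forall>\<^sub>F u in nhds t. \<eta>1 d u = \<eta>1 d t"
        using liftD(1)[OF l(1) d(1)] d 1 e1[of t] by simp
      ultimately show ?thesis by eventually_elim (use 1 in \<open>simp add: \<theta>_def\<close>)
    next
      case 2
      then have "\<forall>\<^sub>F u in nhds t. u > 1/2" by (intro eventually_nhds_in_open[of "{1/2<..}", simplified]) auto
      moreover have "\<forall>\<^sub>F u in nhds t. \<eta>2 d u = \<eta>2 d t"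
        using liftD(1)[OF l(2) d(1)] d 2 e2[of t] by simp
      ultimately show ?thesis by eventually_elim (use 2 in \<open>simp add: \<theta>_def\<close>)
    next
      case 3
      then have "\<forall>\<^sub>F u in nhds t. u \<in> {1/3<..<2/3}" by (intro eventually_nhds_in_open) auto
      moreover have "\<forall>\<^sub>F u in nhds t. \<eta>2 d u = \<eta>2 d t"
        using liftD(1)[OF l(2) d(1), of t] d(2) e2[of t] unfolding 3 by simp
      ultimately show ?thesis
      proof eventually_elim
        case (elim u)
        have t: "1/3 < t" "t < 2/3" using 3 by auto
        have v: "snd v \<in> cdom d" using d(2) rest[OF t] by simp
        have "\<theta> d u = \<eta>2 d u + k" using t2[of u d] elim(1) rest[of u] v d(1) by simp
        moreover have "\<theta> d t = \<eta>2 d t + k" using t2[OF t(1) d] .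
        ultimately show ?case using elim(2) by metis
      qed
    qed
  next
    fix d e t assume de: "d \<in> AS" "e \<in> AS" "\<gamma> t \<in> cdom d" "\<gamma> t \<in> cdom e"
    show "\<theta> d t + \<theta> e t = w1_cocycle d e (\<gamma> t)"
    proof (cases "t < 1/2")
      case True
      then show ?thesis
        using liftD(2)[OF l(1) de(1) _ de(2), of t] de e1[of t] by (simp add: \<theta>_def)
    next
      case False
      then show ?thesis
        using liftD(2)[OF l(2) de(1) _ de(2), of t] de e2[of t]
        by (cases k; cases "\<eta>2 d t"; cases "\<eta>2 e t") (simp_all add: \<theta>_def)
    qed
  qed
  have X: "crossings \<gamma> = crossings \<delta>1 \<union> crossings \<delta>2" "crossings \<delta>1 \<inter> crossings \<delta>2 = {}"
    "finite (crossings \<delta>1)" "finite (crossings \<delta>2)"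
  proof -
    have i1: "t < 1/3" if "t \<in> crossings \<delta>1" for t
      using crossings_inside[OF g1(1), of "3 * t + 0"] st that by (auto simp: crossings_def \<delta>1_def state_def)
    have i2: "t > 2/3" if "t \<in> crossings \<delta>2" for t
      using crossings_inside[OF g2(1), of "3 * t + (-2)"] st that by (auto simp: crossings_def \<delta>2_def state_def)
    show "crossings \<delta>1 \<inter> crossings \<delta>2 = {}"
      using i1 i2 by force
    show "crossings \<gamma> = crossings \<delta>1 \<union> crossings \<delta>2"
    proof (intro set_eqI iffI)
      fix t assume "t \<in> crossings \<gamma>"
      then show "t \<in> crossings \<delta>1 \<union> crossings \<delta>2"
        by (auto simp: crossings_def \<gamma>_def split: if_splits)
    next
      fix t assume "t \<in> crossings \<delta>1 \<union> crossings \<delta>2"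
      then show "t \<in> crossings \<gamma>"
      proof
        assume "t \<in> crossings \<delta>1"
        then show ?thesis using i1[of t] e1[of t] by (simp add: crossings_def)
      next
        assume "t \<in> crossings \<delta>2"
        then show ?thesis using i2[of t] e2[of t] by (simp add: crossings_def)
      qed
    qed
    show "finite (crossings \<delta>1)" "finite (crossings \<delta>2)"
      using g1(1) g2(1) crossings_affine(1)[of 3 \<gamma>1 0] crossings_affine(1)[of 3 \<gamma>2 "-2"]
      by (auto simp: \<delta>1_def \<delta>2_def path_between_def)
  qed
  have loc: "\<exists>V. open V \<and> t \<in> V \<and> ((\<forall>u\<in>V. \<gamma> u = \<delta>1 u) \<or> (\<forall>u\<in>V. \<gamma> u = \<delta>2 u))" for t
  proof (cases "t < 2/3")
    case True
    then show ?thesis using e1 by (intro exI[of _ "{..<2/3}"]) auto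
  next
    case False
    then show ?thesis using e2 by (intro exI[of _ "{1/3<..}"]) auto
  qed
  have sd: "smooth_path \<delta>1" "smooth_path \<delta>2"
    unfolding \<delta>1_def \<delta>2_def by (intro smooth_path_affine sm)+
  have cw1: "crosses_well \<delta>1 t" for t
    unfolding \<delta>1_def by (rule crosses_well_affine[OF sm(1)]) (use g1(1) in \<open>auto simp: path_between_def\<close>)
  have cw2: "crosses_well \<delta>2 t" for t
    unfolding \<delta>2_def by (rule crosses_well_affine[OF sm(2)]) (use g2(1) in \<open>auto simp: path_between_def\<close>)
  have "path_between \<gamma> (snd u) (snd w)"
    unfolding path_between_def
  proof (intro conjI allI impI)
    show "smooth_path \<gamma>" by (rule smooth_path_local) (use loc sd in metis)
    show "crosses_well \<gamma> t" for t using loc[of t] cw1 cw2 crosses_well_cong by metis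
    show "finite (crossings \<gamma>)" using X by simp
    show "\<gamma> t = snd u" if "t \<le> 0" for t using that g1(1) by (simp add: \<gamma>_def \<delta>1_def path_between_def)
    show "\<gamma> t = snd w" if "t \<ge> 1" for t using that g2(1) by (simp add: \<gamma>_def \<delta>2_def path_between_def)
  qed
  moreover have "card (crossings \<gamma>) = card (crossings \<gamma>1) + card (crossings \<gamma>2)"
    using X card_Un_disjoint[OF X(3,4,2)] crossings_affine(2)[of 3 \<gamma>1 0] crossings_affine(2)[of 3 \<gamma>2 "-2"]
    by (simp add: \<delta>1_def \<delta>2_def)
  moreover have "\<theta> (fst u) 0 = \<theta>1 (fst u) 0" "\<theta> (fst w) 1 = \<theta>2 (fst w) 1 + k"
    by (auto simp: \<theta>_def \<eta>1_def \<eta>2_def)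
  moreover have "b + b' = \<theta>1 (fst u) 0 + (\<theta>2 (fst w) 1 + k) + of_nat (card (crossings \<gamma>1) + card (crossings \<gamma>2))"
    unfolding b1 b2 k_def of_nat_add by (simp only: ac_simps)
  ultimately show ?thesis using lift st unfolding joins_def by metis
qed

end

text \<open>
  Transport without holonomy comes from a potential: in each class of connected vertices fix a
  representative and take the label of a connection with it.
\<close>

lemma potential_exists:
  fixes R :: "'v \<Rightarrow> 'v \<Rightarrow> bit \<Rightarrow> bool"
  assumes sym: "\<And>u v b. R u v b \<Longrightarrow> R v u b"
    and trans: "\<And>u v w b c. R u v b \<Longrightarrow> R v w c \<Longrightarrow> R u w (b + c)"
    and closed: "\<And>u b. R u u b \<Longrightarrow> b = 0"
  shows "\<exists>\<epsilon>. \<forall>u v b. R u v b \<longrightarrow> b = \<epsilon> u + \<epsilon> v"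
proof -
  define rep where "rep u = (SOME r. \<exists>b. R u r b)" for u
  define \<epsilon> where "\<epsilon> u = (SOME b. R u (rep u) b)" for u
  have "b = \<epsilon> u + \<epsilon> v" if b: "R u v b" for u v b
  proof -
    have "(\<exists>b. R u r b) \<longleftrightarrow> (\<exists>b. R v r b)" for r
      using b sym trans by blast
    then have r: "rep u = rep v" by (simp add: rep_def)
    have eps: "R w (rep w) (\<epsilon> w)" if "\<exists>r b. R w r b" for w
    proof -
      have "\<exists>b. R w (rep w) b" unfolding rep_def using someI_ex[OF that] .
      then show ?thesis unfolding \<epsilon>_def by (rule someI_ex)
    qed
    have "R u (rep u) (\<epsilon> u)" by (rule eps) (use b in blast)
    moreover have "R v (rep u) (\<epsilon> v)" unfolding r by (rule eps) (use sym[OF b] in blast)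
    ultimately have "R u v (\<epsilon> u + \<epsilon> v)" using sym trans by blast
    from closed[OF trans[OF this sym[OF b]]] show ?thesis
      by (cases b; cases "\<epsilon> u"; cases "\<epsilon> v") auto
  qed
  then show ?thesis by blast
qed

locale curve_dual_to_w1 = curve_on_surface S AS B AB f
  for S :: "'s::{t2_space, second_countable_topology} set" and AS :: "('s, real^2) chart set"
    and B :: "'m::{t2_space, second_countable_topology} set" and AB :: "('m, real) chart set"
    and f :: "'m \<Rightarrow> 's" +
  assumes dual: "dual_to_w1 B AB S AS f"
begin

text \<open>
  Here the curve being dual to \<open>w\<^sub>1\<close> enters. A closed path extends to a smooth loop, as it rests at
  both ends. Around this loop the transported orientation is reversed \<open>w\<^sub>1\<close> times by the surface
  and once at each crossing, which is an even number of times in total.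
\<close>

lemma joins_loop:
  assumes "joins u u b"
  shows "b = 0"
proof -
  obtain d p where u: "u = (d, p)" by (cases u)
  obtain \<gamma> \<theta> where g: "path_between \<gamma> p p" "lift \<gamma> \<theta>"
    and b: "b = \<theta> d 0 + \<theta> d 1 + of_nat (card (crossings \<gamma>))"
    using assms by (auto simp: joins_def u)
  have st: "d \<in> AS" "p \<in> cdom d" "p \<notin> f ` B" using assms by (auto simp: joins_def state_def u)
  have sm: "smooth_path \<gamma>" and cw: "\<And>t. crosses_well \<gamma> t"
    and ends: "\<And>t. t \<le> 0 \<Longrightarrow> \<gamma> t = p" "\<And>t. t \<ge> 1 \<Longrightarrow> \<gamma> t = p"
    using g(1) by (auto simp: path_between_def)
  define \<Lambda> where "\<Lambda> t = \<gamma> (3 * frac t - 1)" for t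
  have loc: "\<exists>V. open V \<and> t \<in> V \<and> (\<forall>u\<in>V. \<Lambda> u = \<gamma> (3 * u + (- 3 * of_int \<lfloor>t\<rfloor> - 1)))" for t
  proof (cases "of_int \<lfloor>t\<rfloor> = t")
    case True
    have "\<Lambda> u = \<gamma> (3 * u + (- 3 * of_int \<lfloor>t\<rfloor> - 1))" if "t - 1/3 < u" "u < t + 1/3" for u
    proof -
      have "\<gamma> (3 * u + (- 3 * of_int \<lfloor>t\<rfloor> - 1)) = p"
        using that True by (intro ends(1)) linarith
      moreover have "\<Lambda> u = p"
      proof (cases "u < t")
        case u: True
        then have "\<lfloor>u\<rfloor> = \<lfloor>t\<rfloor> - 1" using that True by (intro floor_unique) auto
        then have "frac u = u - t + 1" using True by (simp add: frac_def)
        then show ?thesis unfolding \<Lambda>_def using that by (intro ends(2)) simp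
      next
        case u: False
        then have "\<lfloor>u\<rfloor> = \<lfloor>t\<rfloor>" using that True by (intro floor_unique) auto
        then have "frac u = u - t" using True by (simp add: frac_def)
        then show ?thesis unfolding \<Lambda>_def using that by (intro ends(1)) simp
      qed
      ultimately show ?thesis by simp
    qed
    then show ?thesis by (intro exI[of _ "{t - 1/3<..<t + 1/3}"]) auto
  next
    case False
    have lt: "of_int \<lfloor>t\<rfloor> < t" using False of_int_floor_le[of t] by linarith
    have "\<Lambda> u = \<gamma> (3 * u + (- 3 * of_int \<lfloor>t\<rfloor> - 1))" if "of_int \<lfloor>t\<rfloor> < u" "u < of_int \<lfloor>t\<rfloor> + 1" for u
    proof -
      have "\<lfloor>u\<rfloor> = \<lfloor>t\<rfloor>" using that by (intro floor_unique) auto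
      then show ?thesis by (simp add: \<Lambda>_def frac_def algebra_simps)
    qed
    then show ?thesis using lt by (intro exI[of _ "{of_int \<lfloor>t\<rfloor><..<of_int \<lfloor>t\<rfloor> + 1}"]) auto
  qed
  have "smooth_path \<Lambda>"
  proof (rule smooth_path_local)
    fix t
    obtain V where "open V" "t \<in> V" "\<forall>u\<in>V. \<Lambda> u = \<gamma> (3 * u + (- 3 * of_int \<lfloor>t\<rfloor> - 1))"
      using loc by blast
    then show "\<exists>V \<gamma>'. open V \<and> t \<in> V \<and> smooth_path \<gamma>' \<and> (\<forall>u\<in>V. \<Lambda> u = \<gamma>' u)"
      using smooth_path_affine[OF sm, of 3 "- 3 * of_int \<lfloor>t\<rfloor> - 1"] by blast
  qed
  then have loop: "smooth_loop S AS \<Lambda>"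
    by (simp add: smooth_loop_def smooth_path_iff[symmetric] \<Lambda>_def frac_1_eq)
  have gp: "general_position B AB AS f \<Lambda>"
    unfolding general_position_iff
  proof
    fix t
    obtain V where V: "open V" "t \<in> V" "\<forall>u\<in>V. \<Lambda> u = \<gamma> (3 * u + (- 3 * of_int \<lfloor>t\<rfloor> - 1))"
      using loc by blast
    have "crosses_well (\<lambda>u. \<gamma> (3 * u + (- 3 * of_int \<lfloor>t\<rfloor> - 1))) t"
      by (rule crosses_well_affine[OF sm _ cw]) simp
    from crosses_well_cong[OF V(1,2) _ this] V(3) show "crosses_well \<Lambda> t" by blast
  qed
  let ?g = "\<lambda>t. \<gamma> (3 * t + (-1))"
  have eq: "\<Lambda> t = ?g t" if "0 \<le> t" "t \<le> 1" for t
  proof (cases "t = 1")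
    case True
    then show ?thesis using ends(1)[of "-1"] ends(2)[of 2] by (simp add: \<Lambda>_def)
  next
    case False
    then have "frac t = t" using that by (simp add: frac_eq)
    then show ?thesis by (simp add: \<Lambda>_def)
  qed
  have "w1_on_loop AS \<Lambda> = \<theta> d (3 * 0 + (-1)) + \<theta> d (3 * 1 + (-1))"
  proof (rule w1_on_loop_eq_lift[OF _ _ lift_affine[OF g(2)] _ eq st(1)])
    show "continuous_on UNIV ?g" "range ?g \<subseteq> S"
      using smooth_path_affine[OF sm, of 3 "-1"] by (auto simp: smooth_path_def)
  qed (use ends(1)[of "-1"] ends(2)[of 2] st in auto)
  also have "\<theta> d (3 * 0 + (-1)) = \<theta> d 0" by (rule lift_at_ends(1)[OF g st(1,2)]) simp
  also have "\<theta> d (3 * 1 + (-1)) = \<theta> d 1" by (rule lift_at_ends(2)[OF g st(1,2)]) simp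
  finally have w: "w1_on_loop AS \<Lambda> = \<theta> d 0 + \<theta> d 1" .
  have "{t \<in> {0..<1}. \<Lambda> t \<in> f ` B} = crossings ?g"
  proof (intro set_eqI iffI)
    fix t assume "t \<in> {t \<in> {0..<1}. \<Lambda> t \<in> f ` B}"
    then show "t \<in> crossings ?g" using eq[of t] by (simp add: crossings_def)
  next
    fix t assume t: "t \<in> crossings ?g"
    then have "0 < 3 * t + (-1) \<and> 3 * t + (-1) < 1"
      by (intro crossings_inside[OF g(1) st(3,3)]) (simp add: crossings_def)
    then show "t \<in> {t \<in> {0..<1}. \<Lambda> t \<in> f ` B}" using eq[of t] t by (simp add: crossings_def)
  qed
  then have "card {t \<in> {0..<1}. \<Lambda> t \<in> f ` B} = card (crossings \<gamma>)"
    using crossings_affine(2)[of 3 \<gamma> "-1"] by simp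
  then have "\<theta> d 0 + \<theta> d 1 = of_nat (card (crossings \<gamma>))"
    using dual loop gp w unfolding dual_to_w1_def by metis
  then show ?thesis unfolding b
    by (cases "\<theta> d 0"; cases "\<theta> d 1") auto
qed

text \<open>
  An orientation of the complement of the curve that is reversed on crossing the curve, recorded
  in each chart relative to the orientation of the chart: the value is \<open>0\<close> where the two agree, for
  one of the two choices on each class of connected states.
\<close>

definition flip_orientation :: "('s, real^2) chart \<times> 's \<Rightarrow> bit" where
  "flip_orientation = (SOME \<epsilon>. \<forall>u v b. joins u v b \<longrightarrow> b = \<epsilon> u + \<epsilon> v)"

lemma flip_orientation_joins: "joins u v b \<Longrightarrow> b = flip_orientation u + flip_orientation v"
proof -
  assume j: "joins u v b"
  have "\<exists>\<epsilon>. \<forall>u v b. joins u v b \<longrightarrow> b = \<epsilon> u + \<epsilon> v"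
    by (rule potential_exists) (erule joins_sym, erule (1) joins_trans, erule joins_loop)
  from someI_ex[OF this] j show ?thesis unfolding flip_orientation_def by blast
qed

definition trace :: "('s, real^2) chart \<Rightarrow> (real^2) set" where
  "trace d = cmap d ` (cdom d \<inter> f ` B)"

definition flip_in_chart :: "('s, real^2) chart \<Rightarrow> real^2 \<Rightarrow> bit" where
  "flip_in_chart d y = flip_orientation (d, cinv d y)"

lemma trace_iff: "d \<in> AS \<Longrightarrow> y \<in> cmap d ` cdom d \<Longrightarrow> y \<in> trace d \<longleftrightarrow> cinv d y \<in> f ` B"
  unfolding trace_def by (metis (no_types, lifting) IntD2 IntI cinv_cmap cinv_in cmap_cinv image_iff inf_le1 subsetD)

lemma flip_in_chart_change_chart:
  assumes "d \<in> AS" "e \<in> AS" "p \<in> cdom d" "p \<in> cdom e" "p \<notin> f ` B"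
  shows "flip_in_chart e (cmap e p) = flip_in_chart d (cmap d p) + w1_cocycle d e p"
proof -
  have pS: "p \<in> S" using assms cdom_subset by blast
  have "joins (d, p) (e, p) (w1_cocycle d d p + w1_cocycle d e p + of_nat (card (crossings (\<lambda>t. p))))"
    unfolding joins_def
  proof (intro conjI exI)
    show "path_between (\<lambda>t. p) (snd (d, p)) (snd (e, p))"
      using assms pS by (auto simp: path_between_def smooth_path_const crosses_well_off crossings_def)
    show "lift (\<lambda>t. p) (\<lambda>e t. w1_cocycle d e p)"
      using lift_single_chart[of "\<lambda>t. p" d] assms by simp
  qed (use assms in \<open>auto simp: state_def\<close>)
  moreover have "crossings (\<lambda>t. p) = {}" using assms by (simp add: crossings_def)
  ultimately have "joins (d, p) (e, p) (w1_cocycle d e p)"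
    by (simp only: w1_cocycle_self[OF assms(1,3)] card.empty of_nat_0 add_0 add_0_right)
  from flip_orientation_joins[OF this] show ?thesis
    using assms unfolding flip_in_chart_def
    by (cases "flip_orientation (d, p)"; cases "flip_orientation (e, p)") auto
qed

text \<open>
  A segment in a chart, run through with a smooth step, is a path that never leaves the chart.
  Hence its lift has the same value at both ends, and only the crossings count.
\<close>

lemma segment_joins:
  assumes d: "d \<in> AS" and seg: "closed_segment y y' \<subseteq> cmap d ` cdom d"
    and off: "y \<notin> trace d" "y' \<notin> trace d"
    and X: "X = {s \<in> {0..1}. y + s *\<^sub>R (y' - y) \<in> trace d}" "finite X"
    and good: "\<And>x. x \<in> B \<Longrightarrow> f x \<in> cdom d \<Longrightarrow> cmap d (f x) \<in> closed_segment y y' \<Longrightarrow>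
      (\<forall>x'\<in>B. f x' = f x \<longrightarrow> x' = x) \<and> (\<exists>c\<in>AB. x \<in> cdom c \<and> det2 (y' - y) (velocity c f d x) \<noteq> 0)"
  shows "joins (d, cinv d y) (d, cinv d y') (of_nat (card X))"
proof -
  obtain \<phi> :: "real \<Rightarrow> real" where \<phi>: "smooth_on UNIV \<phi>"
    "\<And>t. t \<le> 0 \<Longrightarrow> \<phi> t = 0" "\<And>t. t \<ge> 1 \<Longrightarrow> \<phi> t = 1"
    "\<And>t. 0 < t \<Longrightarrow> t < 1 \<Longrightarrow> 0 < \<phi> t \<and> \<phi> t < 1"
    "\<And>t. 0 < t \<Longrightarrow> t < 1 \<Longrightarrow> \<exists>D>0. (\<phi> has_real_derivative D) (at t)"
    "inj_on \<phi> {0..1}"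
    using smooth_step_exists by blast
  define h where "h t = y + \<phi> t *\<^sub>R (y' - y)" for t
  define \<gamma> where "\<gamma> t = cinv d (h t)" for t
  have \<phi>01: "\<phi> t \<in> {0..1}" for t
    using \<phi>(2)[of t] \<phi>(3)[of t] \<phi>(4)[of t] by (cases "t \<le> 0"; cases "t \<ge> 1") auto
  have segI: "y + s *\<^sub>R (y' - y) \<in> closed_segment y y'" if "s \<in> {0..1}" for s
    unfolding in_segment by (rule exI[of _ s]) (use that in \<open>simp add: algebra_simps\<close>)
  have hseg: "h t \<in> closed_segment y y'" for t unfolding h_def using segI \<phi>01 by blast
  then have him: "h t \<in> cmap d ` cdom d" for t using seg by blast
  have \<gamma>d: "\<gamma> t \<in> cdom d" "cmap d (\<gamma> t) = h t" for t
    unfolding \<gamma>_def using cinv_in[OF d him] cmap_cinv[OF d him] by auto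
  have c\<phi>: "continuous_on UNIV \<phi>" using \<phi>(1) by (metis C_diff_on.simps(1) smooth_on_def)
  have cont: "continuous_on UNIV \<gamma>"
    unfolding \<gamma>_def
  proof (rule continuous_on_compose2[OF continuous_on_cinv[OF d]])
    show "continuous_on UNIV h" unfolding h_def by (intro continuous_intros c\<phi>)
  qed (use him in auto)
  have sm: "smooth_path \<gamma>"
    unfolding smooth_path_def
  proof (intro conjI ballI)
    show "range \<gamma> \<subseteq> S" using \<gamma>d(1) cdom_subset[OF d] by blast
    fix e assume e: "e \<in> AS"
    have "\<gamma> -` cdom e = {t. y + \<phi> t *\<^sub>R (y' - y) \<in> cmap d ` (cdom d \<inter> cdom e)}"
    proof (intro set_eqI iffI)
      fix t assume "t \<in> \<gamma> -` cdom e"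
      then have "h t \<in> cmap d ` (cdom d \<inter> cdom e)" using \<gamma>d[of t] by (intro image_eqI[of _ _ "\<gamma> t"]) auto
      then show "t \<in> {t. y + \<phi> t *\<^sub>R (y' - y) \<in> cmap d ` (cdom d \<inter> cdom e)}" by (simp add: h_def)
    next
      fix t assume "t \<in> {t. y + \<phi> t *\<^sub>R (y' - y) \<in> cmap d ` (cdom d \<inter> cdom e)}"
      then obtain q where "q \<in> cdom d" "q \<in> cdom e" "h t = cmap d q" by (auto simp: h_def)
      then show "t \<in> \<gamma> -` cdom e" using d by (simp add: \<gamma>_def)
    qed
    then show "smooth_on (\<gamma> -` cdom e) (cmap e \<circ> \<gamma>)"
      using smooth_on_compose_line[OF open_overlap[OF d e] smooth_transition[OF d e] \<phi>(1), of y "y' - y"]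
      by (simp add: \<gamma>_def[abs_def] h_def[abs_def] o_def)
  qed (rule cont)
  have on: "\<gamma> t \<in> f ` B \<longleftrightarrow> h t \<in> trace d" for t
    unfolding \<gamma>_def using trace_iff[OF d him] by simp
  have h01: "h t = y" if "t \<le> 0" for t using \<phi>(2)[OF that] by (simp add: h_def)
  have h1: "h t = y'" if "t \<ge> 1" for t using \<phi>(3)[OF that] by (simp add: h_def)
  have inside: "0 < t \<and> t < 1" if "h t \<in> trace d" for t
    using that off h01[of t] h1[of t] by (metis not_le)
  have cw: "crosses_well \<gamma> t" for t
    unfolding crosses_well_def
  proof (intro ballI impI)
    fix x assume x: "x \<in> B" "\<gamma> t = f x"
    have xd: "f x \<in> cdom d" "cmap d (f x) = h t" using \<gamma>d[of t] x by auto
    from good[OF x(1) xd(1)] hseg[of t] xd(2) obtain c where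
      simple: "\<forall>x'\<in>B. f x' = f x \<longrightarrow> x' = x" and c: "c \<in> AB" "x \<in> cdom c"
      and D: "det2 (y' - y) (velocity c f d x) \<noteq> 0" by auto
    have "0 < t \<and> t < 1" by (rule inside) (use on[of t] x in auto)
    then obtain D' where D': "D' > 0" "(\<phi> has_real_derivative D') (at t)" using \<phi>(5) by blast
    have "cmap d \<circ> \<gamma> = (\<lambda>t. y + \<phi> t *\<^sub>R (y' - y))" using \<gamma>d(2) by (auto simp: h_def)
    moreover have "((\<lambda>t. y + \<phi> t *\<^sub>R (y' - y)) has_vector_derivative D' *\<^sub>R (y' - y)) (at t)"
      using D'(2) by (auto intro!: derivative_eq_intros)
    ultimately have "vector_derivative (cmap d \<circ> \<gamma>) (at t) = D' *\<^sub>R (y' - y)"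
      by (simp add: vector_derivative_at)
    then show "transversal_at AS line_atlas \<gamma> t AB f x \<and> (\<forall>y\<in>B. f y = f x \<longrightarrow> y = x)"
      using simple D D' transversal_at_iff[OF sm x(2) d xd(1) c] by (simp add: det2_simps)
  qed
  have bij: "bij_betw \<phi> (crossings \<gamma>) X"
    unfolding bij_betw_def
  proof
    have "crossings \<gamma> \<subseteq> {0..1}" using inside on by (force simp: crossings_def)
    then show "inj_on \<phi> (crossings \<gamma>)" using \<phi>(6) inj_on_subset by blast
    show "\<phi> ` crossings \<gamma> = X"
    proof (intro set_eqI iffI)
      fix s assume "s \<in> \<phi> ` crossings \<gamma>"
      then show "s \<in> X" unfolding X crossings_def on using \<phi>01 by (auto simp: h_def)
    next
      fix s assume s: "s \<in> X"
      have "\<exists>t\<ge>0. t \<le> 1 \<and> \<phi> t = s"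
        by (rule IVT') (use s \<phi>(2)[of 0] \<phi>(3)[of 1] c\<phi> X in \<open>auto intro: continuous_on_subset\<close>)
      then obtain t where "\<phi> t = s" by blast
      then show "s \<in> \<phi> ` crossings \<gamma>"
        using s unfolding X crossings_def on by (auto simp: h_def)
    qed
  qed
  have "joins (d, cinv d y) (d, cinv d y')
     (w1_cocycle d d (\<gamma> 0) + w1_cocycle d d (\<gamma> 1) + of_nat (card (crossings \<gamma>)))"
    unfolding joins_def
  proof (intro conjI exI)
    show "path_between \<gamma> (snd (d, cinv d y)) (snd (d, cinv d y'))"
      unfolding path_between_def
      using sm cw bij_betw_finite[OF bij] X(2) h01 h1 by (auto simp: \<gamma>_def)
    show "lift \<gamma> (\<lambda>e t. w1_cocycle d e (\<gamma> t))"
      by (rule lift_single_chart[OF cont d \<gamma>d(1)])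
    show "state (d, cinv d y)" "state (d, cinv d y')"
      using d off \<gamma>d(1)[of 0] \<gamma>d(1)[of 1] on[of 0] on[of 1] h01[of 0] h1[of 1] by (auto simp: state_def \<gamma>_def)
  qed auto
  then show ?thesis
    by (simp only: bij_betw_same_card[OF bij] w1_cocycle_self[OF d \<gamma>d(1)] add_0)
qed

lemma flip_in_chart_segment:
  assumes "d \<in> AS" "closed_segment y y' \<subseteq> cmap d ` cdom d" "closed_segment y y' \<inter> trace d = {}"
  shows "flip_in_chart d y = flip_in_chart d y'"
proof -
  have X: "{} = {s \<in> {0..1}. y + s *\<^sub>R (y' - y) \<in> trace d}"
  proof -
    have "y + s *\<^sub>R (y' - y) \<in> closed_segment y y'" if "s \<in> {0..1}" for s
      unfolding in_segment by (rule exI[of _ s]) (use that in \<open>simp add: algebra_simps\<close>)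
    then show ?thesis using assms(3) by blast
  qed
  have "joins (d, cinv d y) (d, cinv d y') (of_nat (card ({} :: real set)))"
  proof (rule segment_joins[OF assms(1,2) _ _ X])
    fix x assume "x \<in> B" "f x \<in> cdom d" "cmap d (f x) \<in> closed_segment y y'"
    then show "(\<forall>x'\<in>B. f x' = f x \<longrightarrow> x' = x) \<and> (\<exists>c\<in>AB. x \<in> cdom c \<and> det2 (y' - y) (velocity c f d x) \<noteq> 0)"
      using assms(3) unfolding trace_def by blast
  qed (use assms(3) in auto)
  from flip_orientation_joins[OF this] show ?thesis
    unfolding flip_in_chart_def by (cases "flip_orientation (d, cinv d y)"; cases "flip_orientation (d, cinv d y')") auto
qed

lemma flip_in_chart_cross:
  assumes d: "d \<in> AS" and seg: "closed_segment y y' \<subseteq> cmap d ` cdom d"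
    and x: "x \<in> B" "f x \<in> cdom d" "c \<in> AB" "x \<in> cdom c" "\<And>x'. x' \<in> B \<Longrightarrow> f x' = f x \<Longrightarrow> x' = x"
    and tr: "closed_segment y y' \<inter> trace d = {cmap d (f x)}"
    and off: "y \<noteq> cmap d (f x)" "y' \<noteq> cmap d (f x)"
    and D: "det2 (y' - y) (velocity c f d x) \<noteq> 0"
  shows "flip_in_chart d y' = flip_in_chart d y + 1"
proof -
  let ?z = "cmap d (f x)"
  have ne: "y' - y \<noteq> 0" using D by (auto simp: det2_simps)
  have segI: "y + s *\<^sub>R (y' - y) \<in> closed_segment y y'" if "s \<in> {0..1}" for s
    unfolding in_segment by (rule exI[of _ s]) (use that in \<open>simp add: algebra_simps\<close>)
  have "?z \<in> closed_segment y y'" using tr by blast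
  then obtain s0 where s0: "s0 \<in> {0..1}" "?z = y + s0 *\<^sub>R (y' - y)"
    unfolding in_segment by (auto simp: algebra_simps)
  have X: "{s0} = {s \<in> {0..1}. y + s *\<^sub>R (y' - y) \<in> trace d}"
  proof (intro set_eqI iffI)
    fix s assume "s \<in> {s0}"
    then show "s \<in> {s \<in> {0..1}. y + s *\<^sub>R (y' - y) \<in> trace d}" using s0 tr by auto
  next
    fix s assume "s \<in> {s \<in> {0..1}. y + s *\<^sub>R (y' - y) \<in> trace d}"
    then have "y + s *\<^sub>R (y' - y) = ?z" using segI tr by blast
    then show "s \<in> {s0}" using s0(2) ne by simp
  qed
  have "joins (d, cinv d y) (d, cinv d y') (of_nat (card {s0}))"
  proof (rule segment_joins[OF d seg _ _ X])
    fix x' assume x': "x' \<in> B" "f x' \<in> cdom d" "cmap d (f x') \<in> closed_segment y y'"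
    then have "cmap d (f x') \<in> closed_segment y y' \<inter> trace d" unfolding trace_def by blast
    then have "cmap d (f x') = ?z" using tr by simp
    then have "f x' = f x" using cmap_inj[OF d x'(2) x(2)] by simp
    then have "x' = x" using x(5) x'(1) by blast
    then show "(\<forall>x''\<in>B. f x'' = f x' \<longrightarrow> x'' = x') \<and> (\<exists>c\<in>AB. x' \<in> cdom c \<and> det2 (y' - y) (velocity c f d x') \<noteq> 0)"
      using x D by blast
  qed (use tr off in auto)
  from flip_orientation_joins[OF this] show ?thesis
    unfolding flip_in_chart_def by (cases "flip_orientation (d, cinv d y)"; cases "flip_orientation (d, cinv d y')") auto
qed

end

section \<open>The curve near a point\<close>

context curve_on_surface
begin

text \<open>
  The velocity is continuous, so by the mean value theorem all secants and tangents of a branch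
  near \<open>x\<close> are close to the tangent at \<open>x\<close>. Secants between any two nearby points are needed, not
  only those from \<open>x\<close>, to see that a branch does not return to a short perpendicular segment
  erected at another of its points.
\<close>

lemma curve_strict_derivative:
  assumes c: "c \<in> AB" "x \<in> cdom c" and d: "d \<in> AS" "f x \<in> cdom d" and \<eta>: "\<eta> > 0"
  obtains N where "openin (top_of_set B) N" "x \<in> N" "N \<subseteq> cdom c" "\<And>z. z \<in> N \<Longrightarrow> f z \<in> cdom d"
    "\<And>y z. y \<in> N \<Longrightarrow> z \<in> N \<Longrightarrow>
       norm (cmap d (f y) - cmap d (f z) - (cmap c y - cmap c z) *\<^sub>R velocity c f d x)
         \<le> \<eta> * \<bar>cmap c y - cmap c z\<bar>"
    "\<And>z. z \<in> N \<Longrightarrow> norm (velocity c f d z - velocity c f d x) \<le> \<eta>"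
proof -
  let ?O = "cmap c ` (cdom c \<inter> f -` cdom d)" and ?F = "cmap d \<circ> f \<circ> cinv c"
  let ?G = "\<lambda>a. velocity c f d (cinv c a)"
  have op: "open ?O" by (rule open_curve_domain[OF c(1) d(1)])
  have x0: "cmap c x \<in> ?O" using c d by auto
  have GF: "(?F has_vector_derivative ?G a) (at a)" if "a \<in> ?O" for a
    using that curve_derivative[OF c(1) d(1)] c(1) by auto
  have eq: "?G a = frechet_derivative ?F (at a) 1" if "a \<in> ?O" for a
    using frechet_derivative_at[OF GF[OF that, unfolded has_vector_derivative_def]]
    by (metis scaleR_one)
  have "continuous_on ?O (\<lambda>a. frechet_derivative ?F (at a) 1)"
    using C_diff_on_SucD(2)[OF curve_C1[OF c(1) d(1)], of 1] by simp
  then have "continuous_on ?O ?G" using eq continuous_on_cong[of ?O ?O ?G] by simp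
  then have "isCont ?G (cmap c x)" using op x0 continuous_on_eq_continuous_at by blast
  then obtain r1 where r1: "r1 > 0" "\<And>a. \<bar>a - cmap c x\<bar> < r1 \<Longrightarrow> norm (?G a - ?G (cmap c x)) < \<eta>"
    using \<eta> unfolding continuous_at_eps_delta dist_norm real_norm_def by meson
  obtain r2 where r2: "r2 > 0" "ball (cmap c x) r2 \<subseteq> ?O" using op x0 openE by blast
  let ?U = "ball (cmap c x) (min r1 r2)"
  let ?N = "cdom c \<inter> cmap c -` ?U"
  have G: "norm (?G a - velocity c f d x) \<le> \<eta>" if "a \<in> ?U" for a
    using r1(2)[of a] that c by (auto simp: dist_real_def abs_minus_commute less_imp_le)
  have bound: "norm (?F a - ?F b - (a - b) *\<^sub>R velocity c f d x) \<le> \<eta> * \<bar>a - b\<bar>"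
    if "a \<in> ?U" "b \<in> ?U" for a b
  proof -
    let ?H = "\<lambda>a. ?F a - a *\<^sub>R velocity c f d x"
    have "norm (?H a - ?H b) \<le> \<eta> * norm (a - b)"
    proof (rule differentiable_bound[OF convex_ball _ _ that(1,2)])
      fix s assume s: "s \<in> ?U"
      have "(?F has_derivative (\<lambda>h. h *\<^sub>R ?G s)) (at s within ?U)"
      proof -
        have "s \<in> ?O" using s r2(2) by auto
        from has_derivative_at_withinI[OF GF[OF this, unfolded has_vector_derivative_def]]
        show ?thesis .
      qed
      moreover have "((\<lambda>a. a *\<^sub>R velocity c f d x) has_derivative (\<lambda>h. h *\<^sub>R velocity c f d x)) (at s within ?U)"
        by (auto intro!: derivative_eq_intros)
      ultimately show "(?H has_derivative (\<lambda>h. h *\<^sub>R ?G s - h *\<^sub>R velocity c f d x)) (at s within ?U)"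
        by (rule has_derivative_diff)
      show "onorm (\<lambda>h. h *\<^sub>R ?G s - h *\<^sub>R velocity c f d x) \<le> \<eta>"
        using mult_right_mono[OF G[OF s], of "\<bar>h\<bar>" for h]
        by (intro onorm_le) (simp add: scaleR_diff_right[symmetric] mult.commute)
    qed
    then show ?thesis by (simp add: algebra_simps)
  qed
  show ?thesis
  proof (rule that)
    show "openin (top_of_set B) ?N" by (rule base.openin_chart_preimage[OF c(1) open_ball])
    show "x \<in> ?N" using c r1(1) r2(1) by simp
    show "?N \<subseteq> cdom c" by blast
    show "f z \<in> cdom d" if z: "z \<in> ?N" for z
    proof -
      have "cmap c z \<in> ?O" using z r2(2) by auto
      then obtain q where "q \<in> cdom c" "f q \<in> cdom d" "cmap c z = cmap c q" by blast
      then show ?thesis using base.cmap_inj[OF c(1)] z by (metis IntD1)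
    qed
    show "norm (cmap d (f y) - cmap d (f z) - (cmap c y - cmap c z) *\<^sub>R velocity c f d x)
         \<le> \<eta> * \<bar>cmap c y - cmap c z\<bar>" if "y \<in> ?N" "z \<in> ?N" for y z
      using bound[of "cmap c y" "cmap c z"] that c(1) by auto
    show "norm (velocity c f d z - velocity c f d x) \<le> \<eta>" if "z \<in> ?N" for z
      using G[of "cmap c z"] that c(1) by auto
  qed
qed

text \<open>
  By compactness of the base the part of the curve outside \<open>N\<close> is closed in the surface, and it
  misses \<open>p\<close>.
\<close>

lemma near_fiber:
  assumes d: "d \<in> AS" "p \<in> cdom d"
    and N: "openin (top_of_set B) N" "\<And>z. z \<in> B \<Longrightarrow> f z = p \<Longrightarrow> z \<in> N"
  obtains \<delta> where "\<delta> > 0" "ball (cmap d p) \<delta> \<subseteq> cmap d ` cdom d"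
    "\<And>z. z \<in> B \<Longrightarrow> f z \<in> cdom d \<Longrightarrow> cmap d (f z) \<in> ball (cmap d p) \<delta> \<Longrightarrow> z \<in> N"
proof -
  obtain T where T: "open T" "N = B \<inter> T" using N(1) by (auto simp: openin_open)
  have "compact (B - T)" using compact_diff[OF compact_base T(1)] .
  then have "closed (f ` (B - T))"
    using compact_continuous_image continuous_on_subset[OF continuous_on_curve] compact_imp_closed
    by (metis Diff_subset)
  then have "openin (top_of_set S) (S \<inter> - f ` (B - T))" by (auto simp: openin_open)
  from open_image_openin[OF d(1) this]
  have "open (cmap d ` (cdom d \<inter> (S \<inter> - f ` (B - T))))" .
  moreover have "p \<in> cdom d \<inter> (S \<inter> - f ` (B - T))"
    using d cdom_subset[OF d(1)] N(2) T(2) by auto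
  ultimately obtain \<delta> where \<delta>: "\<delta> > 0" "ball (cmap d p) \<delta> \<subseteq> cmap d ` (cdom d \<inter> (S \<inter> - f ` (B - T)))"
    by (meson image_eqI openE)
  show ?thesis
  proof (rule that[OF \<delta>(1)])
    show "ball (cmap d p) \<delta> \<subseteq> cmap d ` cdom d" using \<delta>(2) by blast
    fix z assume z: "z \<in> B" "f z \<in> cdom d" "cmap d (f z) \<in> ball (cmap d p) \<delta>"
    then have "cmap d (f z) \<in> cmap d ` (cdom d \<inter> (S \<inter> - f ` (B - T)))" using \<delta>(2) by blast
    then obtain q where "q \<in> cdom d" "q \<notin> f ` (B - T)" "cmap d (f z) = cmap d q" by blast
    then have "f z \<notin> f ` (B - T)" using cmap_inj[OF d(1) z(2)] by metis
    then show "z \<in> N" using z(1) T(2) by blast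
  qed
qed

text \<open>
  The distance of a branch from its tangent line is small compared to the distance from \<open>f x\<close>, so it
  leaves \<open>f x\<close> inside arbitrarily thin double cones.
\<close>

lemma branch_in_cone:
  assumes c: "c \<in> AB" "x \<in> cdom c" and d: "d \<in> AS" "f x \<in> cdom d" and \<kappa>: "\<kappa> > 0"
  obtains N where "openin (top_of_set B) N" "x \<in> N" "N \<subseteq> cdom c" "\<And>z. z \<in> N \<Longrightarrow> f z \<in> cdom d"
    "\<And>z. z \<in> N \<Longrightarrow> \<bar>det2 (velocity c f d x) (cmap d (f z) - cmap d (f x))\<bar>
       \<le> \<kappa> * norm (cmap d (f z) - cmap d (f x))"
proof -
  let ?t = "velocity c f d x"
  have t: "norm ?t > 0" using velocity_nonzero[OF c(1) d(1) c(2) d(2)] by simp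
  define \<eta> where "\<eta> = min (norm ?t / 2) (\<kappa> / 2)"
  have \<eta>: "\<eta> > 0" "\<eta> \<le> norm ?t / 2" "\<eta> \<le> \<kappa> / 2" using t \<kappa> by (auto simp: \<eta>_def)
  obtain N where N: "openin (top_of_set B) N" "x \<in> N" "N \<subseteq> cdom c" "\<And>z. z \<in> N \<Longrightarrow> f z \<in> cdom d"
    "\<And>y z. y \<in> N \<Longrightarrow> z \<in> N \<Longrightarrow>
       norm (cmap d (f y) - cmap d (f z) - (cmap c y - cmap c z) *\<^sub>R ?t) \<le> \<eta> * \<bar>cmap c y - cmap c z\<bar>"
    using curve_strict_derivative[OF c d \<eta>(1)] by metis
  show ?thesis
  proof (rule that[OF N(1-4)])
    fix z assume z: "z \<in> N"
    define h where "h = cmap c z - cmap c x"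
    define w where "w = cmap d (f z) - cmap d (f x)"
    have err: "norm (w - h *\<^sub>R ?t) \<le> \<eta> * \<bar>h\<bar>" using N(5)[OF z N(2)] by (simp add: h_def w_def)
    have "det2 ?t w = det2 ?t (w - h *\<^sub>R ?t)" by (simp add: det2_simps)
    then have "\<bar>det2 ?t w\<bar> \<le> norm ?t * (\<eta> * \<bar>h\<bar>)"
      using abs_det2_le[of ?t "w - h *\<^sub>R ?t"] mult_left_mono[OF err, of "norm ?t"] by simp
    also have "\<dots> \<le> norm ?t * (\<kappa> / 2 * \<bar>h\<bar>)"
      using \<eta> by (intro mult_left_mono mult_right_mono) auto
    also have "\<dots> = \<kappa> * (\<bar>h\<bar> * (norm ?t / 2))" by simp
    also have "\<bar>h\<bar> * (norm ?t / 2) \<le> norm w"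
    proof -
      have "norm (h *\<^sub>R ?t) \<le> norm w + norm (w - h *\<^sub>R ?t)"
        using norm_triangle_sub[of "h *\<^sub>R ?t" w] by (simp add: norm_minus_commute)
      then have "\<bar>h\<bar> * norm ?t \<le> norm w + \<eta> * \<bar>h\<bar>" using err by simp
      moreover have "\<eta> * \<bar>h\<bar> \<le> norm ?t / 2 * \<bar>h\<bar>" using \<eta> by (intro mult_right_mono) auto
      ultimately show ?thesis by (simp add: algebra_simps)
    qed
    then have "\<kappa> * (\<bar>h\<bar> * (norm ?t / 2)) \<le> \<kappa> * norm w" using \<kappa> by simp
    finally show "\<bar>det2 ?t (cmap d (f z) - cmap d (f x))\<bar> \<le> \<kappa> * norm (cmap d (f z) - cmap d (f x))"
      by (simp add: w_def)
  qed
qed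

lemma secant_tendsto_velocity:
  assumes c: "c \<in> AB" "x \<in> cdom c" and d: "d \<in> AS" "f x \<in> cdom d"
  shows "((\<lambda>z. (1 / (cmap c z - cmap c x)) *\<^sub>R (cmap d (f z) - cmap d (f x))) \<longlongrightarrow> velocity c f d x)
    (at x within B)"
proof (rule tendstoI)
  fix e :: real assume e: "e > 0"
  then have e2: "e / 2 > 0" by simp
  obtain N where N: "openin (top_of_set B) N" "x \<in> N" "N \<subseteq> cdom c"
    "\<And>y z. y \<in> N \<Longrightarrow> z \<in> N \<Longrightarrow>
       norm (cmap d (f y) - cmap d (f z) - (cmap c y - cmap c z) *\<^sub>R velocity c f d x) \<le> e / 2 * \<bar>cmap c y - cmap c z\<bar>"
    using curve_strict_derivative[OF c d e2] by metis
  have "\<forall>\<^sub>F z in at x within B. z \<in> N \<and> z \<noteq> x"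
    using base.eventually_in_openin[OF N(1,2)] by (auto simp: eventually_at_filter elim: eventually_mono)
  then show "\<forall>\<^sub>F z in at x within B. dist ((1 / (cmap c z - cmap c x)) *\<^sub>R (cmap d (f z) - cmap d (f x))) (velocity c f d x) < e"
  proof eventually_elim
    case (elim z)
    let ?h = "cmap c z - cmap c x" and ?w = "cmap d (f z) - cmap d (f x)"
    have h: "?h \<noteq> 0" using base.cmap_inj[OF c(1), of z x] elim N(3) c(2) by auto
    have "(1 / ?h) *\<^sub>R ?w - velocity c f d x = (1 / ?h) *\<^sub>R (?w - ?h *\<^sub>R velocity c f d x)"
      using h by (simp add: scaleR_diff_right)
    then have "norm ((1 / ?h) *\<^sub>R ?w - velocity c f d x) = norm (?w - ?h *\<^sub>R velocity c f d x) / \<bar>?h\<bar>"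
      by (simp add: divide_inverse mult.commute)
    also have "\<dots> \<le> e / 2" using N(4)[of z x] N(2) elim h by (simp add: field_simps)
    finally show ?case using e by (simp add: dist_norm)
  qed
qed

lemma coordinate_tendsto:
  assumes c: "c \<in> AB" "x \<in> cdom c"
  shows "filterlim (\<lambda>z. \<bar>cmap c z - cmap c x\<bar>) (at_right 0) (at x within B)"
proof -
  have "\<forall>\<^sub>F z in at x within B. z \<in> cdom c \<and> z \<noteq> x"
    using base.eventually_in_openin[OF base.openin_cdom[OF c(1)] c(2)]
    by (auto simp: eventually_at_filter elim: eventually_mono)
  then have pos: "\<forall>\<^sub>F z in at x within B. \<bar>cmap c z - cmap c x\<bar> \<in> {0<..}"
    by eventually_elim (use base.cmap_inj[OF c(1)] c(2) in auto)
  have "(cmap c \<longlongrightarrow> cmap c x) (at x within B)"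
  proof (rule topological_tendstoI)
    fix W assume W: "open W" "cmap c x \<in> W"
    have "\<forall>\<^sub>F z in at x within B. z \<in> cdom c \<inter> cmap c -` W"
      using W c(2) by (intro base.eventually_in_openin base.openin_chart_preimage c(1)) auto
    then show "\<forall>\<^sub>F z in at x within B. cmap c z \<in> W" by eventually_elim simp
  qed
  then have "((\<lambda>z. \<bar>cmap c z - cmap c x\<bar>) \<longlongrightarrow> 0) (at x within B)"
    by (intro tendsto_eq_intros | simp)+
  then show ?thesis using pos by (simp add: filterlim_at)
qed

text \<open>
  The base has no boundary, so there are points on both sides of \<open>x\<close> arbitrarily close to it, and
  properties that hold near \<open>x\<close> on one side are not vacuous.
\<close>

lemma side_nonempty:
  assumes c: "c \<in> AB" "x \<in> cdom c" and \<rho>: "\<rho> \<in> {1, -1}"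
    and ev: "\<forall>\<^sub>F z in at x within B. \<rho> * (cmap c z - cmap c x) > 0 \<longrightarrow> Q z"
  shows "\<exists>z. z \<in> cdom c \<and> \<rho> * (cmap c z - cmap c x) > 0 \<and> Q z"
proof -
  let ?g = "\<lambda>t. cinv c (cmap c x + \<rho> * t)"
  have im: "\<forall>\<^sub>F t in at_right 0. cmap c x + \<rho> * t \<in> cmap c ` cdom c"
  proof (rule topological_tendstoD[OF _ base.open_chart_image[OF c(1)]])
    show "((\<lambda>t. cmap c x + \<rho> * t) \<longlongrightarrow> cmap c x) (at_right 0)" by (auto intro!: tendsto_eq_intros)
  qed (use c in auto)
  have "isCont (cinv c) (cmap c x)"
    using base.continuous_on_cinv[OF c(1)] base.open_chart_image[OF c(1)] c(2)
    by (simp add: continuous_on_eq_continuous_at)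
  then have "((\<lambda>t. cinv c (cmap c x + \<rho> * t)) \<longlongrightarrow> cinv c (cmap c x)) (at_right 0)"
    by (rule isCont_tendsto_compose) (auto intro!: tendsto_eq_intros)
  then have "(?g \<longlongrightarrow> x) (at_right 0)" using c by simp
  moreover have pos: "\<forall>\<^sub>F t in at_right 0. ?g t \<in> cdom c \<and> \<rho> * (cmap c (?g t) - cmap c x) > 0"
    using im eventually_at_right_less[of 0]
    by eventually_elim (use \<rho> c(1) base.cinv_in[OF c(1)] in auto)
  then have "\<forall>\<^sub>F t in at_right 0. ?g t \<in> B \<and> ?g t \<noteq> x"
    by eventually_elim (use base.cdom_subset[OF c(1)] in auto)
  ultimately have "filterlim ?g (at x within B) (at_right 0)" by (simp add: filterlim_at)
  from eventually_compose_filterlim[OF ev this] pos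
  have "\<forall>\<^sub>F t in at_right 0. ?g t \<in> cdom c \<and> \<rho> * (cmap c (?g t) - cmap c x) > 0 \<and> Q (?g t)"
    by eventually_elim simp
  then show ?thesis using eventually_happens'[OF trivial_limit_at_right_real] by blast
qed

end

section \<open>The sides of the curve\<close>

lemma difference_quotient_tendsto:
  assumes "(g has_vector_derivative v) (at (0::real))"
  shows "((\<lambda>s. (1 / s) *\<^sub>R (g s - g 0)) \<longlongrightarrow> v) (at 0)"
proof -
  have "((\<lambda>h. norm (g (0 + h) - g 0 - h *\<^sub>R v) / norm h) \<longlongrightarrow> 0) (at 0)"
    using assms unfolding has_vector_derivative_def has_derivative_at by blast
  moreover have "\<forall>\<^sub>F h in at 0. norm (g (0 + h) - g 0 - h *\<^sub>R v) / norm h = norm ((1 / h) *\<^sub>R (g h - g 0) - v)"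
    unfolding eventually_at_filter
  proof (intro always_eventually allI impI)
    fix h :: real assume h: "h \<noteq> 0"
    then have "(1 / h) *\<^sub>R (g h - g 0) - v = (1 / h) *\<^sub>R (g h - g 0 - h *\<^sub>R v)"
      by (simp add: scaleR_diff_right)
    then show "norm (g (0 + h) - g 0 - h *\<^sub>R v) / norm h = norm ((1 / h) *\<^sub>R (g h - g 0) - v)"
      by (simp add: divide_inverse mult.commute)
  qed
  ultimately have "((\<lambda>h. norm ((1 / h) *\<^sub>R (g h - g 0) - v)) \<longlongrightarrow> 0) (at 0)"
    by (rule Lim_transform_eventually)
  then show ?thesis using Lim_null tendsto_norm_zero_iff by blast
qed

lemma convex_det2_cone: "convex {w. \<sigma> * det2 \<tau> w > \<kappa> * norm w}" if "\<kappa> \<ge> 0"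
  unfolding convex_def
proof (intro ballI allI impI)
  fix x y :: "real^2" and u v :: real
  assume xy: "x \<in> {w. \<sigma> * det2 \<tau> w > \<kappa> * norm w}" "y \<in> {w. \<sigma> * det2 \<tau> w > \<kappa> * norm w}"
    and uv: "0 \<le> u" "0 \<le> v" "u + v = 1"
  let ?g = "\<lambda>w. \<sigma> * det2 \<tau> w - \<kappa> * norm w"
  have "norm (u *\<^sub>R x + v *\<^sub>R y) \<le> u * norm x + v * norm y"
    using norm_triangle_ineq[of "u *\<^sub>R x" "v *\<^sub>R y"] uv by simp
  from mult_left_mono[OF this that] have "?g (u *\<^sub>R x + v *\<^sub>R y) \<ge> u * ?g x + v * ?g y"
    by (simp add: det2_simps algebra_simps)
  moreover have "u * ?g x + v * ?g y > 0"
  proof (cases "u = 0")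
    case True
    then show ?thesis using uv xy by simp
  next
    case False
    then have "u * ?g x > 0" using uv xy by simp
    moreover have "v * ?g y \<ge> 0" using uv xy by (intro mult_nonneg_nonneg) auto
    ultimately show ?thesis by simp
  qed
  ultimately show "u *\<^sub>R x + v *\<^sub>R y \<in> {w. \<sigma> * det2 \<tau> w > \<kappa> * norm w}" by simp
qed

context curve_dual_to_w1
begin

definition simple :: "'m \<Rightarrow> bool" where
  "simple x \<longleftrightarrow> x \<in> B \<and> (\<forall>y\<in>B. f y = f x \<longrightarrow> y = x)"

text \<open>
  Two branches of the curve with charts of the base and of the surface, which make up the curve
  near the point \<open>f x\<close>. The case \<open>x' = x\<close> covers simple points.
\<close>

definition branches ::
  "('s, real^2) chart \<Rightarrow> ('m, real) chart \<Rightarrow> 'm \<Rightarrow> ('m, real) chart \<Rightarrow> 'm \<Rightarrow> bool" where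
  "branches d c x c' x' \<longleftrightarrow> d \<in> AS \<and> c \<in> AB \<and> c' \<in> AB \<and> x \<in> cdom c \<and> x' \<in> cdom c' \<and>
     f x \<in> cdom d \<and> f x' = f x \<and> (\<forall>z\<in>B. f z = f x \<longrightarrow> z = x \<or> z = x')"

lemma branches_simple:
  assumes "simple x" "d \<in> AS" "c \<in> AB" "x \<in> cdom c" "f x \<in> cdom d"
  shows "branches d c x c x"
  using assms by (auto simp: branches_def simple_def)

text \<open>
  Near \<open>f x\<close> nothing but the two branches is left of the curve, and each stays in a cone around its
  tangent.
\<close>

lemma trace_in_cones:
  assumes br: "branches d c x c' x'" and \<kappa>: "\<kappa> > 0"
  obtains \<delta> where "\<delta> > 0" "ball (cmap d (f x)) \<delta> \<subseteq> cmap d ` cdom d"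
    "\<And>w. cmap d (f x) + w \<in> trace d \<Longrightarrow> norm w < \<delta> \<Longrightarrow>
      \<bar>det2 (velocity c f d x) w\<bar> \<le> \<kappa> * norm w \<or> \<bar>det2 (velocity c' f d x') w\<bar> \<le> \<kappa> * norm w"
proof -
  have b: "d \<in> AS" "c \<in> AB" "c' \<in> AB" "x \<in> cdom c" "x' \<in> cdom c'" "f x \<in> cdom d" "f x' = f x"
    and fib: "\<And>z. z \<in> B \<Longrightarrow> f z = f x \<Longrightarrow> z = x \<or> z = x'" using br by (auto simp: branches_def)
  obtain N1 where N1: "openin (top_of_set B) N1" "x \<in> N1"
    "\<And>z. z \<in> N1 \<Longrightarrow> \<bar>det2 (velocity c f d x) (cmap d (f z) - cmap d (f x))\<bar> \<le> \<kappa> * norm (cmap d (f z) - cmap d (f x))"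
    using branch_in_cone[OF b(2,4,1,6) \<kappa>] by metis
  have x'd: "f x' \<in> cdom d" using b by simp
  obtain N2 where N2: "openin (top_of_set B) N2" "x' \<in> N2"
    "\<And>z. z \<in> N2 \<Longrightarrow> \<bar>det2 (velocity c' f d x') (cmap d (f z) - cmap d (f x'))\<bar> \<le> \<kappa> * norm (cmap d (f z) - cmap d (f x'))"
    using branch_in_cone[OF b(3,5,1) x'd \<kappa>] by metis
  have N: "openin (top_of_set B) (N1 \<union> N2)" using N1(1) N2(1) by blast
  obtain \<delta> where \<delta>: "\<delta> > 0" "ball (cmap d (f x)) \<delta> \<subseteq> cmap d ` cdom d"
    "\<And>z. z \<in> B \<Longrightarrow> f z \<in> cdom d \<Longrightarrow> cmap d (f z) \<in> ball (cmap d (f x)) \<delta> \<Longrightarrow> z \<in> N1 \<union> N2"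
    using near_fiber[OF b(1,6) N] fib N1(2) N2(2) by blast
  show ?thesis
  proof (rule that[OF \<delta>(1,2)])
    fix w assume w: "cmap d (f x) + w \<in> trace d" "norm w < \<delta>"
    then obtain z where z: "z \<in> B" "f z \<in> cdom d" "cmap d (f z) = cmap d (f x) + w"
      unfolding trace_def by auto
    then have "z \<in> N1 \<union> N2" using w by (intro \<delta>(3)) (auto simp: dist_norm)
    moreover have "w = cmap d (f z) - cmap d (f x)" using z by simp
    ultimately show "\<bar>det2 (velocity c f d x) w\<bar> \<le> \<kappa> * norm w \<or> \<bar>det2 (velocity c' f d x') w\<bar> \<le> \<kappa> * norm w"
      using N1(3)[of z] N2(3)[of z] b(7) by auto
  qed
qed

text \<open>
  The points \<open>P + s *\<^sub>R w\<close> with small \<open>s > 0\<close> and \<open>w\<close> near \<open>u\<close> lie off the curve and the flip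
  orientation has the value \<open>e\<close> in the chart \<open>d\<close> there. Letting \<open>s\<close> and \<open>w\<close> vary independently makes the notion
  apply to curved approaches to \<open>P\<close>, such as the image of a segment in another chart, or points that
  move along a branch towards \<open>P\<close>.
\<close>

definition sector_value :: "('s, real^2) chart \<Rightarrow> real^2 \<Rightarrow> real^2 \<Rightarrow> bit \<Rightarrow> bool" where
  "sector_value d P u e \<longleftrightarrow> (\<forall>\<^sub>F q in at_right 0 \<times>\<^sub>F nhds u.
     P + fst q *\<^sub>R snd q \<in> cmap d ` cdom d - trace d \<and> flip_in_chart d (P + fst q *\<^sub>R snd q) = e)"

lemma sector_value_unique:
  assumes "sector_value d P u e" "sector_value d P u e'"
  shows "e = e'"
proof -
  have "(at_right (0::real) \<times>\<^sub>F nhds u) \<noteq> bot"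
    by (simp add: prod_filter_eq_bot)
  moreover have "\<forall>\<^sub>F q in at_right (0::real) \<times>\<^sub>F nhds u. e = e'"
    using assms unfolding sector_value_def by eventually_elim simp
  ultimately show ?thesis by simp
qed

lemma sector_value_tendsto:
  assumes "sector_value d P u e" "filterlim s (at_right 0) F" "(w \<longlongrightarrow> u) F"
  shows "\<forall>\<^sub>F i in F. P + s i *\<^sub>R w i \<in> cmap d ` cdom d - trace d \<and> flip_in_chart d (P + s i *\<^sub>R w i) = e"
  using eventually_compose_filterlim[OF assms(1)[unfolded sector_value_def] filterlim_Pair[OF assms(2,3)]]
  by simp

text \<open>
  The tangents of the branches cut the directions at \<open>f x\<close> into open sectors, indexed by the signs
  \<open>\<sigma>\<close> and \<open>\<sigma>'\<close>. A slightly narrower sector avoids the cones that contain the curve, and it is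
  convex, so any two of its points are joined by a segment off the curve.
\<close>

lemma sector_value_exists:
  assumes br: "branches d c x c' x'" and \<sigma>: "\<sigma> \<in> {1, -1}" "\<sigma>' \<in> {1, -1}"
  shows "\<exists>e. \<forall>u. \<sigma> * det2 (velocity c f d x) u > 0 \<longrightarrow> \<sigma>' * det2 (velocity c' f d x') u > 0 \<longrightarrow>
    sector_value d (cmap d (f x)) u e"
proof -
  let ?t = "velocity c f d x" and ?t' = "velocity c' f d x'" and ?P = "cmap d (f x)"
  let ?A = "{u. \<sigma> * det2 ?t u > 0 \<and> \<sigma>' * det2 ?t' u > 0}"
  have d: "d \<in> AS" using br by (simp add: branches_def)
  have pair: "\<exists>e. sector_value d ?P u e \<and> sector_value d ?P u' e" if u: "u \<in> ?A" "u' \<in> ?A" for u u'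
  proof -
    \<comment> \<open>The constant \<open>\<kappa>\<close> is so small that the narrower sector still contains both \<open>u\<close> and \<open>u'\<close>.\<close>
    define m where "m = Min {\<sigma> * det2 ?t u, \<sigma>' * det2 ?t' u, \<sigma> * det2 ?t u', \<sigma>' * det2 ?t' u'}"
    define \<kappa> where "\<kappa> = m / (norm u + norm u' + 1)"
    have m: "m > 0" "m \<le> \<sigma> * det2 ?t u" "m \<le> \<sigma>' * det2 ?t' u" "m \<le> \<sigma> * det2 ?t u'" "m \<le> \<sigma>' * det2 ?t' u'"
      using u by (auto simp: m_def)
    have n: "norm u + norm u' + 1 > 0" using norm_ge_zero[of u] norm_ge_zero[of u'] by linarith
    have \<kappa>: "\<kappa> > 0" using m(1) n by (simp add: \<kappa>_def)
    have "\<kappa> * (norm u + norm u' + 1) = m" using n by (simp add: \<kappa>_def)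
    then have km: "\<kappa> * norm u + \<kappa> * norm u' + \<kappa> = m" by (simp add: algebra_simps)
    moreover have "\<kappa> * norm u \<ge> 0" "\<kappa> * norm u' \<ge> 0" using \<kappa> by auto
    ultimately have ku: "\<kappa> * norm u < m" "\<kappa> * norm u' < m" using \<kappa> by linarith+
    obtain \<delta> where \<delta>: "\<delta> > 0" "ball ?P \<delta> \<subseteq> cmap d ` cdom d"
      "\<And>w. ?P + w \<in> trace d \<Longrightarrow> norm w < \<delta> \<Longrightarrow> \<bar>det2 ?t w\<bar> \<le> \<kappa> * norm w \<or> \<bar>det2 ?t' w\<bar> \<le> \<kappa> * norm w"
      using trace_in_cones[OF br \<kappa>] by metis
    define C where "C = ball 0 \<delta> \<inter> ({w. \<sigma> * det2 ?t w > \<kappa> * norm w} \<inter> {w. \<sigma>' * det2 ?t' w > \<kappa> * norm w})"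
    have conv: "convex C"
      unfolding C_def using \<kappa> by (intro convex_Int convex_ball convex_det2_cone) auto
    have off: "?P + w \<in> cmap d ` cdom d - trace d" if w: "w \<in> C" for w
    proof
      show "?P + w \<in> cmap d ` cdom d" using w \<delta>(2) by (auto simp: C_def dist_norm)
      show "?P + w \<notin> trace d"
      proof
        assume "?P + w \<in> trace d"
        then show False using \<delta>(3)[of w] w \<sigma> by (auto simp: C_def)
      qed
    qed
    have const: "flip_in_chart d (?P + w) = flip_in_chart d (?P + w')" if "w \<in> C" "w' \<in> C" for w w'
    proof -
      have "closed_segment w w' \<subseteq> C" using conv that by (simp add: closed_segment_subset)
      then have "closed_segment (?P + w) (?P + w') \<subseteq> (+) ?P ` C"
        by (auto simp: closed_segment_translation)
      then have "closed_segment (?P + w) (?P + w') \<subseteq> cmap d ` cdom d - trace d" using off by blast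
      then show ?thesis by (intro flip_in_chart_segment d) blast+
    qed
    have ev: "\<forall>\<^sub>F q in at_right 0 \<times>\<^sub>F nhds v. fst q *\<^sub>R snd q \<in> C"
      if v: "\<kappa> * norm v < \<sigma> * det2 ?t v" "\<kappa> * norm v < \<sigma>' * det2 ?t' v" for v
    proof -
      let ?F = "at_right (0::real) \<times>\<^sub>F nhds v"
      have fst: "filterlim fst (at_right 0) ?F" and snd: "(snd \<longlongrightarrow> v) ?F"
        by (rule filterlim_fst, rule filterlim_snd)
      have f0: "(fst \<longlongrightarrow> 0) ?F" and fpos: "\<forall>\<^sub>F q in ?F. fst q > 0"
        using fst by (auto simp: filterlim_at elim: eventually_mono)
      have "((\<lambda>q. norm (fst q *\<^sub>R snd q)) \<longlongrightarrow> norm (0 *\<^sub>R v)) ?F" by (intro tendsto_intros f0 snd)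
      then have "\<forall>\<^sub>F q in ?F. norm (fst q *\<^sub>R snd q) < \<delta>" using \<delta>(1) by (auto dest: order_tendstoD(2))
      moreover have "((\<lambda>q. \<sigma> * det2 ?t (snd q) - \<kappa> * norm (snd q)) \<longlongrightarrow> \<sigma> * det2 ?t v - \<kappa> * norm v) ?F"
        by (intro tendsto_intros snd)
      then have "\<forall>\<^sub>F q in ?F. \<sigma> * det2 ?t (snd q) - \<kappa> * norm (snd q) > 0"
        using v by (auto dest!: order_tendstoD(1)[where a = 0])
      moreover have "((\<lambda>q. \<sigma>' * det2 ?t' (snd q) - \<kappa> * norm (snd q)) \<longlongrightarrow> \<sigma>' * det2 ?t' v - \<kappa> * norm v) ?F"
        by (intro tendsto_intros snd)
      then have "\<forall>\<^sub>F q in ?F. \<sigma>' * det2 ?t' (snd q) - \<kappa> * norm (snd q) > 0"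
        using v by (auto dest!: order_tendstoD(1)[where a = 0])
      ultimately show ?thesis using fpos
      proof eventually_elim
        case (elim q)
        have "fst q * (\<sigma> * det2 ?t (snd q) - \<kappa> * norm (snd q)) > 0"
          "fst q * (\<sigma>' * det2 ?t' (snd q) - \<kappa> * norm (snd q)) > 0"
          using elim by (simp_all del: right_diff_distrib)
        then show ?case using elim by (simp add: C_def det2_simps algebra_simps)
      qed
    qed
    have evu: "\<forall>\<^sub>F q in at_right 0 \<times>\<^sub>F nhds u. fst q *\<^sub>R snd q \<in> C" and evu': "\<forall>\<^sub>F q in at_right 0 \<times>\<^sub>F nhds u'. fst q *\<^sub>R snd q \<in> C"
      by (rule ev, use m ku in linarith, use m ku in linarith)+
    have "(at_right (0::real) \<times>\<^sub>F nhds u) \<noteq> bot" by (simp add: prod_filter_eq_bot)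
    from eventually_happens'[OF this evu] obtain w0 where w0: "w0 \<in> C" by blast
    have "sector_value d ?P u (flip_in_chart d (?P + w0))"
      unfolding sector_value_def using evu by eventually_elim (use off const[OF _ w0] in blast)
    moreover have "sector_value d ?P u' (flip_in_chart d (?P + w0))"
      unfolding sector_value_def using evu' by eventually_elim (use off const[OF _ w0] in blast)
    ultimately show ?thesis by blast
  qed
  show ?thesis
  proof (cases "?A = {}")
    case False
    then obtain u0 where u0: "u0 \<in> ?A" by blast
    obtain e where e: "sector_value d ?P u0 e" using pair[OF u0 u0] by blast
    have "sector_value d ?P u e" if "u \<in> ?A" for u
      using pair[OF u0 that] sector_value_unique[OF e] by metis
    then show ?thesis by blast
  qed auto
qed

text \<open>
  The value of the flip orientation just to the left of the curve; meant for simple points.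
\<close>

definition left_value :: "('m, real) chart \<Rightarrow> ('s, real^2) chart \<Rightarrow> 'm \<Rightarrow> bit" where
  "left_value c d x = (SOME e. sector_value d (cmap d (f x)) (rot (velocity c f d x)) e)"

lemma det2_velocity_rot_pos:
  assumes "c \<in> AB" "x \<in> cdom c" "d \<in> AS" "f x \<in> cdom d"
  shows "det2 (velocity c f d x) (rot (velocity c f d x)) > 0"
  using velocity_nonzero[OF assms(1,3,2,4)] by (simp add: det2_rot)

lemma sector_value_left:
  assumes x: "simple x" "c \<in> AB" "x \<in> cdom c" "d \<in> AS" "f x \<in> cdom d"
    and u: "det2 (velocity c f d x) u > 0"
  shows "sector_value d (cmap d (f x)) u (left_value c d x)"
proof -
  let ?t = "velocity c f d x"
  obtain e where e: "\<And>u. det2 ?t u > 0 \<Longrightarrow> sector_value d (cmap d (f x)) u e"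
    using sector_value_exists[OF branches_simple[OF x(1,4,2,3,5)], of 1 1] by auto
  have r: "sector_value d (cmap d (f x)) (rot ?t) e"
    by (rule e[OF det2_velocity_rot_pos[OF x(2-5)]])
  then have "sector_value d (cmap d (f x)) (rot ?t) (left_value c d x)"
    unfolding left_value_def by (rule someI)
  then have "left_value c d x = e" using r sector_value_unique by blast
  then show ?thesis using e[OF u] by simp
qed

text \<open>
  A short segment perpendicular to the tangent crosses the curve exactly once, at \<open>f x\<close>.
\<close>

lemma sector_value_right:
  assumes x: "simple x" "c \<in> AB" "x \<in> cdom c" "d \<in> AS" "f x \<in> cdom d"
    and u: "det2 (velocity c f d x) u < 0"
  shows "sector_value d (cmap d (f x)) u (left_value c d x + 1)"
proof -
  let ?t = "velocity c f d x" and ?P = "cmap d (f x)"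
  let ?v = "rot ?t"
  obtain e where e: "\<And>u. det2 ?t u < 0 \<Longrightarrow> sector_value d ?P u e"
    using sector_value_exists[OF branches_simple[OF x(1,4,2,3,5)], of "-1" "-1"] by auto
  have v: "det2 ?t ?v > 0" by (rule det2_velocity_rot_pos[OF x(2-5)])
  have id: "filterlim (\<lambda>s. s) (at_right 0) (at_right (0::real))" by (rule filterlim_ident)
  have "\<forall>\<^sub>F s in at_right 0. ?P + s *\<^sub>R ?v \<in> cmap d ` cdom d - trace d \<and> flip_in_chart d (?P + s *\<^sub>R ?v) = left_value c d x"
    by (rule sector_value_tendsto[OF sector_value_left[OF x v] id tendsto_const])
  moreover have "\<forall>\<^sub>F s in at_right 0. ?P + s *\<^sub>R (- ?v) \<in> cmap d ` cdom d - trace d \<and> flip_in_chart d (?P + s *\<^sub>R (- ?v)) = e"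
    by (rule sector_value_tendsto[OF e id tendsto_const]) (use v in \<open>simp add: det2_simps\<close>)
  ultimately have "\<forall>\<^sub>F s in at_right 0.
     (?P + s *\<^sub>R ?v \<in> cmap d ` cdom d - trace d \<and> flip_in_chart d (?P + s *\<^sub>R ?v) = left_value c d x) \<and>
     (?P + s *\<^sub>R (- ?v) \<in> cmap d ` cdom d - trace d \<and> flip_in_chart d (?P + s *\<^sub>R (- ?v)) = e)"
    by (rule eventually_conj)
  then obtain b where b: "b > 0" "\<And>s. 0 < s \<Longrightarrow> s < b \<Longrightarrow>
     (?P + s *\<^sub>R ?v \<in> cmap d ` cdom d - trace d \<and> flip_in_chart d (?P + s *\<^sub>R ?v) = left_value c d x) \<and>
     (?P + s *\<^sub>R (- ?v) \<in> cmap d ` cdom d - trace d \<and> flip_in_chart d (?P + s *\<^sub>R (- ?v)) = e)"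
    unfolding eventually_at_right_field by blast
  define s where "s = b / 2"
  have s: "0 < s" "s < b" using b(1) by (auto simp: s_def)
  let ?y = "?P + s *\<^sub>R (- ?v)" and ?y' = "?P + s *\<^sub>R ?v"
  have v0: "?v \<noteq> 0" using v by (auto simp: det2_simps)
  have segm: "z = ?P \<or> z \<in> cmap d ` cdom d - trace d" if "z \<in> closed_segment ?y ?y'" for z
  proof -
    have "\<exists>k. 0 \<le> k \<and> k \<le> 1 \<and> z = (1 - k) *\<^sub>R ?y + k *\<^sub>R ?y'"
      using that by (simp only: in_segment)
    then obtain k where k: "0 \<le> k" "k \<le> 1" "z = (1 - k) *\<^sub>R ?y + k *\<^sub>R ?y'"
      by (elim exE conjE)
    then have z: "z = ?P + ((2 * k - 1) * s) *\<^sub>R ?v"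
      unfolding k(3) by (simp add: vec_eq_iff algebra_simps)
    have le: "\<bar>(2 * k - 1) * s\<bar> < b"
    proof -
      have "\<bar>2 * k - 1\<bar> * s \<le> 1 * s" using k s by (intro mult_right_mono) auto
      moreover have "\<bar>(2 * k - 1) * s\<bar> = \<bar>2 * k - 1\<bar> * s" using s by (simp add: abs_mult)
      ultimately show ?thesis using s by linarith
    qed
    consider "(2 * k - 1) * s = 0" | "(2 * k - 1) * s > 0" | "(2 * k - 1) * s < 0" by linarith
    then show ?thesis
    proof cases
      case 1
      then show ?thesis by (simp only: z 1) simp
    next
      case 2
      then show ?thesis using b(2)[of "(2 * k - 1) * s"] le z by auto
    next
      case 3
      have "?P + (- ((2 * k - 1) * s)) *\<^sub>R (- ?v) \<in> cmap d ` cdom d - trace d"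
        using b(2)[of "- ((2 * k - 1) * s)"] le 3 by auto
      then show ?thesis using z by simp
    qed
  qed
  have P: "?P \<in> closed_segment ?y ?y'"
    unfolding in_segment by (rule exI[of _ "1/2"]) (simp add: vec_eq_iff field_simps)
  have Ptr: "?P \<in> trace d" unfolding trace_def using x(1,5) by (auto simp: simple_def)
  have "flip_in_chart d ?y' = flip_in_chart d ?y + 1"
  proof (rule flip_in_chart_cross[OF x(4)])
    show "closed_segment ?y ?y' \<subseteq> cmap d ` cdom d" using segm x(5) by blast
    show "closed_segment ?y ?y' \<inter> trace d = {?P}" using segm P Ptr by blast
    show "?y \<noteq> ?P" "?y' \<noteq> ?P" using v0 s by auto
    have "?y' - ?y = (2 * s) *\<^sub>R ?v" by (simp add: vec_eq_iff)
    then show "det2 (?y' - ?y) ?t \<noteq> 0" using v s by (simp add: det2_simps det2_swap[of ?v])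
  qed (use x in \<open>auto simp: simple_def\<close>)
  then have "e = left_value c d x + 1" using b(2)[OF s] by (cases e) auto
  then show ?thesis using e[OF u] by simp
qed


text \<open>
  A transition map that reverses orientation swaps left and right, which flips the value once, and
  reverses the orientation of the chart to which the flip orientation is compared, which flips it
  back. To compare the two charts, approach \<open>f x\<close> along a segment in \<open>d\<close> and look at its image in
  \<open>e\<close>, which approaches \<open>f x\<close> in the direction given by the Jacobian matrix.
\<close>

lemma left_value_change_surface_chart:
  assumes x: "simple x" "c \<in> AB" "x \<in> cdom c" and d: "d \<in> AS" "f x \<in> cdom d" and e: "e \<in> AS" "f x \<in> cdom e"
  shows "left_value c e x = left_value c d x"
proof -
  let ?t = "velocity c f d x" and ?t' = "velocity c f e x" and ?J = "J d e (f x)"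
  let ?v = "rot ?t"
  define g where "g s = cinv d (cmap d (f x) + s *\<^sub>R ?v)" for s
  have g0: "g 0 = f x" using d by (simp add: g_def)
  have tv: "det2 ?t ?v > 0" by (rule det2_velocity_rot_pos[OF x(2,3) d])
  have lim: "((\<lambda>s. cmap d (f x) + s *\<^sub>R ?v) \<longlongrightarrow> cmap d (f x)) (at 0)"
    by (auto intro!: tendsto_eq_intros)
  have im: "\<forall>\<^sub>F s in nhds 0. cmap d (f x) + s *\<^sub>R ?v \<in> cmap d ` cdom d"
  proof -
    have "\<forall>\<^sub>F s in at 0. cmap d (f x) + s *\<^sub>R ?v \<in> cmap d ` cdom d"
      using topological_tendstoD[OF lim open_chart_image[OF d(1)]] d(2) by blast
    then show ?thesis using d(2) by (simp add: eventually_nhds_conv_at)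
  qed
  have gd: "\<forall>\<^sub>F s in nhds 0. g s \<in> cdom d \<and> cmap d (g s) = cmap d (f x) + s *\<^sub>R ?v"
    using im by eventually_elim (use d(1) cinv_in[OF d(1)] in \<open>simp add: g_def\<close>)
  have "((\<lambda>s. cmap d (f x) + s *\<^sub>R ?v) has_vector_derivative ?v) (at 0)"
    by (auto intro!: derivative_eq_intros)
  then have "(cmap d \<circ> g has_vector_derivative ?v) (at 0)"
  proof -
    assume *: "((\<lambda>s. cmap d (f x) + s *\<^sub>R ?v) has_vector_derivative ?v) (at 0)"
    obtain T where T: "open T" "0 \<in> T" "\<forall>s\<in>T. g s \<in> cdom d \<and> cmap d (g s) = cmap d (f x) + s *\<^sub>R ?v"
      using gd unfolding eventually_nhds by blast
    show ?thesis
      by (rule has_vector_derivative_transform_within_open[OF * T(1,2)]) (use T(3) in simp)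
  qed
  moreover have "\<forall>\<^sub>F s in at 0. g s \<in> cdom d"
    using gd by (auto simp: eventually_at_filter elim: eventually_mono)
  ultimately have "(cmap e \<circ> g has_vector_derivative J d e (g 0) *v ?v) (at 0)"
    using d e g0 by (intro has_vector_derivative_change_chart) auto
  from difference_quotient_tendsto[OF this]
  have "((\<lambda>s. (1 / s) *\<^sub>R (cmap e (g s) - cmap e (f x))) \<longlongrightarrow> ?J *v ?v) (at 0)"
    by (simp add: g0)
  then have q: "((\<lambda>s. (1 / s) *\<^sub>R (cmap e (g s) - cmap e (f x))) \<longlongrightarrow> ?J *v ?v) (at_right 0)"
    by (rule tendsto_mono[OF at_le, rotated]) simp
  have D: "det2 ?t' (?J *v ?v) = det ?J * det2 ?t ?v"
    unfolding velocity_change_surface_chart[OF x(2) d(1) e(1) x(3) d(2) e(2)] by (rule det2_matrix)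
  have dJ: "det ?J \<noteq> 0" by (rule det_J_nonzero[OF d(1) e(1) d(2) e(2)])
  define k :: bit where "k = w1_cocycle d e (f x)"
  have sv: "sector_value e (cmap e (f x)) (?J *v ?v) (left_value c e x + k)"
  proof (cases "det ?J > 0")
    case True
    then have "det2 ?t' (?J *v ?v) > 0" using D tv by simp
    then have "k = 0" "sector_value e (cmap e (f x)) (?J *v ?v) (left_value c e x)"
      using sector_value_left[OF x e, of "?J *v ?v"] True by (simp_all add: k_def w1_cocycle_alt)
    then show ?thesis by (simp only: add_0_right)
  next
    case False
    then have neg: "det ?J < 0" using dJ by simp
    then have "det2 ?t' (?J *v ?v) < 0" using D tv by (simp add: mult_neg_pos)
    from sector_value_right[OF x e this] show ?thesis
      using neg by (simp add: k_def w1_cocycle_alt)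
  qed
  have id: "filterlim (\<lambda>s. s) (at_right 0) (at_right (0::real))" by (rule filterlim_ident)
  have gdr: "\<forall>\<^sub>F s in at_right 0. g s \<in> cdom d \<and> cmap d (g s) = cmap d (f x) + s *\<^sub>R ?v"
    using gd by (auto simp: eventually_at_filter elim: eventually_mono)
  have evd: "\<forall>\<^sub>F s in at_right 0. cmap d (f x) + s *\<^sub>R ?v \<in> cmap d ` cdom d - trace d \<and>
      flip_in_chart d (cmap d (f x) + s *\<^sub>R ?v) = left_value c d x"
    by (rule sector_value_tendsto[OF sector_value_left[OF x d tv] id tendsto_const])
  have eve: "\<forall>\<^sub>F s in at_right 0. flip_in_chart e (cmap e (g s)) = left_value c e x + k"
    using sector_value_tendsto[OF sv id q] eventually_at_right_less[of 0]
    by eventually_elim simp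
  have offc: "\<forall>\<^sub>F s in at_right 0. g s \<notin> f ` B"
    using evd gdr
  proof eventually_elim
    case (elim s)
    then show ?case unfolding trace_def by (metis DiffD2 IntI imageI)
  qed
  have "(g \<longlongrightarrow> f x) (at_right 0)"
  proof -
    have "isCont (cinv d) (cmap d (f x))"
      using continuous_on_cinv[OF d(1)] open_chart_image[OF d(1)] d(2)
      by (simp add: continuous_on_eq_continuous_at)
    from isCont_tendsto_compose[OF this lim] have "(g \<longlongrightarrow> f x) (at 0)"
      using d by (simp add: g_def[abs_def])
    then show ?thesis by (rule tendsto_mono[OF at_le, rotated]) simp
  qed
  moreover have "\<forall>\<^sub>F s in at_right 0. g s \<in> S \<and> g s \<noteq> f x"
    using gdr offc by eventually_elim (use cdom_subset[OF d(1)] x(1) in \<open>auto simp: simple_def\<close>)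
  ultimately have "filterlim g (at (f x) within S) (at_right 0)" by (simp add: filterlim_at)
  from eventually_compose_filterlim[OF w1_cocycle_locally_constant[OF d(1) e(1) d(2) e(2)] this]
  have "\<forall>\<^sub>F s in at_right 0. g s \<in> cdom d \<and> g s \<in> cdom e \<and> w1_cocycle d e (g s) = k"
    by (simp add: k_def)
  then have "\<forall>\<^sub>F s in at_right (0::real). left_value c e x + k = left_value c d x + k"
    using evd eve offc gdr
  proof eventually_elim
    case (elim s)
    then have "flip_in_chart e (cmap e (g s)) = flip_in_chart d (cmap d (g s)) + w1_cocycle d e (g s)"
      by (intro flip_in_chart_change_chart d e) auto
    then show ?case using elim by metis
  qed
  then have "left_value c e x + k = left_value c d x + k"
    using trivial_limit_at_right_real eventually_const by blast
  then show ?thesis by (cases k; cases "left_value c e x"; cases "left_value c d x") auto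
qed

text \<open>
  Reversing the coordinate of the base swaps the two sides.
\<close>

lemma left_value_change_base_chart:
  assumes x: "simple x" and c: "c \<in> AB" "x \<in> cdom c" "c' \<in> AB" "x \<in> cdom c'" and d: "d \<in> AS" "f x \<in> cdom d"
  defines "k \<equiv> deriv (cmap c' \<circ> cinv c) (cmap c x)"
  shows "k > 0 \<Longrightarrow> left_value c' d x = left_value c d x"
    and "k < 0 \<Longrightarrow> left_value c' d x = left_value c d x + 1" and "k \<noteq> 0"
proof -
  let ?u = "rot (velocity c f d x)"
  have v: "velocity c f d x = k *\<^sub>R velocity c' f d x"
    unfolding k_def by (rule velocity_change_base_chart[OF c(1,3) d(1) c(2,4) d(2)])
  have pos: "det2 (velocity c f d x) ?u > 0" by (rule det2_velocity_rot_pos[OF c(1,2) d])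
  then have p: "k * det2 (velocity c' f d x) ?u > 0" by (subst (asm) (1) v) (simp add: det2_simps)
  then show "k \<noteq> 0" by auto
  have s: "sector_value d (cmap d (f x)) ?u (left_value c d x)"
    by (rule sector_value_left[OF x c(1,2) d pos])
  show "left_value c' d x = left_value c d x" if "k > 0"
    using sector_value_left[OF x c(3,4) d, of ?u] p that s sector_value_unique
    by (metis zero_less_mult_pos)
  show "left_value c' d x = left_value c d x + 1" if "k < 0"
  proof -
    have "det2 (velocity c' f d x) ?u < 0" using p that by (simp add: zero_less_mult_iff)
    from sector_value_unique[OF sector_value_right[OF x c(3,4) d this] s]
    show ?thesis by (cases "left_value c' d x") auto
  qed
qed

text \<open>
  Perpendicular segments erected at points \<open>z\<close> of the branch, of a length proportional to the
  distance of \<open>z\<close> from \<open>x\<close>, meet the curve at \<open>f z\<close> only. They avoid their own branch since secants of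
  it are nearly parallel to the tangent, and they avoid the other branch since they stay within a
  cone around the tangent of the first one, which is transversal to the second.
\<close>

lemma branch_clearance:
  assumes br: "branches d c x c' x'"
    and tr: "x' \<noteq> x \<Longrightarrow> det2 (velocity c f d x) (velocity c' f d x') \<noteq> 0" and \<kappa>1: "\<kappa>1 > 0"
  obtains \<kappa> where "0 < \<kappa>" "\<kappa> \<le> \<kappa>1"
    "\<forall>\<^sub>F z in at x within B. z \<in> cdom c \<and> f z \<in> cdom d \<and> cmap c z \<noteq> cmap c x \<and> simple z \<and>
       det2 (velocity c f d z) (rot (velocity c f d x)) > 0 \<and>
       (\<forall>r. \<bar>r\<bar> \<le> \<kappa> * \<bar>cmap c z - cmap c x\<bar> \<longrightarrow>
          cmap d (f z) + r *\<^sub>R rot (velocity c f d x) \<in> cmap d ` cdom d \<and>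
          (cmap d (f z) + r *\<^sub>R rot (velocity c f d x) \<in> trace d \<longrightarrow> r = 0))"
proof -
  let ?t = "velocity c f d x" and ?t' = "velocity c' f d x'"
  let ?D = "det2 ?t ?t'" and ?T = "norm (velocity c f d x)" and ?T' = "norm (velocity c' f d x')"
  have b: "d \<in> AS" "c \<in> AB" "c' \<in> AB" "x \<in> cdom c" "x' \<in> cdom c'" "f x \<in> cdom d" "f x' = f x"
    and fib: "\<And>z. z \<in> B \<Longrightarrow> f z = f x \<Longrightarrow> z = x \<or> z = x'" using br by (auto simp: branches_def)
  have x'd: "f x' \<in> cdom d" using b by simp
  have T: "?T > 0" using velocity_nonzero[OF b(2,1,4,6)] by simp
  have T': "?T' > 0" using velocity_nonzero[OF b(3,1,5) x'd] by simp
  \<comment> \<open>Here \<open>\<eta>\<close> bounds the relative deviation of the branch from its tangent, and \<open>\<kappa>\<close> makes the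
    segments contribute no more than that. If there is another branch, both together change
    \<open>det2 ?t'\<close> by at most a quarter of its value on the tangent.\<close>
  define \<eta> where "\<eta> = (if x' = x then ?T / 4 else min (?T / 4) (\<bar>?D\<bar> / (8 * ?T')))"
  define \<kappa> where "\<kappa> = min \<kappa>1 (\<eta> / ?T)"
  have \<eta>: "\<eta> > 0" "\<eta> \<le> ?T / 4" "x' \<noteq> x \<Longrightarrow> ?T' * \<eta> \<le> \<bar>?D\<bar> / 8"
  proof -
    show "\<eta> > 0" "\<eta> \<le> ?T / 4" using T T' tr by (auto simp: \<eta>_def)
    assume "x' \<noteq> x"
    then have "?T' * \<eta> \<le> ?T' * (\<bar>?D\<bar> / (8 * ?T'))" using T' by (intro mult_left_mono) (auto simp: \<eta>_def)
    then show "?T' * \<eta> \<le> \<bar>?D\<bar> / 8" using T' by simp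
  qed
  have \<kappa>: "\<kappa> > 0" "\<kappa> \<le> \<kappa>1" "\<kappa> * ?T \<le> \<eta>"
    using \<kappa>1 \<eta>(1) T by (auto simp: \<kappa>_def min_def field_simps)
  obtain N1 where N1: "openin (top_of_set B) N1" "x \<in> N1" "N1 \<subseteq> cdom c" "\<And>z. z \<in> N1 \<Longrightarrow> f z \<in> cdom d"
    "\<And>y z. y \<in> N1 \<Longrightarrow> z \<in> N1 \<Longrightarrow>
       norm (cmap d (f y) - cmap d (f z) - (cmap c y - cmap c z) *\<^sub>R ?t) \<le> \<eta> * \<bar>cmap c y - cmap c z\<bar>"
    "\<And>z. z \<in> N1 \<Longrightarrow> norm (velocity c f d z - ?t) \<le> \<eta>"
    by (rule curve_strict_derivative[OF b(2,4,1,6) \<eta>(1)]) (rule that)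
  obtain N2 where N2: "openin (top_of_set B) N2" "x' \<noteq> x \<Longrightarrow> x' \<in> N2"
    "\<And>z. z \<in> N2 \<Longrightarrow> x' \<noteq> x \<and> \<bar>det2 ?t' (cmap d (f z) - cmap d (f x))\<bar>
       \<le> \<bar>?D\<bar> / (8 * ?T) * norm (cmap d (f z) - cmap d (f x))"
  proof (cases "x' = x")
    case True
    then show ?thesis using that[of "{}"] by simp
  next
    case False
    then have "\<bar>?D\<bar> / (8 * ?T) > 0" using tr T by simp
    from branch_in_cone[OF b(3,5,1) x'd this] that False b(7) show ?thesis by metis
  qed
  have N: "openin (top_of_set B) (N1 \<union> N2)" using N1(1) N2(1) by blast
  obtain \<delta> where \<delta>: "\<delta> > 0" "ball (cmap d (f x)) \<delta> \<subseteq> cmap d ` cdom d"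
    "\<And>z. z \<in> B \<Longrightarrow> f z \<in> cdom d \<Longrightarrow> cmap d (f z) \<in> ball (cmap d (f x)) \<delta> \<Longrightarrow> z \<in> N1 \<union> N2"
    using near_fiber[OF b(1,6) N] fib N1(2) N2(2) by blast
  show ?thesis
  proof (rule that[OF \<kappa>(1,2)])
    have "\<forall>\<^sub>F z in at x within B. z \<in> N1 \<and> z \<noteq> x"
      using base.eventually_in_openin[OF N1(1,2)] by (auto simp: eventually_at_filter elim: eventually_mono)
    moreover have "\<forall>\<^sub>F z in at x within B. \<bar>cmap c z - cmap c x\<bar> < \<delta> / (2 * ?T)"
    proof -
      have "((\<lambda>z. \<bar>cmap c z - cmap c x\<bar>) \<longlongrightarrow> 0) (at x within B)"
        using coordinate_tendsto[OF b(2,4)] by (simp add: filterlim_at)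
      then show ?thesis by (rule order_tendstoD(2)) (use \<delta>(1) T in simp)
    qed
    ultimately show "\<forall>\<^sub>F z in at x within B. z \<in> cdom c \<and> f z \<in> cdom d \<and> cmap c z \<noteq> cmap c x \<and> simple z \<and>
       det2 (velocity c f d z) (rot ?t) > 0 \<and>
       (\<forall>r. \<bar>r\<bar> \<le> \<kappa> * \<bar>cmap c z - cmap c x\<bar> \<longrightarrow>
          cmap d (f z) + r *\<^sub>R rot ?t \<in> cmap d ` cdom d \<and>
          (cmap d (f z) + r *\<^sub>R rot ?t \<in> trace d \<longrightarrow> r = 0))"
    proof eventually_elim
      case (elim z)
      define h where "h = cmap c z - cmap c x"
      have zc: "z \<in> cdom c" "f z \<in> cdom d" "z \<in> B"
        using elim N1(3,4) base.cdom_subset[OF b(2)] by auto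
      have h0: "h \<noteq> 0" using base.cmap_inj[OF b(2) zc(1) b(4)] elim by (auto simp: h_def)
      define err where "err = cmap d (f z) - cmap d (f x) - h *\<^sub>R ?t"
      have err: "norm err \<le> \<eta> * \<bar>h\<bar>" using N1(5)[of z x] elim N1(2) by (simp add: h_def err_def)
      have pt: "cmap d (f z) + r *\<^sub>R rot ?t = cmap d (f x) + (h *\<^sub>R ?t + (err + r *\<^sub>R rot ?t))" for r
        by (simp add: err_def)
      have small: "norm (err + r *\<^sub>R rot ?t) \<le> 2 * \<eta> * \<bar>h\<bar>" if "\<bar>r\<bar> \<le> \<kappa> * \<bar>h\<bar>" for r
      proof -
        have "\<bar>r\<bar> * ?T \<le> \<kappa> * \<bar>h\<bar> * ?T" using that T by (intro mult_right_mono) auto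
        also have "\<dots> = (\<kappa> * ?T) * \<bar>h\<bar>" by simp
        also have "\<dots> \<le> \<eta> * \<bar>h\<bar>" using \<kappa>(3) by (intro mult_right_mono) auto
        finally have "norm (r *\<^sub>R rot ?t) \<le> \<eta> * \<bar>h\<bar>" by simp
        then show ?thesis using norm_triangle_ineq[of err "r *\<^sub>R rot ?t"] err by linarith
      qed
      have wn: "norm (h *\<^sub>R ?t + (err + r *\<^sub>R rot ?t)) \<le> 2 * ?T * \<bar>h\<bar>" if "\<bar>r\<bar> \<le> \<kappa> * \<bar>h\<bar>" for r
      proof -
        have "norm (h *\<^sub>R ?t + (err + r *\<^sub>R rot ?t)) \<le> \<bar>h\<bar> * ?T + 2 * \<eta> * \<bar>h\<bar>"
          using norm_triangle_ineq[of "h *\<^sub>R ?t" "err + r *\<^sub>R rot ?t"] small[OF that] by simp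
        moreover have "2 * \<eta> * \<bar>h\<bar> \<le> ?T * \<bar>h\<bar>" using \<eta> by (intro mult_right_mono) auto
        ultimately show ?thesis by (simp add: algebra_simps)
      qed
      have "2 * ?T * \<bar>h\<bar> < \<delta>" using elim T by (simp add: h_def field_simps)
      have ball: "cmap d (f z) + r *\<^sub>R rot ?t \<in> ball (cmap d (f x)) \<delta>" if "\<bar>r\<bar> \<le> \<kappa> * \<bar>h\<bar>" for r
      proof -
        have dw: "dist (cmap d (f x)) (cmap d (f x) + w) = norm w" for w by (simp add: dist_norm)
        show ?thesis
          unfolding pt mem_ball dw using wn[OF that] \<open>2 * ?T * \<bar>h\<bar> < \<delta>\<close> by linarith
      qed
      have only: "z' = z" if z': "z' \<in> B" "f z' \<in> cdom d" "cmap d (f z') = cmap d (f z) + r *\<^sub>R rot ?t"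
        and r: "\<bar>r\<bar> \<le> \<kappa> * \<bar>h\<bar>" for z' r
      proof -
        have "z' \<in> N1 \<union> N2" using \<delta>(3)[OF z'(1,2)] ball[OF r] z'(3) by simp
        then show ?thesis
        proof
          \<comment> \<open>A secant of the branch through \<open>x\<close> is not perpendicular to its tangent at \<open>x\<close>.\<close>
          assume z'N: "z' \<in> N1"
          define h' where "h' = cmap c z' - cmap c z"
          have "norm (r *\<^sub>R rot ?t - h' *\<^sub>R ?t) \<le> \<eta> * \<bar>h'\<bar>"
            using N1(5)[OF z'N, of z] elim z'(3) by (simp add: h'_def)
          then have "\<bar>?t \<bullet> (r *\<^sub>R rot ?t - h' *\<^sub>R ?t)\<bar> \<le> ?T * (\<eta> * \<bar>h'\<bar>)"
            using Cauchy_Schwarz_ineq2[of ?t "r *\<^sub>R rot ?t - h' *\<^sub>R ?t"] T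
            by (meson mult_left_mono norm_ge_zero order_trans)
          moreover have "?t \<bullet> (r *\<^sub>R rot ?t - h' *\<^sub>R ?t) = - h' * ?T\<^sup>2"
            by (simp add: inner_diff_right inner_rot power2_norm_eq_inner)
          ultimately have "\<bar>h'\<bar> * ?T\<^sup>2 \<le> ?T * (\<eta> * \<bar>h'\<bar>)" by (simp add: abs_mult)
          also have "\<dots> \<le> ?T * (?T / 4 * \<bar>h'\<bar>)"
            using \<eta>(2) T by (intro mult_left_mono mult_right_mono) auto
          finally have "\<bar>h'\<bar> * ?T\<^sup>2 \<le> \<bar>h'\<bar> * ?T\<^sup>2 / 4" by (simp add: power2_eq_square mult.commute)
          then have "\<bar>h'\<bar> * ?T\<^sup>2 \<le> 0" by linarith
          then have "h' = 0" using T by (simp add: mult_le_0_iff)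
          then show "z' = z" using base.cmap_inj[OF b(2), of z' z] z'N N1(3) zc(1) by (auto simp: h'_def)
        next
          assume z'N: "z' \<in> N2"
          let ?w = "h *\<^sub>R ?t + (err + r *\<^sub>R rot ?t)"
          have w: "cmap d (f z') - cmap d (f x) = ?w" using z'(3) pt[of r] by simp
          have ne: "x' \<noteq> x" and le: "\<bar>det2 ?t' ?w\<bar> \<le> \<bar>?D\<bar> / (8 * ?T) * norm ?w"
            using N2(3)[OF z'N] unfolding w by auto
          have "\<bar>?D\<bar> / (8 * ?T) * norm ?w \<le> \<bar>?D\<bar> / (8 * ?T) * (2 * ?T * \<bar>h\<bar>)"
            using wn[OF r] T by (intro mult_left_mono) auto
          also have "\<dots> = \<bar>?D\<bar> * \<bar>h\<bar> / 4" using T by simp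
          finally have up: "\<bar>det2 ?t' ?w\<bar> \<le> \<bar>?D\<bar> * \<bar>h\<bar> / 4" using le by linarith
          have "\<bar>det2 ?t' (err + r *\<^sub>R rot ?t)\<bar> \<le> ?T' * (2 * \<eta> * \<bar>h\<bar>)"
            using abs_det2_le[of ?t' "err + r *\<^sub>R rot ?t"] mult_left_mono[OF small[OF r], of ?T'] by simp
          also have "\<dots> = 2 * (?T' * \<eta>) * \<bar>h\<bar>" by simp
          also have "\<dots> \<le> 2 * (\<bar>?D\<bar> / 8) * \<bar>h\<bar>"
            using \<eta>(3)[OF ne] by (intro mult_right_mono mult_left_mono) auto
          finally have "\<bar>det2 ?t' (err + r *\<^sub>R rot ?t)\<bar> \<le> \<bar>?D\<bar> * \<bar>h\<bar> / 4" by simp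
          moreover have "det2 ?t' ?w = - (h * ?D) + det2 ?t' (err + r *\<^sub>R rot ?t)"
            by (simp add: det2_simps det2_swap[of ?t'])
          moreover have "\<bar>h * ?D\<bar> = \<bar>?D\<bar> * \<bar>h\<bar>" by (simp add: abs_mult)
          ultimately have "\<bar>?D\<bar> * \<bar>h\<bar> \<le> \<bar>?D\<bar> * \<bar>h\<bar> / 2" using up by linarith
          moreover have "\<bar>?D\<bar> * \<bar>h\<bar> > 0" using tr[OF ne] h0 by simp
          ultimately show "z' = z" by linarith
        qed
      qed
      have "simple z"
        unfolding simple_def using zc only[of _ 0] \<kappa>(1) by auto
      moreover have "det2 (velocity c f d z) (rot ?t) > 0"
      proof -
        have "\<bar>det2 (velocity c f d z - ?t) (rot ?t)\<bar> \<le> \<eta> * ?T"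
          using abs_det2_le[of "velocity c f d z - ?t" "rot ?t"] mult_right_mono[OF N1(6)[of z], of ?T] elim by simp
        also have "\<dots> \<le> ?T / 4 * ?T" using \<eta>(2) T by (intro mult_right_mono) auto
        finally have "\<bar>det2 (velocity c f d z) (rot ?t) - ?T\<^sup>2\<bar> \<le> ?T\<^sup>2 / 4"
          by (simp add: det2_simps det2_rot power2_eq_square)
        moreover have "?T\<^sup>2 > 0" using T by simp
        ultimately show ?thesis by linarith
      qed
      moreover have "cmap d (f z) + r *\<^sub>R rot ?t \<in> cmap d ` cdom d"
        "cmap d (f z) + r *\<^sub>R rot ?t \<in> trace d \<longrightarrow> r = 0" if r: "\<bar>r\<bar> \<le> \<kappa> * \<bar>h\<bar>" for r
      proof -
        show "cmap d (f z) + r *\<^sub>R rot ?t \<in> cmap d ` cdom d" using ball[OF r] \<delta>(2) by blast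
        show "cmap d (f z) + r *\<^sub>R rot ?t \<in> trace d \<longrightarrow> r = 0"
        proof
          assume "cmap d (f z) + r *\<^sub>R rot ?t \<in> trace d"
          then obtain z' where z': "z' \<in> B" "f z' \<in> cdom d" "cmap d (f z') = cmap d (f z) + r *\<^sub>R rot ?t"
            unfolding trace_def by auto
          then have "r *\<^sub>R rot ?t = 0" using only[OF z' r] by simp
          moreover have "rot ?t \<noteq> 0" using T norm_rot[of ?t] by (metis norm_zero less_irrefl)
          ultimately show "r = 0" by simp
        qed
      qed
      ultimately show ?case using zc h0 unfolding h_def by auto
    qed
  qed
qed

end

section \<open>Orientation of the chord diagram\<close>

context curve_dual_to_w1
begin

text \<open>
  Let \<open>z\<close> approach \<open>x\<close> along the branch, from the side given by \<open>\<rho>\<close>. The perpendicular segment at \<open>z\<close>,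
  to the left for \<open>\<mu> = 1\<close> and to the right for \<open>\<mu> = -1\<close>, leads off the curve from a point next to \<open>z\<close>
  to a point that is seen from \<open>f x\<close> approximately in the direction
  \<open>\<rho> *\<^sub>R t + (\<mu> * \<kappa>) *\<^sub>R rot t\<close>, where \<open>t\<close> is the velocity at \<open>x\<close>. So the sector of that direction
  determines the values next to \<open>z\<close>.
\<close>

lemma left_value_along_branch:
  assumes br: "branches d c x c' x'"
    and tr: "x' \<noteq> x \<Longrightarrow> det2 (velocity c f d x) (velocity c' f d x') \<noteq> 0" and \<kappa>1: "\<kappa>1 > 0"
  obtains \<kappa> where "0 < \<kappa>" "\<kappa> \<le> \<kappa>1"
    "\<forall>\<^sub>F z in at x within B. z \<in> cdom c \<and> f z \<in> cdom d \<and> cmap c z \<noteq> cmap c x \<and> simple z"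
    "\<And>\<rho> \<mu> e. \<rho> \<in> {1, -1} \<Longrightarrow> \<mu> \<in> {1, -1} \<Longrightarrow>
       sector_value d (cmap d (f x)) (\<rho> *\<^sub>R velocity c f d x + (\<mu> * \<kappa>) *\<^sub>R rot (velocity c f d x)) e \<Longrightarrow>
       \<forall>\<^sub>F z in at x within B. \<rho> * (cmap c z - cmap c x) > 0 \<longrightarrow>
         left_value c d z = (if \<mu> = 1 then e else e + 1)"
proof -
  let ?t = "velocity c f d x" and ?P = "cmap d (f x)"
  let ?h = "\<lambda>z. cmap c z - cmap c x"
  have b: "d \<in> AS" "c \<in> AB" "x \<in> cdom c" "f x \<in> cdom d" using br by (auto simp: branches_def)
  obtain \<kappa> where \<kappa>: "0 < \<kappa>" "\<kappa> \<le> \<kappa>1"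
    and cl: "\<forall>\<^sub>F z in at x within B. z \<in> cdom c \<and> f z \<in> cdom d \<and> cmap c z \<noteq> cmap c x \<and> simple z \<and>
       det2 (velocity c f d z) (rot ?t) > 0 \<and>
       (\<forall>r. \<bar>r\<bar> \<le> \<kappa> * \<bar>?h z\<bar> \<longrightarrow>
          cmap d (f z) + r *\<^sub>R rot ?t \<in> cmap d ` cdom d \<and>
          (cmap d (f z) + r *\<^sub>R rot ?t \<in> trace d \<longrightarrow> r = 0))"
    by (rule branch_clearance[OF br tr \<kappa>1]) (assumption, rule that)
  show ?thesis
  proof (rule that[OF \<kappa>])
    show "\<forall>\<^sub>F z in at x within B. z \<in> cdom c \<and> f z \<in> cdom d \<and> cmap c z \<noteq> cmap c x \<and> simple z"
      using cl by (rule eventually_mono) blast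
    fix \<rho> \<mu> :: real and e
    assume \<rho>: "\<rho> \<in> {1, -1}" and \<mu>: "\<mu> \<in> {1, -1}"
      and sv: "sector_value d ?P (\<rho> *\<^sub>R ?t + (\<mu> * \<kappa>) *\<^sub>R rot ?t) e"
    let ?F = "inf (at x within B) (principal {z. \<rho> * ?h z > 0})"
    let ?w = "\<lambda>z. \<rho> *\<^sub>R ((1 / ?h z) *\<^sub>R (cmap d (f z) - ?P)) + (\<mu> * \<kappa>) *\<^sub>R rot ?t"
    have h: "filterlim (\<lambda>z. \<bar>?h z\<bar>) (at_right 0) ?F"
      by (rule filterlim_mono[OF coordinate_tendsto[OF b(2,3)]]) auto
    have "((\<lambda>z. (1 / ?h z) *\<^sub>R (cmap d (f z) - ?P)) \<longlongrightarrow> ?t) ?F"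
      by (rule tendsto_mono[OF _ secant_tendsto_velocity[OF b(2,3,1,4)]]) simp
    then have "(?w \<longlongrightarrow> \<rho> *\<^sub>R ?t + (\<mu> * \<kappa>) *\<^sub>R rot ?t) ?F" by (intro tendsto_intros)
    from sector_value_tendsto[OF sv h this]
    have "\<forall>\<^sub>F z in at x within B. \<rho> * ?h z > 0 \<longrightarrow> flip_in_chart d (?P + \<bar>?h z\<bar> *\<^sub>R ?w z) = e"
      unfolding eventually_inf_principal by (rule eventually_mono) simp
    then show "\<forall>\<^sub>F z in at x within B. \<rho> * ?h z > 0 \<longrightarrow> left_value c d z = (if \<mu> = 1 then e else e + 1)"
      using cl
    proof eventually_elim
      case (elim z)
      show ?case
      proof
        assume pos: "\<rho> * ?h z > 0"
        then have h0: "?h z \<noteq> 0" and ah: "\<bar>?h z\<bar> = \<rho> * ?h z" using \<rho> by auto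
        define H where "H = \<kappa> * \<bar>?h z\<bar>"
        have H: "H > 0" using \<kappa>(1) h0 by (simp add: H_def)
        have "\<bar>?h z\<bar> *\<^sub>R (\<rho> *\<^sub>R ((1 / ?h z) *\<^sub>R (cmap d (f z) - ?P))) = cmap d (f z) - ?P"
          unfolding ah using h0 \<rho> by auto
        then have "?P + \<bar>?h z\<bar> *\<^sub>R ?w z = cmap d (f z) + (\<mu> * H) *\<^sub>R rot ?t"
          by (simp add: scaleR_add_right H_def mult.commute mult.left_commute)
        then have e: "flip_in_chart d (cmap d (f z) + (\<mu> * H) *\<^sub>R rot ?t) = e" using elim(1) pos by simp
        \<comment> \<open>The value next to the curve at \<open>z\<close>, on the side chosen by \<open>\<mu>\<close>.\<close>
        define l where "l = (if \<mu> = 1 then left_value c d z else left_value c d z + 1)"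
        have "sector_value d (cmap d (f z)) (\<mu> *\<^sub>R rot ?t) l"
        proof (cases "\<mu> = 1")
          case True
          then show ?thesis using sector_value_left[of z c d "rot ?t"] elim(2) b by (simp add: l_def)
        next
          case False
          then have "\<mu> = -1" using \<mu> by simp
          then show ?thesis using sector_value_right[of z c d "- rot ?t"] elim(2) b
            by (simp add: l_def det2_simps)
        qed
        from sector_value_tendsto[OF this filterlim_ident tendsto_const]
        have "\<forall>\<^sub>F s in at_right 0. flip_in_chart d (cmap d (f z) + s *\<^sub>R (\<mu> *\<^sub>R rot ?t)) = l"
          by (rule eventually_mono) simp
        moreover have "\<forall>\<^sub>F s in at_right 0. 0 < s \<and> s < H"
          using H by (simp add: eventually_at_right_field) (use H in blast)
        ultimately have "\<forall>\<^sub>F s in at_right 0. flip_in_chart d (cmap d (f z) + s *\<^sub>R (\<mu> *\<^sub>R rot ?t)) = l \<and> 0 < s \<and> s < H"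
          by (rule eventually_conj)
        then obtain s where s: "flip_in_chart d (cmap d (f z) + (\<mu> * s) *\<^sub>R rot ?t) = l" "0 < s" "s < H"
          using eventually_happens'[OF trivial_limit_at_right_real] by (auto simp: mult.commute)
        have off: "y \<in> cmap d ` cdom d - trace d"
          if "y \<in> closed_segment (cmap d (f z) + (\<mu> * s) *\<^sub>R rot ?t) (cmap d (f z) + (\<mu> * H) *\<^sub>R rot ?t)" for y
        proof -
          have "\<exists>k. 0 \<le> k \<and> k \<le> 1 \<and> y = (1 - k) *\<^sub>R (cmap d (f z) + (\<mu> * s) *\<^sub>R rot ?t) + k *\<^sub>R (cmap d (f z) + (\<mu> * H) *\<^sub>R rot ?t)"
            using that by (simp only: in_segment)
          then obtain k where k: "0 \<le> k" "k \<le> 1"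
            "y = (1 - k) *\<^sub>R (cmap d (f z) + (\<mu> * s) *\<^sub>R rot ?t) + k *\<^sub>R (cmap d (f z) + (\<mu> * H) *\<^sub>R rot ?t)"
            by (elim exE conjE)
          define r where "r = (1 - k) * s + k * H"
          have y: "y = cmap d (f z) + (\<mu> * r) *\<^sub>R rot ?t"
            unfolding k(3) r_def by (simp add: vec_eq_iff algebra_simps)
          have "k * s \<le> k * H" "(1 - k) * s \<le> (1 - k) * H" using k s by (auto intro: mult_left_mono)
          then have r: "s \<le> r" "r \<le> H" by (simp_all add: r_def algebra_simps)
          then have "\<bar>\<mu> * r\<bar> \<le> H" "\<mu> * r \<noteq> 0" using \<mu> s by auto
          then show ?thesis using elim(2) unfolding y H_def by blast
        qed
        have "l = e" unfolding s(1)[symmetric] e[symmetric] by (rule flip_in_chart_segment[OF b(1)]) (use off in blast)+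
        then show "left_value c d z = (if \<mu> = 1 then e else e + 1)"
          by (cases "left_value c d z") (auto simp: l_def split: if_splits)
      qed
    qed
  qed
qed

lemma left_value_locally_constant:
  assumes x: "simple x" "c \<in> AB" "x \<in> cdom c" "d \<in> AS" "f x \<in> cdom d"
  shows "\<forall>\<^sub>F z in at x within B. z \<in> cdom c \<and> f z \<in> cdom d \<and> simple z \<and> left_value c d z = left_value c d x"
proof -
  let ?t = "velocity c f d x"
  obtain \<kappa> where \<kappa>: "0 < \<kappa>" and near: "\<forall>\<^sub>F z in at x within B. z \<in> cdom c \<and> f z \<in> cdom d \<and> cmap c z \<noteq> cmap c x \<and> simple z"
    and along: "\<And>\<rho> \<mu> e. \<rho> \<in> {1, -1} \<Longrightarrow> \<mu> \<in> {1, -1} \<Longrightarrow>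
       sector_value d (cmap d (f x)) (\<rho> *\<^sub>R ?t + (\<mu> * \<kappa>) *\<^sub>R rot ?t) e \<Longrightarrow>
       \<forall>\<^sub>F z in at x within B. \<rho> * (cmap c z - cmap c x) > 0 \<longrightarrow> left_value c d z = (if \<mu> = 1 then e else e + 1)"
    by (rule left_value_along_branch[OF branches_simple[OF x(1,4,2,3,5)] _ zero_less_one]) (simp, rule that)
  have "sector_value d (cmap d (f x)) (\<rho> *\<^sub>R ?t + (1 * \<kappa>) *\<^sub>R rot ?t) (left_value c d x)" for \<rho>
    using det2_velocity_rot_pos[OF x(2-5)] \<kappa> by (intro sector_value_left x) (simp add: det2_simps)
  from along[OF _ _ this, of 1] along[OF _ _ this, of "-1"]
  have "\<forall>\<^sub>F z in at x within B. 1 * (cmap c z - cmap c x) > 0 \<longrightarrow> left_value c d z = left_value c d x"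
    "\<forall>\<^sub>F z in at x within B. -1 * (cmap c z - cmap c x) > 0 \<longrightarrow> left_value c d z = left_value c d x"
    by simp_all
  with near show ?thesis
    by eventually_elim (auto simp: linorder_neq_iff)
qed

text \<open>
  Neighbouring sectors at the double point are separated by a half-branch, so their values differ
  and alternate around the point. The sectors to the left of a branch before and after the double
  point are separated by the other branch, so the value on the left changes at the point. For the
  two branches it changes in opposite ways: index a sector by its sides with respect to the two
  branches, and let \<open>s\<close> be the sign of the determinant of their velocities. To the left of the first
  branch before the point lies the sector \<open>(1, s)\<close>, to the left of the second branch after it the
  sector \<open>(s, 1)\<close>; these are equal or opposite, and in both cases have the same value.
\<close>

lemma left_value_at_double_point:
  assumes xy: "x \<in> B" "y \<in> B" "x \<noteq> y" "f x = f y"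
    and c: "c \<in> AB" "x \<in> cdom c" "c' \<in> AB" "y \<in> cdom c'" and d: "d \<in> AS" "f x \<in> cdom d"
  obtains b where
    "\<forall>\<^sub>F z in at x within B. z \<in> cdom c \<and> f z \<in> cdom d \<and> simple z \<and>
       left_value c d z = (if cmap c z < cmap c x then b else b + 1)"
    "\<forall>\<^sub>F z in at y within B. z \<in> cdom c' \<and> f z \<in> cdom d \<and> simple z \<and>
       left_value c' d z = (if cmap c' z < cmap c' y then b + 1 else b)"
proof -
  let ?t = "velocity c f d x" and ?t' = "velocity c' f d y" and ?P = "cmap d (f x)"
  let ?D = "det2 ?t ?t'"
  have br: "branches d c x c' y"
    unfolding branches_def using c d xy no_triple_point[OF xy(1,2)] by metis
  have br': "branches d c' y c x"
    unfolding branches_def using c d xy no_triple_point[OF xy(1,2)] by metis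
  have D: "?D \<noteq> 0"
    using double_point_transversal[OF xy] c d unfolding transversal_at_def
    by (simp add: span_pair_eq_UNIV_iff)
  then have D': "det2 ?t' ?t \<noteq> 0" by (simp add: det2_swap[of ?t'])
  have T: "norm ?t > 0" using velocity_nonzero[OF c(1) d(1) c(2) d(2)] by simp
  have T': "norm ?t' > 0" using velocity_nonzero[OF c(3) d(1) c(4)] d(2) xy(4) by simp
  have "\<forall>\<sigma> \<sigma>'. \<exists>e. \<sigma> \<in> {1, -1} \<longrightarrow> \<sigma>' \<in> {1, -1} \<longrightarrow> (\<forall>u. \<sigma> * det2 ?t u > 0 \<longrightarrow> \<sigma>' * det2 ?t' u > 0 \<longrightarrow> sector_value d ?P u e)"
    using sector_value_exists[OF br] by blast
  then obtain e where e: "\<And>\<sigma> \<sigma>' u. \<sigma> \<in> {1, -1} \<Longrightarrow> \<sigma>' \<in> {1, -1} \<Longrightarrow> \<sigma> * det2 ?t u > 0 \<Longrightarrow> \<sigma>' * det2 ?t' u > 0 \<Longrightarrow>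
      sector_value d ?P u (e \<sigma> \<sigma>')" by metis
  define \<kappa>1 where "\<kappa>1 = \<bar>?D\<bar> / (2 * (norm ?t * norm ?t'))"
  have \<kappa>1: "\<kappa>1 > 0" using D T T' by (simp add: \<kappa>1_def)
  have dom: "\<bar>\<mu> * \<kappa> * q\<bar> < \<bar>?D\<bar>" if "0 < \<kappa>" "\<kappa> \<le> \<kappa>1" "\<mu> \<in> {1, -1}" "\<bar>q\<bar> \<le> norm ?t * norm ?t'" for \<mu> \<kappa> q :: real
  proof -
    have "\<bar>\<mu> * \<kappa> * q\<bar> = \<kappa> * \<bar>q\<bar>" using that by (auto simp: abs_mult)
    also have "\<dots> \<le> \<kappa>1 * (norm ?t * norm ?t')" using that by (intro mult_mono) auto
    also have "\<dots> = \<bar>?D\<bar> / 2" using T T' by (simp add: \<kappa>1_def)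
    finally show ?thesis using D by linarith
  qed
  define s where "s = sgn ?D"
  have s: "s \<in> {1, -1}" "s * ?D = \<bar>?D\<bar>" using D by (auto simp: s_def sgn_if)
  obtain \<kappa> where \<kappa>: "0 < \<kappa>" "\<kappa> \<le> \<kappa>1"
    and near: "\<forall>\<^sub>F z in at x within B. z \<in> cdom c \<and> f z \<in> cdom d \<and> cmap c z \<noteq> cmap c x \<and> simple z"
    and along: "\<And>\<rho> \<mu> e. \<rho> \<in> {1, -1} \<Longrightarrow> \<mu> \<in> {1, -1} \<Longrightarrow>
       sector_value d ?P (\<rho> *\<^sub>R ?t + (\<mu> * \<kappa>) *\<^sub>R rot ?t) e \<Longrightarrow>
       \<forall>\<^sub>F z in at x within B. \<rho> * (cmap c z - cmap c x) > 0 \<longrightarrow> left_value c d z = (if \<mu> = 1 then e else e + 1)"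
    by (rule left_value_along_branch[OF br D \<kappa>1]) (rule that)
  obtain \<kappa>' where \<kappa>': "0 < \<kappa>'" "\<kappa>' \<le> \<kappa>1"
    and near': "\<forall>\<^sub>F z in at y within B. z \<in> cdom c' \<and> f z \<in> cdom d \<and> cmap c' z \<noteq> cmap c' y \<and> simple z"
    and along': "\<And>\<rho> \<mu> e. \<rho> \<in> {1, -1} \<Longrightarrow> \<mu> \<in> {1, -1} \<Longrightarrow>
       sector_value d (cmap d (f y)) (\<rho> *\<^sub>R ?t' + (\<mu> * \<kappa>') *\<^sub>R rot ?t') e \<Longrightarrow>
       \<forall>\<^sub>F z in at y within B. \<rho> * (cmap c' z - cmap c' y) > 0 \<longrightarrow> left_value c' d z = (if \<mu> = 1 then e else e + 1)"
    by (rule left_value_along_branch[OF br' D' \<kappa>1]) (rule that)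
  have X: "\<forall>\<^sub>F z in at x within B. \<rho> * (cmap c z - cmap c x) > 0 \<longrightarrow>
      left_value c d z = (if \<mu> = 1 then e \<mu> (- \<rho> * s) else e \<mu> (- \<rho> * s) + 1)"
    if \<rho>: "\<rho> \<in> {1, -1}" and \<mu>: "\<mu> \<in> {1, -1}" for \<rho> \<mu>
  proof (rule along[OF \<rho> \<mu> e[OF \<mu>]])
    show "- \<rho> * s \<in> {1, -1}" using \<rho> s by auto
    have "\<mu> * \<mu> = 1" "\<rho> * \<rho> = 1" "s * s = 1" using \<rho> \<mu> s by auto
    then have "\<mu> * det2 ?t (\<rho> *\<^sub>R ?t + (\<mu> * \<kappa>) *\<^sub>R rot ?t) = \<kappa> * (norm ?t)\<^sup>2"
      by (simp add: det2_simps det2_rot mult.assoc[symmetric])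
    then show "\<mu> * det2 ?t (\<rho> *\<^sub>R ?t + (\<mu> * \<kappa>) *\<^sub>R rot ?t) > 0" using \<kappa> T by simp
    have "\<bar>\<mu> * \<kappa> * det2 ?t' (rot ?t)\<bar> < \<bar>?D\<bar>"
      using abs_det2_le[of ?t' "rot ?t"] by (intro dom \<kappa> \<mu>) (simp add: mult.commute)
    moreover have "det2 ?t' (\<rho> *\<^sub>R ?t + (\<mu> * \<kappa>) *\<^sub>R rot ?t) = - \<rho> * ?D + \<mu> * \<kappa> * det2 ?t' (rot ?t)"
      by (simp add: det2_simps det2_swap[of ?t' ?t])
    ultimately show "- \<rho> * s * det2 ?t' (\<rho> *\<^sub>R ?t + (\<mu> * \<kappa>) *\<^sub>R rot ?t) > 0"
      using \<rho> s by (auto simp: algebra_simps)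
  qed
  have Y: "\<forall>\<^sub>F z in at y within B. \<rho> * (cmap c' z - cmap c' y) > 0 \<longrightarrow>
      left_value c' d z = (if \<mu> = 1 then e (\<rho> * s) \<mu> else e (\<rho> * s) \<mu> + 1)"
    if \<rho>: "\<rho> \<in> {1, -1}" and \<mu>: "\<mu> \<in> {1, -1}" for \<rho> \<mu>
  proof (rule along'[OF \<rho> \<mu>, folded xy(4), OF e[OF _ \<mu>]])
    show "\<rho> * s \<in> {1, -1}" using \<rho> s by auto
    have "\<mu> * \<mu> = 1" using \<mu> by auto
    then have "\<mu> * det2 ?t' (\<rho> *\<^sub>R ?t' + (\<mu> * \<kappa>') *\<^sub>R rot ?t') = \<kappa>' * (norm ?t')\<^sup>2"
      by (simp add: det2_simps det2_rot mult.assoc[symmetric])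
    then show "\<mu> * det2 ?t' (\<rho> *\<^sub>R ?t' + (\<mu> * \<kappa>') *\<^sub>R rot ?t') > 0" using \<kappa>' T' by simp
    have "\<bar>\<mu> * \<kappa>' * det2 ?t (rot ?t')\<bar> < \<bar>?D\<bar>"
      using abs_det2_le[of ?t "rot ?t'"] by (intro dom \<kappa>' \<mu>) simp
    moreover have "det2 ?t (\<rho> *\<^sub>R ?t' + (\<mu> * \<kappa>') *\<^sub>R rot ?t') = \<rho> * ?D + \<mu> * \<kappa>' * det2 ?t (rot ?t')"
      by (simp add: det2_simps)
    ultimately show "\<rho> * s * det2 ?t (\<rho> *\<^sub>R ?t' + (\<mu> * \<kappa>') *\<^sub>R rot ?t') > 0"
      using \<rho> s by (auto simp: algebra_simps)
  qed
  have pm: "(1::real) \<in> {1, -1}" "(-1::real) \<in> {1, -1}" by auto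
  have crossX: "e 1 \<sigma> = e (-1) \<sigma> + 1" if \<sigma>: "\<sigma> \<in> {1, -1}" for \<sigma>
  proof -
    define \<rho> where "\<rho> = - \<sigma> * s"
    have \<rho>: "\<rho> \<in> {1, -1}" "- \<rho> * s = \<sigma>" using \<sigma> s by (auto simp: \<rho>_def)
    have "\<forall>\<^sub>F z in at x within B. \<rho> * (cmap c z - cmap c x) > 0 \<longrightarrow> e 1 \<sigma> = e (-1) \<sigma> + 1"
      using X[OF \<rho>(1) pm(1)] X[OF \<rho>(1) pm(2)] unfolding \<rho>(2) by eventually_elim auto
    from side_nonempty[OF c(1,2) \<rho>(1) this] show ?thesis by blast
  qed
  have crossY: "e \<sigma> 1 = e \<sigma> (-1) + 1" if \<sigma>: "\<sigma> \<in> {1, -1}" for \<sigma>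
  proof -
    define \<rho> where "\<rho> = \<sigma> * s"
    have \<rho>: "\<rho> \<in> {1, -1}" "\<rho> * s = \<sigma>" using \<sigma> s by (auto simp: \<rho>_def)
    have "\<forall>\<^sub>F z in at y within B. \<rho> * (cmap c' z - cmap c' y) > 0 \<longrightarrow> e \<sigma> 1 = e \<sigma> (-1) + 1"
      using Y[OF \<rho>(1) pm(1)] Y[OF \<rho>(1) pm(2)] unfolding \<rho>(2) by eventually_elim auto
    from side_nonempty[OF c(3,4) \<rho>(1) this] show ?thesis by blast
  qed
  \<comment> \<open>The four sectors have alternating values.\<close>
  have alt: "e 1 (- s) = e 1 s + 1" "e s 1 = e 1 s" "e (- s) 1 = e 1 s + 1"
    using s(1) crossX[OF pm(1)] crossX[OF pm(2)] crossY[OF pm(1)] crossY[OF pm(2)]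
    by (cases "e 1 1"; auto)+
  show ?thesis
  proof (rule that)
    show "\<forall>\<^sub>F z in at x within B. z \<in> cdom c \<and> f z \<in> cdom d \<and> simple z \<and>
       left_value c d z = (if cmap c z < cmap c x then e 1 s else e 1 s + 1)"
      using near X[OF pm(2,1)] X[OF pm(1,1)] by eventually_elim (use alt in auto)
    show "\<forall>\<^sub>F z in at y within B. z \<in> cdom c' \<and> f z \<in> cdom d \<and> simple z \<and>
       left_value c' d z = (if cmap c' z < cmap c' y then e 1 s + 1 else e 1 s)"
      using near' Y[OF pm(2,1)] Y[OF pm(1,1)] by eventually_elim (use alt in auto)
  qed
qed

text \<open>
  This orients each arc as part of the boundary of the region on its left. The region on its right
  induces the same orientation, since on crossing the arc both the side and the flip orientation
  are reversed.
\<close>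

definition arc_sign :: "('m, real) chart \<Rightarrow> 'm \<Rightarrow> real" where
  "arc_sign c x = (if left_value c (SOME d. d \<in> AS \<and> f x \<in> cdom d) x = 0 then 1 else -1)"

lemma arc_sign_eq:
  assumes "simple x" "c \<in> AB" "x \<in> cdom c" "d \<in> AS" "f x \<in> cdom d"
  shows "arc_sign c x = (if left_value c d x = 0 then 1 else -1)"
proof -
  let ?e = "SOME d. d \<in> AS \<and> f x \<in> cdom d"
  have "?e \<in> AS \<and> f x \<in> cdom ?e" by (rule someI[of _ d]) (use assms in simp)
  then have "left_value c ?e x = left_value c d x"
    using left_value_change_surface_chart[OF assms] by blast
  then show ?thesis by (simp add: arc_sign_def)
qed

lemma end_points: "\<Union>(chords B f) = {x \<in> B. \<not> simple x}"
  by (auto simp: chords_def simple_def)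

lemma arc_sign_orients:
  assumes "a \<subseteq> B - \<Union>(chords B f)"
  shows "orients AB a arc_sign"
  unfolding orients_def
proof (intro conjI ballI)
  have sim: "simple x" "f x \<in> S" if "x \<in> a" for x
    using that assms curve_in_surface by (auto simp: end_points)
  fix c assume c: "c \<in> AB"
  show "arc_sign c ` (a \<inter> cdom c) \<subseteq> {1, -1}" by (auto simp: arc_sign_def)
  show "continuous_on (a \<inter> cdom c) (arc_sign c)"
    unfolding continuous_on_def
  proof
    fix x assume x: "x \<in> a \<inter> cdom c"
    obtain d where d: "d \<in> AS" "f x \<in> cdom d" using chart_at sim(2)[of x] x by blast
    have sx: "simple x" "x \<in> cdom c" using sim(1) x by auto
    have "\<forall>\<^sub>F z in at x within B. arc_sign c z = arc_sign c x"
      using left_value_locally_constant[OF sx(1) c sx(2) d]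
      by eventually_elim (simp add: arc_sign_eq[OF _ c _ d(1)] sx d)
    moreover have "at x within (a \<inter> cdom c) \<le> at x within B" using assms by (intro at_le) auto
    ultimately have "\<forall>\<^sub>F z in at x within (a \<inter> cdom c). arc_sign c z = arc_sign c x"
      by (metis filter_leD)
    then show "(arc_sign c \<longlongrightarrow> arc_sign c x) (at x within (a \<inter> cdom c))"
      by (rule tendsto_eventually)
  qed
next
  have sim: "simple x" "f x \<in> S" if "x \<in> a" for x
    using that assms curve_in_surface by (auto simp: end_points)
  fix c c' x assume c: "c \<in> AB" "c' \<in> AB" and x: "x \<in> a \<inter> cdom c \<inter> cdom c'"
  obtain d where d: "d \<in> AS" "f x \<in> cdom d" using chart_at sim(2)[of x] x by blast
  have sx: "simple x" "x \<in> cdom c" "x \<in> cdom c'" using sim(1) x by auto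
  note ch = left_value_change_base_chart[OF sx(1) c(1) sx(2) c(2) sx(3) d]
  show "arc_sign c' x = sgn (deriv (cmap c' \<circ> cinv c) (cmap c x)) * arc_sign c x"
    unfolding arc_sign_eq[OF sx(1) c(1) sx(2) d] arc_sign_eq[OF sx(1) c(2) sx(3) d]
    using ch by (cases "deriv (cmap c' \<circ> cinv c) (cmap c x) > 0"; cases "left_value c d x") (auto simp: sgn_if)
qed

text \<open>
  Any pair of charts at the two ends of a chord yields one attractive and one repulsive end. As a
  point cannot be both, fixing the chart at one end shows that the outcome is the same for all
  charts at the other one.
\<close>

lemma chord_ends:
  assumes xy: "x \<in> B" "y \<in> B" "x \<noteq> y" "f x = f y"
  shows "attractive B AB arc_sign x \<and> repulsive B AB arc_sign y \<or>
         attractive B AB arc_sign y \<and> repulsive B AB arc_sign x"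
proof -
  let ?A = "\<lambda>c x. \<forall>\<^sub>F z in at x within B. arc_sign c z = (if cmap c z < cmap c x then 1 else -1)"
  let ?R = "\<lambda>c x. \<forall>\<^sub>F z in at x within B. arc_sign c z = (if cmap c z < cmap c x then -1 else 1)"
  obtain d where d: "d \<in> AS" "f x \<in> cdom d" using chart_at curve_in_surface[OF xy(1)] by blast
  have alt: "?A c x \<and> ?R c' y \<or> ?R c x \<and> ?A c' y"
    if c: "c \<in> AB" "x \<in> cdom c" "c' \<in> AB" "y \<in> cdom c'" for c c'
  proof -
    obtain b where b:
      "\<forall>\<^sub>F z in at x within B. z \<in> cdom c \<and> f z \<in> cdom d \<and> simple z \<and>
         left_value c d z = (if cmap c z < cmap c x then b else b + 1)"
      "\<forall>\<^sub>F z in at y within B. z \<in> cdom c' \<and> f z \<in> cdom d \<and> simple z \<and>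
         left_value c' d z = (if cmap c' z < cmap c' y then b + 1 else b)"
      by (rule left_value_at_double_point[OF xy c d])
    show ?thesis
    proof (cases "b = 0")
      case True
      have "?A c x" using b(1) by eventually_elim (simp add: arc_sign_eq[OF _ c(1) _ d(1)] True)
      moreover have "?R c' y" using b(2) by eventually_elim (simp add: arc_sign_eq[OF _ c(3) _ d(1)] True)
      ultimately show ?thesis by blast
    next
      case False
      then have b1: "b = 1" by simp
      have "?R c x" using b(1) by eventually_elim (simp add: arc_sign_eq[OF _ c(1) _ d(1)] b1)
      moreover have "?A c' y" using b(2) by eventually_elim (simp add: arc_sign_eq[OF _ c(3) _ d(1)] b1)
      ultimately show ?thesis by blast
    qed
  qed
  have excl: "\<not> (?A c x \<and> ?R c x)" if c: "c \<in> AB" "x \<in> cdom c" for c x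
  proof
    assume AR: "?A c x \<and> ?R c x"
    have "\<forall>\<^sub>F z in at x within B. 1 * (cmap c z - cmap c x) > 0 \<longrightarrow> False"
      using AR[THEN conjunct1] AR[THEN conjunct2] by eventually_elim (auto split: if_splits)
    from side_nonempty[OF c _ this] show False by simp
  qed
  obtain c0 where c0: "c0 \<in> AB" "x \<in> cdom c0" using base.chart_at xy(1) by blast
  show ?thesis
  proof (cases "?A c0 x")
    case True
    then have R: "?R c' y" if "c' \<in> AB" "y \<in> cdom c'" for c'
      using alt[OF c0 that] excl[OF c0] by blast
    obtain c1 where c1: "c1 \<in> AB" "y \<in> cdom c1" using base.chart_at xy(2) by blast
    have "?A c x" if "c \<in> AB" "x \<in> cdom c" for c
      using alt[OF that c1] R[OF c1] excl[OF c1] by blast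
    then show ?thesis using R unfolding attractive_def repulsive_def by blast
  next
    case False
    then have A: "?A c' y" if "c' \<in> AB" "y \<in> cdom c'" for c'
      using alt[OF c0 that] by blast
    obtain c1 where c1: "c1 \<in> AB" "y \<in> cdom c1" using base.chart_at xy(2) by blast
    have "?R c x" if "c \<in> AB" "x \<in> cdom c" for c
      using alt[OF that c1] A[OF c1] excl[OF c1] by blast
    then show ?thesis using A unfolding attractive_def repulsive_def by blast
  qed
qed

lemma arc_sign_orientation: "chord_diagram_orientation B AB (chords B f) arc_sign"
  unfolding chord_diagram_orientation_def
proof (intro conjI ballI)
  fix a assume "a \<in> components (B - \<Union>(chords B f))"
  then show "orients AB a arc_sign" by (intro arc_sign_orients in_components_subset)
next
  fix k assume "k \<in> chords B f"
  then obtain x y where k: "k = {x, y}" and xy: "x \<in> B" "y \<in> B" "x \<noteq> y" "f x = f y"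
    unfolding chords_def by blast
  have "k = {y, x}" using k by blast
  then show "\<exists>p q. k = {p, q} \<and> attractive B AB arc_sign p \<and> repulsive B AB arc_sign q"
    using chord_ends[OF xy] k by blast
next
  fix p assume "p \<in> \<Union>(chords B f)"
  then obtain k where "k \<in> chords B f" "p \<in> k" by blast
  then obtain x y where "p = x \<or> p = y" and xy: "x \<in> B" "y \<in> B" "x \<noteq> y" "f x = f y"
    unfolding chords_def by blast
  then show "attractive B AB arc_sign p \<or> repulsive B AB arc_sign p"
    using chord_ends[OF xy] by blast
qed

end

theorem theorem6:
  fixes S :: "'s::{t2_space, second_countable_topology} set"
    and AS :: "('s, real^2) chart set"
    and B :: "'m::{t2_space, second_countable_topology} set"
    and AB :: "('m, real) chart set"
    and f :: "'m \<Rightarrow> 's"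
  assumes surface: "smooth_manifold S AS"
    and closed_base: "smooth_manifold B AB" "compact B"
    and generic: "generic_immersion B AB S AS f"
    and dual: "dual_to_w1 B AB S AS f"
  shows "orientable_chord_diagram B AB (chords B f)"
proof -
  interpret curve_dual_to_w1 S AS B AB f
    by unfold_locales (fact surface closed_base generic dual)+
  show ?thesis
    unfolding orientable_chord_diagram_def using arc_sign_orientation by blast
qed

end
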